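(* Let $(X_t)_{t\in\mathbb{N}}$ be i.i.d. random variables distributed as $X$, with mean $\mu>0$ and finite standard deviation $\sigma>0$, where the distribution of $X$ is known up to the parameter $\mu\in(0,\infty)$. Let $S_t=X_1+\dots+X_t$, $S_0=0$. For $\Delta>0$ let $\tau_0=0$ and $\tau_n=\inf\{t\ge\tau_{n-1}:S_t-S_{\tau_{n-1}}\ge\Delta\}$ for $n\in\mathbb{N}$, and let $\tau=\tau_1$, $\delta=\mathsf{E}[\tau]$, $\eta=S_\tau-\Delta$, $N(t)=\max\{n:\tau_n\le t\}$, $\tau(t)=\tau_{N(t)}$, $$\hat\mu_t=\frac{N(t)\,\Delta}{\tau(t)},\qquad\check\mu_t=\frac{N(t)\,\Delta}{t}.$$ Let $\rho(\mu)=\dfrac{\mathsf{E}[S_{\tau_+}^2]}{2\,\mathsf{E}[S_{\tau_+}]}$ with $\tau_+=\inf\{t\in\mathbb{N}:S_t>0\}$, and $g(x)=x\,(1+\rho(x)/\Delta)$ for $x>0$. Suppose that $X$ is non-lattice and (A1) $\mathsf{E}[|X|^{r+1}]<\infty$ for some $r\ge2$; (A2) $|\mathsf{E}[\eta]-\rho(\mu)|=O(\Delta^{-(r-1)})$ as $\Delta\to\infty$ for some $r\ge2$; (A3) $\mu\mapsto\rho(\mu)$ is a Lipschitz function on $(0,\infty)$. Then: (i) as $\delta,t\to\infty$ so that $t^{1/4}=o(\delta)$ and $\delta=o(\sqrt t)$, $$\frac{g(\check\mu_t)-\mu}{\sigma/\sqrt t}\longrightarrow\mathcal{N}(0,1)\quad\text{in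 distribution};$$ (ii) as $\delta,t\to\infty$ so that $t^{1/4}=o(\delta)$ and $\delta=o(t)$, $$\frac{g(\hat\mu_t)-\mu}{\sigma/\sqrt t}\longrightarrow\mathcal{N}(0,1)\quad\text{in distribution}.$$
   Context: There is a family of distributions indexed by the mean $\mu\in(0,\infty)$, each with finite variance; $\rho(\mu)$ is computed under the member of the family with mean $\mu$, so that $\rho$ is a function on $(0,\infty)$. The data $(X_t)$ follow the member with the fixed true value $\mu$, and $\sigma$, (A1), (A2) and the non-lattice assumption refer to that law. Non-lattice: there is no $d>0$ with $\mathsf{P}(X\in d\mathbb{Z})=1$. The period $\delta=\delta(\Delta)$ is controlled by $\Delta$, so "$\delta\to\infty$" means $\Delta\to\infty$. On the event $\{t<\tau_1\}$, where $N(t)=0$, the estimators $g(\check\mu_t)$ and $g(\hat\mu_t)$ may be given any fixed value (e.g. $0$). Limits refer to any joint limit in $(\delta,t)$ satisfying the indicated growth relations. *)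

theory Defs
  imports "HOL-Probability.Probability" "HOL-Library.Landau_Symbols"
begin

text \<open>Sequences \<open>X :: nat \<Rightarrow> 'a \<Rightarrow> real\<close> are read from index \<open>1\<close> on; \<open>X 0\<close> is never used.\<close>

definition walk :: "(nat \<Rightarrow> 'a \<Rightarrow> real) \<Rightarrow> nat \<Rightarrow> 'a \<Rightarrow> real" where
  "walk X t \<omega> = (\<Sum>i=1..t. X i \<omega>)"

text \<open>Passage times live in \<^typ>\<open>enat\<close>, where \<open>Inf {} = \<infinity>\<close>, so that a level which is never
  reached is reached at time \<open>\<infinity>\<close>.\<close>

primrec crossing_time :: "(nat \<Rightarrow> 'a \<Rightarrow> real) \<Rightarrow> real \<Rightarrow> nat \<Rightarrow> 'a \<Rightarrow> enat" where
  "crossing_time X \<Delta> 0 \<omega> = 0"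
| "crossing_time X \<Delta> (Suc n) \<omega> =
     (case crossing_time X \<Delta> n \<omega> of
        enat s \<Rightarrow> Inf {enat t | t. s \<le> t \<and> walk X t \<omega> - walk X s \<omega> \<ge> \<Delta>}
      | \<infinity> \<Rightarrow> \<infinity>)"

definition ladder_time :: "(nat \<Rightarrow> 'a \<Rightarrow> real) \<Rightarrow> 'a \<Rightarrow> enat" where
  "ladder_time X \<omega> = Inf {enat t | t. walk X t \<omega> > 0}"

text \<open>The value \<open>0\<close> on \<open>{T = \<infinity>}\<close> is a convention; for the two passage times above this is a
  null event when the steps are i.i.d. with positive mean.\<close>

definition stopped_walk :: "(nat \<Rightarrow> 'a \<Rightarrow> real) \<Rightarrow> ('a \<Rightarrow> enat) \<Rightarrow> 'a \<Rightarrow> real" where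
  "stopped_walk X T \<omega> = (case T \<omega> of enat k \<Rightarrow> walk X k \<omega> | \<infinity> \<Rightarrow> 0)"

definition mean_period :: "'a measure \<Rightarrow> (nat \<Rightarrow> 'a \<Rightarrow> real) \<Rightarrow> real \<Rightarrow> real" where
  "mean_period M X \<Delta> = enn2real (\<integral>\<^sup>+\<omega>. ennreal_of_enat (crossing_time X \<Delta> 1 \<omega>) \<partial>M)"

definition overshoot :: "(nat \<Rightarrow> 'a \<Rightarrow> real) \<Rightarrow> real \<Rightarrow> 'a \<Rightarrow> real" where
  "overshoot X \<Delta> \<omega> = stopped_walk X (crossing_time X \<Delta> 1) \<omega> - \<Delta>"

definition crossing_count :: "(nat \<Rightarrow> 'a \<Rightarrow> real) \<Rightarrow> real \<Rightarrow> nat \<Rightarrow> 'a \<Rightarrow> nat" where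
  "crossing_count X \<Delta> t \<omega> = Max {n. crossing_time X \<Delta> n \<omega> \<le> enat t}"

definition last_crossing :: "(nat \<Rightarrow> 'a \<Rightarrow> real) \<Rightarrow> real \<Rightarrow> nat \<Rightarrow> 'a \<Rightarrow> nat" where
  "last_crossing X \<Delta> t \<omega> = the_enat (crossing_time X \<Delta> (crossing_count X \<Delta> t \<omega>) \<omega>)"

definition mu_hat :: "(nat \<Rightarrow> 'a \<Rightarrow> real) \<Rightarrow> real \<Rightarrow> nat \<Rightarrow> 'a \<Rightarrow> real" where
  "mu_hat X \<Delta> t \<omega> = real (crossing_count X \<Delta> t \<omega>) * \<Delta> / real (last_crossing X \<Delta> t \<omega>)"

definition mu_check :: "(nat \<Rightarrow> 'a \<Rightarrow> real) \<Rightarrow> real \<Rightarrow> nat \<Rightarrow> 'a \<Rightarrow> real" where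
  "mu_check X \<Delta> t \<omega> = real (crossing_count X \<Delta> t \<omega>) * \<Delta> / real t"

text \<open>\<open>\<rho>\<close> depends only on the law \<open>D\<close> of a step, so it is evaluated on the canonical space of
  i.i.d. sequences with law \<open>D\<close>.\<close>

definition rho :: "real measure \<Rightarrow> real" where
  "rho D =
     (let P = (\<Pi>\<^sub>M i\<in>(UNIV :: nat set). D);
          H = stopped_walk (\<lambda>i \<omega>. \<omega> i) (ladder_time (\<lambda>i \<omega>. \<omega> i))
      in (\<integral>\<omega>. (H \<omega>)\<^sup>2 \<partial>P) / (2 * (\<integral>\<omega>. H \<omega> \<partial>P)))"

text \<open>\<open>F m\<close> is the member with mean \<open>m\<close> of the family of laws.\<close>

definition bias_correction :: "(real \<Rightarrow> real measure) \<Rightarrow> real \<Rightarrow> real \<Rightarrow> real" where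
  "bias_correction F \<Delta> x = x * (1 + rho (F x) / \<Delta>)"

text \<open>The argument \<open>c\<close> is the arbitrary value given to the estimators before the first crossing.\<close>

definition corrected_hat ::
    "(real \<Rightarrow> real measure) \<Rightarrow> real \<Rightarrow> (nat \<Rightarrow> 'a \<Rightarrow> real) \<Rightarrow> real \<Rightarrow> nat \<Rightarrow> 'a \<Rightarrow> real" where
  "corrected_hat F c X \<Delta> t \<omega> =
     (if crossing_count X \<Delta> t \<omega> = 0 then c else bias_correction F \<Delta> (mu_hat X \<Delta> t \<omega>))"

definition corrected_check ::
    "(real \<Rightarrow> real measure) \<Rightarrow> real \<Rightarrow> (nat \<Rightarrow> 'a \<Rightarrow> real) \<Rightarrow> real \<Rightarrow> nat \<Rightarrow> 'a \<Rightarrow> real" where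
  "corrected_check F c X \<Delta> t \<omega> =
     (if crossing_count X \<Delta> t \<omega> = 0 then c else bias_correction F \<Delta> (mu_check X \<Delta> t \<omega>))"

end

theory Submission
  imports Defs "HOL-Real_Asymp.Real_Asymp"
begin

text \<open>
  Let \<open>M t = S t - \<mu> t\<close>, \<open>e\<close> the mean overshoot, \<open>T = \<tau>(t)\<close>, \<open>N = N(t)\<close>, and \<open>Z\<close> the sum of the
  centred overshoots of the first \<open>N\<close> periods. Since \<open>S T = N \<Delta> + N e + Z\<close>,
  \<open>g(hat \<mu>) - \<mu> = (M T + N (\<rho>(hat \<mu>) - e) - Z) / T\<close> and
  \<open>g(check \<mu>) - \<mu> = (M T + N (\<rho>(check \<mu>) - e) - Z - \<mu> (t - T)) / t\<close>, so both parts follow from the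
  central limit theorem for \<open>M t\<close> once the remaining terms are seen to be \<open>o(sqrt t)\<close> in
  probability. As the open period gains less than \<open>\<Delta>\<close>, \<open>\<mu> (t - T) < \<Delta> + M T - M t\<close>; Kolmogorov's
  inequality on \<open>[0, t]\<close> thus bounds \<open>t - T\<close> by a small multiple of \<open>t\<close>, and a second application
  on a short window before \<open>t\<close> gives \<open>M t - M T = o(sqrt t)\<close>. The variance of \<open>Z\<close> is of order
  \<open>(t / \<Delta>) E \<eta>\<^sup>2\<close>, where \<open>E \<eta>\<^sup>2 = o(\<Delta>)\<close> because \<open>\<eta>\<close> is at most the last step of the period and steps
  have a third moment. Finally \<open>N (\<rho>(hat \<mu>) - e)\<close> is controlled by the Lipschitz condition, (A2) and
  \<open>sqrt t = o(\<Delta>\<^sup>2)\<close>.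
\<close>

section \<open>Independence of past and future on the sequence space\<close>

text \<open>The last epoch \<open>T\<close> looks into the future: it is not a stopping time, so
  neither the centred walk nor the overshoot sum at \<open>T\<close> has directly computable
  moments. The walk is therefore controlled uniformly over windows, and \<open>Z\<close> through all
  periods started by time \<open>t\<close>, since the past decides whether a period starts. Apart
  from the central limit theorem, independence enters in one form: on the product space the first
  \<open>k\<close> coordinates are independent of the sequence after them. Random times thus become
  families of events at deterministic times, each depending on finitely many coordinates, and
  stopped sums become gated sums. The order of \<open>t / \<Delta>\<close> periods each keep a
  corrected bias of order \<open>1/\<Delta> + 1/sqrt t + \<Delta>/t\<close>. Divided by
  \<open>sqrt t\<close> this totals \<open>sqrt t / \<Delta>^2 + 1/\<Delta> + 1/sqrt t\<close>,
  which is where t^(1/4) = o(\<delta>) comes from, \<delta> and \<Delta> being of the same order.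
  The two parts differ in the open period: the divisor \<open>t\<close> leaves
  \<open>\<mu> (t - T) / sqrt t\<close>, of order \<open>\<Delta> / sqrt t\<close>, whereas the
  divisor \<open>T\<close> multiplies \<open>t - T\<close> by \<open>M T / (T sqrt t)\<close>, so
  that \<open>(t - T) / t\<close> tending to 0 suffices.\<close>

definition psum :: "(nat \<Rightarrow> real) \<Rightarrow> nat \<Rightarrow> real" where
  "psum x n = (\<Sum>i<n. x i)"

definition shift :: "nat \<Rightarrow> (nat \<Rightarrow> real) \<Rightarrow> nat \<Rightarrow> real" where
  "shift k x = (\<lambda>i. x (k + i))"

text \<open>This stands in for measurability with respect to the first \<open>k\<close> steps.
  Ordinary measurability on the product space is kept as a separate condition, so no filtration is
  built.\<close>

definition past :: "nat \<Rightarrow> ((nat \<Rightarrow> real) \<Rightarrow> 'b) \<Rightarrow> bool" where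
  "past k f \<longleftrightarrow> (\<forall>x y. (\<forall>i<k. x i = y i) \<longrightarrow> f x = f y)"

lemma psum_0 [simp]: "psum x 0 = 0"
  by (simp add: psum_def)

lemma psum_Suc [simp]: "psum x (Suc n) = psum x n + x n"
  by (simp add: psum_def)

lemma psum_shift: "psum (shift k x) n = psum x (k + n) - psum x k"
  by (induction n) (simp_all add: shift_def)

lemma psum_cong: "(\<And>i. i < n \<Longrightarrow> x i = y i) \<Longrightarrow> psum x n = psum y n"
  by (simp add: psum_def)

lemma shift_0 [simp]: "shift 0 x = x"
  by (simp add: shift_def)

lemma shift_comb_seq [simp]: "shift k (comb_seq k x y) = y"
  by (auto simp: shift_def comb_seq_def)

lemma past_comb_seq: "past k f \<Longrightarrow> f (comb_seq k x y) = f x"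
  unfolding past_def by (metis comb_seq_less)

locale iid_steps = sequence_space D for D :: "real measure" +
  assumes sets_D [measurable_cong, simp]: "sets D = sets borel"
begin

lemma space_D [simp]: "space D = UNIV"
  using sets_eq_imp_space_eq[OF sets_D] by simp

lemma space_S [simp]: "space S = UNIV"
  by (simp add: space_PiM PiE_def)

lemma measurable_psum [measurable]: "(\<lambda>x. psum x n) \<in> borel_measurable S"
  unfolding psum_def by measurable

lemma measurable_shift [measurable]: "shift k \<in> measurable S S"
  unfolding shift_def by (rule measurable_abs_UNIV) measurable

lemma prob_UNIV [simp]: "measure S UNIV = 1"
  using P.prob_space by simp

text \<open>\<open>S\<close> is the image of two independent copies of itself under
  \<open>comb_seq k\<close>, which continues the first \<open>k\<close> coordinates of
  \<open>x\<close> with the sequence \<open>y\<close>. On such a path \<open>f\<close> sees only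
  \<open>x\<close>, \<open>h\<close> after \<open>shift k\<close> sees only \<open>y\<close>, and
  Fubini separates them.\<close>

lemma
  fixes f h :: "(nat \<Rightarrow> real) \<Rightarrow> real"
  assumes f [measurable]: "integrable S f" and h [measurable]: "integrable S h" and past: "past k f"
  shows integrable_past_mult_shift: "integrable S (\<lambda>x. f x * h (shift k x))"
    and integral_past_mult_shift:
      "(\<integral>x. f x * h (shift k x) \<partial>S) = (\<integral>x. f x \<partial>S) * (\<integral>x. h x \<partial>S)"
proof -
  interpret SS: pair_sigma_finite S S ..
  have prod: "integrable (S \<Otimes>\<^sub>M S) (\<lambda>(x, y). f x * h y)"
    using f h by (intro SS.Fubini_integrable) (auto simp: abs_mult)
  have "integrable (distr (S \<Otimes>\<^sub>M S) S (\<lambda>(x, y). comb_seq k x y)) (\<lambda>x. f x * h (shift k x))"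
    by (subst integrable_distr_eq)
       (use prod past in \<open>auto simp: split_beta' past_comb_seq\<close>)
  then show "integrable S (\<lambda>x. f x * h (shift k x))"
    by (simp add: PiM_comb_seq)
  have "(\<integral>x. f x * h (shift k x) \<partial>S) =
        (\<integral>x. f x * h (shift k x) \<partial>distr (S \<Otimes>\<^sub>M S) S (\<lambda>(x, y). comb_seq k x y))"
    by (simp add: PiM_comb_seq)
  also have "\<dots> = (\<integral>z. (case z of (x, y) \<Rightarrow> f x * h y) \<partial>(S \<Otimes>\<^sub>M S))"
    by (subst integral_distr) (use past in \<open>auto simp: split_beta' past_comb_seq\<close>)
  also have "\<dots> = (\<integral>x. (\<integral>y. f x * h y \<partial>S) \<partial>S)"
    using SS.integral_fst'[OF prod] by simp
  finally show "(\<integral>x. f x * h (shift k x) \<partial>S) = (\<integral>x. f x \<partial>S) * (\<integral>x. h x \<partial>S)"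
    by simp
qed

lemma integral_shift: "integrable S h \<Longrightarrow> (\<integral>x. h (shift k x) \<partial>S) = (\<integral>x. h x \<partial>S)"
  for h :: "(nat \<Rightarrow> real) \<Rightarrow> real"
  using integral_past_mult_shift[of "\<lambda>_. 1" h k] by (simp add: past_def P.prob_space)

text \<open>A martingale transform when \<open>h\<close> is centred: the gate \<open>G k\<close>,
  decided by the first \<open>k\<close> steps, switches on a functional of the future. The gates
  used are "no deviation so far", "level not yet reached" (\<open>below\<close>) and "a period
  starts now" (\<open>renewal\<close>).\<close>

definition gated :: "(nat \<Rightarrow> (nat \<Rightarrow> real) \<Rightarrow> bool) \<Rightarrow> ((nat \<Rightarrow> real) \<Rightarrow> real) \<Rightarrow> nat \<Rightarrow> (nat \<Rightarrow> real) \<Rightarrow> real" where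
  "gated G h n x = (\<Sum>k<n. of_bool (G k x) * h (shift k x))"

lemma integrable_of_bool [simp]:
  assumes [measurable]: "Measurable.pred S P"
  shows "integrable S (\<lambda>x. of_bool (P x) :: real)"
  by (intro P.integrable_const_bound[where B=1]) auto

lemma integral_of_bool:
  assumes [measurable]: "Measurable.pred S P"
  shows "(\<integral>x. (of_bool (P x) :: real) \<partial>S) = measure S {x. P x}"
proof -
  have "(\<integral>x. (of_bool (P x) :: real) \<partial>S) = (\<integral>x. indicator {x. P x} x \<partial>S)"
    by (intro Bochner_Integration.integral_cong) (auto simp: indicator_def)
  then show ?thesis by simp
qed

lemma past_of_bool: "past k G \<Longrightarrow> past k (\<lambda>x. of_bool (G x) :: 'c :: zero_neq_one)"
  by (simp add: past_def) metis

text \<open>Wald's identity for truncated sums: a gate and the increment it switches on are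
  independent.\<close>

lemma
  assumes G [measurable]: "\<And>k. Measurable.pred S (G k)" and past: "\<And>k. past k (G k)"
    and h: "integrable S h"
  shows integrable_gated: "integrable S (gated G h n)"
    and integral_gated: "(\<integral>x. gated G h n x \<partial>S) = (\<Sum>k<n. measure S {x. G k x}) * (\<integral>x. h x \<partial>S)"
proof -
  have "integrable S (\<lambda>x. of_bool (G k x) * h (shift k x))" for k
    by (intro integrable_past_mult_shift h past_of_bool past integrable_of_bool G)
  then show "integrable S (gated G h n)"
    unfolding gated_def by (rule Bochner_Integration.integrable_sum)
  have "(\<integral>x. gated G h n x \<partial>S) = (\<Sum>k<n. \<integral>x. of_bool (G k x) * h (shift k x) \<partial>S)"
    unfolding gated_def using \<open>\<And>k. integrable S (\<lambda>x. of_bool (G k x) * h (shift k x))\<close>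
    by (rule Bochner_Integration.integral_sum)
  also have "\<dots> = (\<Sum>k<n. measure S {x. G k x} * (\<integral>x. h x \<partial>S))"
    by (intro sum.cong refl, subst integral_past_mult_shift)
       (auto intro!: h past_of_bool past simp: integral_of_bool)
  finally show "(\<integral>x. gated G h n x \<partial>S) = (\<Sum>k<n. measure S {x. G k x}) * (\<integral>x. h x \<partial>S)"
    by (simp add: sum_distrib_right)
qed

text \<open>Gated centred increments are orthogonal: the gate of a later term and the whole earlier
  term are functions of the steps preceding the later increment.\<close>

lemma
  assumes G [measurable]: "\<And>k. Measurable.pred S (G k)" and past: "\<And>k. past k (G k)"
    and h [measurable]: "h \<in> borel_measurable S" and h2: "integrable S (\<lambda>x. (h x)\<^sup>2)"
    and centred: "(\<integral>x. h x \<partial>S) = 0"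
    and cross: "\<And>k l. k < l \<Longrightarrow> past l (\<lambda>x. of_bool (G l x) * (of_bool (G k x) * h (shift k x)))"
  shows integrable_gated_square: "integrable S (\<lambda>x. (gated G h n x)\<^sup>2)"
    and integral_gated_square:
      "(\<integral>x. (gated G h n x)\<^sup>2 \<partial>S) = (\<Sum>k<n. measure S {x. G k x}) * (\<integral>x. (h x)\<^sup>2 \<partial>S)"
proof -
  let ?U = "\<lambda>k x. of_bool (G k x) * h (shift k x)"
  have h1: "integrable S h"
    by (rule P.square_integrable_imp_integrable[OF h h2])
  have U2: "integrable S (\<lambda>x. (?U k x)\<^sup>2)"
     and iU2: "(\<integral>x. (?U k x)\<^sup>2 \<partial>S) = measure S {x. G k x} * (\<integral>x. (h x)\<^sup>2 \<partial>S)" for k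
  proof -
    have *: "(\<lambda>x. (?U k x)\<^sup>2) = (\<lambda>x. of_bool (G k x) * (h (shift k x))\<^sup>2)"
      by (auto simp: of_bool_def)
    show "integrable S (\<lambda>x. (?U k x)\<^sup>2)"
      unfolding * by (rule integrable_past_mult_shift[where h="\<lambda>x. (h x)\<^sup>2"]) (auto intro!: h2 past_of_bool past)
    show "(\<integral>x. (?U k x)\<^sup>2 \<partial>S) = measure S {x. G k x} * (\<integral>x. (h x)\<^sup>2 \<partial>S)"
      unfolding *
      by (subst integral_past_mult_shift[where h="\<lambda>x. (h x)\<^sup>2"]) (auto intro!: h2 past_of_bool past simp: integral_of_bool)
  qed
  have U1: "integrable S (?U k)" for k
    by (rule P.square_integrable_imp_integrable[OF _ U2]) measurable
  have cr: "integrable S (\<lambda>x. ?U k x * ?U l x)" "(\<integral>x. ?U k x * ?U l x \<partial>S) = 0" if "k < l" for k l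
  proof -
    have i: "integrable S (\<lambda>x. of_bool (G l x) * ?U k x)"
      by (rule Bochner_Integration.integrable_bound[OF U1[of k]]) (auto simp: of_bool_def)
    have *: "(\<lambda>x. ?U k x * ?U l x) = (\<lambda>x. (of_bool (G l x) * ?U k x) * h (shift l x))"
      by (auto simp: fun_eq_iff)
    show "integrable S (\<lambda>x. ?U k x * ?U l x)"
      unfolding * by (rule integrable_past_mult_shift[OF i h1 cross[OF that]])
    show "(\<integral>x. ?U k x * ?U l x \<partial>S) = 0"
      unfolding * by (subst integral_past_mult_shift[OF i h1 cross[OF that]]) (simp add: centred)
  qed
  have "integrable S (\<lambda>x. (gated G h n x)\<^sup>2) \<and>
      (\<integral>x. (gated G h n x)\<^sup>2 \<partial>S) = (\<Sum>k<n. measure S {x. G k x}) * (\<integral>x. (h x)\<^sup>2 \<partial>S)"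
  proof (induction n)
    case 0
    then show ?case by (simp add: gated_def)
  next
    case (Suc n)
    have eq: "(\<lambda>x. (gated G h (Suc n) x)\<^sup>2) =
        (\<lambda>x. (gated G h n x)\<^sup>2 + 2 * (\<Sum>k<n. ?U k x * ?U n x) + (?U n x)\<^sup>2)"
      by (auto simp: gated_def power2_sum sum_distrib_left sum_distrib_right algebra_simps fun_eq_iff
          simp del: of_bool_def sum_of_bool_mult_eq)
    have I: "integrable S (\<lambda>x. \<Sum>k<n. ?U k x * ?U n x)" "(\<integral>x. (\<Sum>k<n. ?U k x * ?U n x) \<partial>S) = 0"
      using cr by (auto simp: Bochner_Integration.integral_sum)
    show ?case
      unfolding eq using Suc I U2[of n] iU2[of n] by (auto simp: algebra_simps)
  qed
  then show "integrable S (\<lambda>x. (gated G h n x)\<^sup>2)"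
    "(\<integral>x. (gated G h n x)\<^sup>2 \<partial>S) = (\<Sum>k<n. measure S {x. G k x}) * (\<integral>x. (h x)\<^sup>2 \<partial>S)"
    by auto
qed

end

section \<open>Passage times of a fixed path\<close>

definition below :: "real \<Rightarrow> nat \<Rightarrow> (nat \<Rightarrow> real) \<Rightarrow> bool" where
  "below \<Delta> k x \<longleftrightarrow> (\<forall>j\<le>k. psum x j < \<Delta>)"

definition crosses_at :: "real \<Rightarrow> nat \<Rightarrow> (nat \<Rightarrow> real) \<Rightarrow> bool" where
  "crosses_at \<Delta> k x \<longleftrightarrow> (\<forall>j<k. psum x j < \<Delta>) \<and> \<Delta> \<le> psum x k"

text \<open>\<open>epoch \<Delta> n s x\<close> is the event that the \<open>n\<close>-th crossing
  time equals \<open>s\<close>, written as a relation instead of an \<open>enat\<close>-valued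
  function. Each instance involves only the first \<open>s\<close> steps, so measurability and
  dependence on the past follow by induction on \<open>n\<close>.\<close>

primrec epoch :: "real \<Rightarrow> nat \<Rightarrow> nat \<Rightarrow> (nat \<Rightarrow> real) \<Rightarrow> bool" where
  "epoch \<Delta> 0 s x \<longleftrightarrow> s = 0"
| "epoch \<Delta> (Suc n) s x \<longleftrightarrow> (\<exists>r\<le>s. epoch \<Delta> n r x \<and> crosses_at \<Delta> (s - r) (shift r x))"

definition renewal :: "real \<Rightarrow> nat \<Rightarrow> (nat \<Rightarrow> real) \<Rightarrow> bool" where
  "renewal \<Delta> s x \<longleftrightarrow> (\<exists>n. epoch \<Delta> n s x)"

text \<open>On a path that never crosses the value is \<open>- \<Delta>\<close>, in agreement with
  \<open>overshoot\<close>, where \<open>stopped_walk\<close> is 0 in that case.\<close>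

definition excess :: "real \<Rightarrow> (nat \<Rightarrow> real) \<Rightarrow> real" where
  "excess \<Delta> x = (if \<exists>k. crosses_at \<Delta> k x then psum x (LEAST k. crosses_at \<Delta> k x) else 0) - \<Delta>"

lemma crosses_at_unique: "crosses_at \<Delta> k x \<Longrightarrow> crosses_at \<Delta> l x \<Longrightarrow> k = l"
  unfolding crosses_at_def by (rule linorder_cases[of k l]) force+

lemma excess_crosses_at: "crosses_at \<Delta> k x \<Longrightarrow> excess \<Delta> x = psum x k - \<Delta>"
  unfolding excess_def using crosses_at_unique[of \<Delta> k x "LEAST k. crosses_at \<Delta> k x"]
  by (auto dest: LeastI[of "\<lambda>k. crosses_at \<Delta> k x"])

lemma not_below_imp_crosses_at:
  assumes "\<not> below \<Delta> n x"
  obtains k where "k \<le> n" "crosses_at \<Delta> k x"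
proof -
  from assms obtain j where j: "j \<le> n" "\<Delta> \<le> psum x j"
    by (auto simp: below_def not_less)
  define k where "k = (LEAST j. \<Delta> \<le> psum x j)"
  have "\<Delta> \<le> psum x k" "k \<le> j"
    unfolding k_def using j by (auto intro: LeastI Least_le)
  moreover have "psum x i < \<Delta>" if "i < k" for i
    using not_less_Least[of i "\<lambda>j. \<Delta> \<le> psum x j"] that unfolding k_def by auto
  ultimately show ?thesis
    using j that[of k] by (auto simp: crosses_at_def)
qed

lemma crosses_at_below: "crosses_at \<Delta> l x \<Longrightarrow> below \<Delta> k x \<longleftrightarrow> k < l"
  unfolding crosses_at_def below_def by (auto simp: not_less) (meson not_less)

lemma crosses_at_pos: "\<Delta> > 0 \<Longrightarrow> crosses_at \<Delta> k x \<Longrightarrow> k > 0"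
  unfolding crosses_at_def by (cases k) auto

lemma epoch_unique: "epoch \<Delta> n s x \<Longrightarrow> epoch \<Delta> n r x \<Longrightarrow> s = r"
proof (induction n arbitrary: s r)
  case (Suc n)
  then obtain p q where "p \<le> s" "epoch \<Delta> n p x" "crosses_at \<Delta> (s - p) (shift p x)"
    "q \<le> r" "epoch \<Delta> n q x" "crosses_at \<Delta> (r - q) (shift q x)" by auto
  moreover from this have "p = q" by (intro Suc.IH)
  ultimately have "s - p = r - p" by (auto intro: crosses_at_unique)
  with \<open>p \<le> s\<close> \<open>q \<le> r\<close> \<open>p = q\<close> show ?case by simp
qed simp

lemma epoch_le:
  assumes "epoch \<Delta> m s x" "n \<le> m"
  obtains r where "r \<le> s" "epoch \<Delta> n r x"
  using assms
proof (induction m arbitrary: s thesis)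
  case (Suc m)
  show ?case
  proof (cases "n = Suc m")
    case False
    from Suc.prems obtain q where "q \<le> s" "epoch \<Delta> m q x" by auto
    moreover obtain r where "r \<le> q" "epoch \<Delta> n r x"
      using Suc.IH[of q] \<open>epoch \<Delta> m q x\<close> False Suc.prems(3) by auto
    ultimately show ?thesis
      by (intro Suc.prems(1)[of r]) auto
  qed (use Suc.prems in auto)
qed auto

lemma epoch_less:
  assumes "\<Delta> > 0" "epoch \<Delta> n r x" "epoch \<Delta> m u x" "m < n"
  shows "u < r"
  using assms(2,4)
proof (induction n arbitrary: r)
  case (Suc n)
  then obtain q where q: "q \<le> r" "epoch \<Delta> n q x" "crosses_at \<Delta> (r - q) (shift q x)" by auto
  from crosses_at_pos[OF \<open>\<Delta> > 0\<close> q(3)] have "q < r" by simp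
  moreover have "u \<le> q"
    using Suc.IH[OF q(2)] epoch_unique[OF assms(3), of q] Suc.prems(2) q(2)
    by (cases "m = n") auto
  ultimately show ?case by simp
qed simp

text \<open>Since \<open>\<Delta> > 0\<close>, every period takes at least one step. This later
  makes the set behind \<open>crossing_count\<close> finite.\<close>

lemma epoch_ge: "\<Delta> > 0 \<Longrightarrow> epoch \<Delta> n s x \<Longrightarrow> n \<le> s"
proof (induction n arbitrary: s)
  case (Suc n)
  then obtain q where q: "q \<le> s" "epoch \<Delta> n q x" "crosses_at \<Delta> (s - q) (shift q x)" by auto
  with Suc.IH[of q] crosses_at_pos[OF \<open>\<Delta> > 0\<close> q(3)] \<open>\<Delta> > 0\<close> show ?case by simp
qed simp

lemma epoch_level: "epoch \<Delta> n s x \<Longrightarrow> real n * \<Delta> \<le> psum x s"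
proof (induction n arbitrary: s)
  case (Suc n)
  then obtain q where q: "q \<le> s" "epoch \<Delta> n q x" "crosses_at \<Delta> (s - q) (shift q x)" by auto
  with Suc.IH[of q] show ?case
    by (auto simp: crosses_at_def psum_shift algebra_simps)
qed simp

text \<open>The period opened at \<open>k\<close> has closed by any later epoch \<open>l\<close>,
  because epochs increase strictly with their index. Hence its overshoot is already known at time
  \<open>l\<close>.\<close>

lemma renewal_next:
  assumes "\<Delta> > 0" "renewal \<Delta> k x" "renewal \<Delta> l x" "k < l"
  obtains u where "k < u" "u \<le> l" "crosses_at \<Delta> (u - k) (shift k x)"
proof -
  from assms obtain n m where nm: "epoch \<Delta> n k x" "epoch \<Delta> m l x"
    by (auto simp: renewal_def)
  have "n < m"
    using epoch_less[OF assms(1) nm(1) nm(2)] epoch_unique[of \<Delta> n k x l] nm \<open>k < l\<close>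
    by (metis linorder_neqE_nat less_asym less_irrefl)
  then obtain u where u: "u \<le> l" "epoch \<Delta> (Suc n) u x"
    using epoch_le[OF nm(2), of "Suc n"] by auto
  then obtain r where "r \<le> u" "epoch \<Delta> n r x" "crosses_at \<Delta> (u - r) (shift r x)" by auto
  moreover from this have "r = k" using epoch_unique[OF nm(1), of r] by simp
  ultimately show ?thesis
    using crosses_at_pos[OF \<open>\<Delta> > 0\<close>, of "u - k"] u that[of u] by auto
qed

text \<open>The overshoots accumulated before an epoch, indexed by the epochs at which their periods
  start.\<close>

lemma epoch_sums:
  assumes "\<Delta> > 0" "epoch \<Delta> n s x"
  shows "(\<Sum>r<s. of_bool (renewal \<Delta> r x)) = real n"
    and "psum x s = real n * \<Delta> + (\<Sum>r<s. of_bool (renewal \<Delta> r x) * excess \<Delta> (shift r x))"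
proof -
  have "(\<Sum>r<s. of_bool (renewal \<Delta> r x)) = real n \<and>
     psum x s = real n * \<Delta> + (\<Sum>r<s. of_bool (renewal \<Delta> r x) * excess \<Delta> (shift r x))"
    using assms(2)
  proof (induction n arbitrary: s)
    case (Suc n)
    then obtain q where q: "q \<le> s" "epoch \<Delta> n q x" "crosses_at \<Delta> (s - q) (shift q x)" by auto
    have "q < s" using crosses_at_pos[OF assms(1) q(3)] by simp
    \<comment> \<open>The epochs \<open>q\<close> and \<open>s\<close> have consecutive indices, and
      strict monotonicity in the index leaves no room for another one between them.\<close>
    have no: "\<not> renewal \<Delta> r x" if "q < r" "r < s" for r
    proof
      assume "renewal \<Delta> r x"
      then obtain m where m: "epoch \<Delta> m r x" by (auto simp: renewal_def)
      have "n < m"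
        using epoch_less[OF assms(1) q(2) m] epoch_unique[of \<Delta> n q x r] q m that
        by (metis linorder_neqE_nat less_asym less_irrefl)
      moreover have "m < Suc n"
        using epoch_less[OF assms(1) m Suc.prems] epoch_unique[OF Suc.prems, of r] m that
        by (metis linorder_neqE_nat less_asym less_irrefl)
      ultimately show False by simp
    qed
    \<comment> \<open>Passing to the next epoch adds exactly the summand at \<open>q\<close>. This
      serves both claims, with the constant 1 and with the overshoot.\<close>
    have sum_eq: "(\<Sum>r<s. of_bool (renewal \<Delta> r x) * f r) =
        (\<Sum>r<q. of_bool (renewal \<Delta> r x) * f r) + f q" for f :: "nat \<Rightarrow> real"
    proof -
      have "{..<s} = {..<q} \<union> {q} \<union> {q<..<s}" using \<open>q < s\<close> by auto
      then have "(\<Sum>r<s. of_bool (renewal \<Delta> r x) * f r) =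
         (\<Sum>r\<in>{..<q} \<union> {q} \<union> {q<..<s}. of_bool (renewal \<Delta> r x) * f r)" by simp
      also have "\<dots> = (\<Sum>r\<in>{..<q} \<union> {q}. of_bool (renewal \<Delta> r x) * f r)"
        using no by (intro sum.mono_neutral_right) auto
      also have "\<dots> = (\<Sum>r<q. of_bool (renewal \<Delta> r x) * f r) + of_bool (renewal \<Delta> q x) * f q"
        by (subst sum.union_disjoint) auto
      also have "\<dots> = (\<Sum>r<q. of_bool (renewal \<Delta> r x) * f r) + f q"
        using q by (auto simp: renewal_def)
      finally show ?thesis .
    qed
    have "psum x s = psum x q + \<Delta> + excess \<Delta> (shift q x)"
      using excess_crosses_at[OF q(3)] q(1) by (simp add: psum_shift)
    then show ?case
      using sum_eq[of "\<lambda>_. 1"] sum_eq[of "\<lambda>r. excess \<Delta> (shift r x)"] Suc.IH[OF q(2)]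
      by (simp add: algebra_simps del: sum_of_bool_mult_eq sum_mult_of_bool_eq)
  qed simp
  then show "(\<Sum>r<s. of_bool (renewal \<Delta> r x)) = real n"
    and "psum x s = real n * \<Delta> + (\<Sum>r<s. of_bool (renewal \<Delta> r x) * excess \<Delta> (shift r x))"
    by auto
qed

section \<open>Passage events as functions of finitely many steps\<close>

lemma pastD: "past k f \<Longrightarrow> (\<And>i. i < k \<Longrightarrow> x i = y i) \<Longrightarrow> f x = f y"
  by (simp add: past_def)

lemma past_psum: "j \<le> k \<Longrightarrow> past k (\<lambda>x. psum x j)"
  unfolding past_def by (auto intro!: psum_cong)

lemma past_below: "past k (below \<Delta> k)"
  unfolding past_def
proof (intro allI impI)
  fix x y :: "nat \<Rightarrow> real" assume "\<forall>i<k. x i = y i"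
  then have "psum x j = psum y j" if "j \<le> k" for j
    using pastD[OF past_psum[OF that], of x y] by simp
  then show "below \<Delta> k x = below \<Delta> k y"
    by (simp add: below_def)
qed

lemma crosses_at_shift_cong:
  assumes "\<And>i. i < s \<Longrightarrow> x i = y i" "r \<le> s"
  shows "crosses_at \<Delta> (s - r) (shift r x) \<longleftrightarrow> crosses_at \<Delta> (s - r) (shift r y)"
proof -
  have "psum (shift r x) j = psum (shift r y) j" if "j \<le> s - r" for j
    using assms that by (intro psum_cong) (auto simp: shift_def)
  then show ?thesis by (auto simp: crosses_at_def)
qed

lemma past_epoch: "past s (epoch \<Delta> n s)"
proof (induction n arbitrary: s)
  case (Suc n)
  show ?case
    unfolding past_def
  proof (intro allI impI)
    fix x y :: "nat \<Rightarrow> real" assume eq: "\<forall>i<s. x i = y i"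
    have "epoch \<Delta> n r x = epoch \<Delta> n r y" if "r \<le> s" for r
      using Suc[of r] eq that unfolding past_def by (metis less_le_trans)
    then show "epoch \<Delta> (Suc n) s x = epoch \<Delta> (Suc n) s y"
      using crosses_at_shift_cong[of s x y] eq by auto
  qed
qed (simp add: past_def)

lemma past_renewal: "past s (renewal \<Delta> s)"
  using past_epoch unfolding past_def renewal_def by blast

text \<open>The overshoot of the period opened at \<open>k\<close> is not determined by any fixed
  number of steps, since the period may be arbitrarily long. Multiplied by the gate of a later epoch
  \<open>l\<close> it is determined by the first \<open>l\<close> steps. This is the hypothesis
  \<open>cross\<close> of the orthogonality lemma.\<close>

lemma past_renewal_cross:
  fixes h :: "real \<Rightarrow> real"
  assumes "\<Delta> > 0" "k < l"
  shows "past l (\<lambda>x. of_bool (renewal \<Delta> l x) * (of_bool (renewal \<Delta> k x) * h (excess \<Delta> (shift k x))))"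
  unfolding past_def
proof (intro allI impI)
  fix x y :: "nat \<Rightarrow> real" assume eq: "\<forall>i<l. x i = y i"
  have 1: "renewal \<Delta> l x = renewal \<Delta> l y" "renewal \<Delta> k x = renewal \<Delta> k y"
    using pastD[OF past_renewal, of l x y] pastD[OF past_renewal, of k x y] eq \<open>k < l\<close> by auto
  have 2: "excess \<Delta> (shift k x) = excess \<Delta> (shift k y)" if ren: "renewal \<Delta> l x" "renewal \<Delta> k x"
  proof -
    obtain u where u: "k < u" "u \<le> l" "crosses_at \<Delta> (u - k) (shift k x)"
      using renewal_next[OF assms(1) ren(2,1) assms(2)] .
    moreover from this have "crosses_at \<Delta> (u - k) (shift k y)"
      using crosses_at_shift_cong[of u x y k] eq by auto
    moreover have "psum (shift k x) (u - k) = psum (shift k y) (u - k)"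
      using eq u by (intro psum_cong) (auto simp: shift_def)
    ultimately show ?thesis using u by (simp add: excess_crosses_at)
  qed
  show "of_bool (renewal \<Delta> l x) * (of_bool (renewal \<Delta> k x) * h (excess \<Delta> (shift k x))) =
        of_bool (renewal \<Delta> l y) * (of_bool (renewal \<Delta> k y) * h (excess \<Delta> (shift k y)))"
    using 1 2 by (auto simp: of_bool_def)
qed

section \<open>Passage times of the statement in terms of path events\<close>

lemma Inf_enat_eq_iff: "Inf {enat t | t. P t} = enat s \<longleftrightarrow> P s \<and> (\<forall>u<s. \<not> P u)"
proof
  assume *: "Inf {enat t | t. P t} = enat s"
  then have ne: "{enat t | t. P t} \<noteq> {}" by (metis Inf_empty enat.distinct(1) top_enat_def)
  from ne obtain t0 where "P t0" by auto
  have "enat s \<in> {enat t | t. P t}"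
  proof -
    have "enat t0 \<in> {enat t | t. P t}" using \<open>P t0\<close> by auto
    then have "(LEAST z. z \<in> {enat t | t. P t}) \<in> {enat t | t. P t}"
      by (rule LeastI)
    then show ?thesis using * ne by (simp only: Inf_enat_def if_False)
  qed
  moreover have "\<not> P u" if "u < s" for u
    using * Inf_lower[of "enat u" "{enat t | t. P t}"] that by force
  ultimately show "P s \<and> (\<forall>u<s. \<not> P u)" by auto
next
  assume "P s \<and> (\<forall>u<s. \<not> P u)"
  then show "Inf {enat t | t. P t} = enat s"
    by (intro antisym Inf_lower Inf_greatest) (auto simp: not_less[symmetric])
qed

lemma walk_eq_psum: "walk X t \<omega> = psum (\<lambda>i. X (Suc i) \<omega>) t"
  unfolding walk_def psum_def by (simp add: sum.atLeast_Suc_atMost_Suc_shift lessThan_Suc_atMost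
     sum.atLeast1_atMost_eq)

lemma crossing_time_eq_enat_iff:
  "crossing_time X \<Delta> n \<omega> = enat s \<longleftrightarrow> epoch \<Delta> n s (\<lambda>i. X (Suc i) \<omega>)"
proof (induction n arbitrary: s)
  case 0
  then show ?case by (auto simp: zero_enat_def)
next
  case (Suc n)
  let ?x = "\<lambda>i. X (Suc i) \<omega>"
  show ?case
  proof (cases "crossing_time X \<Delta> n \<omega>")
    case (enat r)
    have "crossing_time X \<Delta> (Suc n) \<omega> = enat s \<longleftrightarrow>
       (r \<le> s \<and> \<Delta> \<le> psum ?x s - psum ?x r) \<and> (\<forall>u<s. \<not> (r \<le> u \<and> \<Delta> \<le> psum ?x u - psum ?x r))"
      using enat by (simp add: Inf_enat_eq_iff walk_eq_psum)
    also have "\<dots> \<longleftrightarrow> r \<le> s \<and> crosses_at \<Delta> (s - r) (shift r ?x)"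
    proof -
      have "(\<forall>u<s. \<not> (r \<le> u \<and> \<Delta> \<le> psum ?x u - psum ?x r)) \<longleftrightarrow> (\<forall>j<s - r. psum ?x (r + j) - psum ?x r < \<Delta>)"
        if "r \<le> s"
      proof safe
        fix j assume *: "\<forall>u<s. \<not> (r \<le> u \<and> \<Delta> \<le> psum ?x u - psum ?x r)" "j < s - r"
        then show "psum ?x (r + j) - psum ?x r < \<Delta>"
          using *(1)[rule_format, of "r + j"] that by (simp add: not_le)
      next
        fix u assume *: "\<forall>j<s - r. psum ?x (r + j) - psum ?x r < \<Delta>" "u < s" "r \<le> u" "\<Delta> \<le> psum ?x u - psum ?x r"
        then show False
          using *(1)[rule_format, of "u - r"] by (simp add: diff_less_mono)
      qed
      then show ?thesis by (auto simp: crosses_at_def psum_shift)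
    qed
    also have "\<dots> \<longleftrightarrow> epoch \<Delta> (Suc n) s ?x"
    proof -
      have "epoch \<Delta> n r ?x" using Suc.IH[of r] enat by simp
      then have "epoch \<Delta> n q ?x \<longleftrightarrow> q = r" for q
        using epoch_unique[of \<Delta> n q ?x r] by auto
      then show ?thesis by simp
    qed
    finally show ?thesis .
  next
    case infinity
    with Suc.IH show ?thesis by auto
  qed
qed

lemma crossing_time_le_iff:
  "crossing_time X \<Delta> n \<omega> \<le> enat t \<longleftrightarrow> (\<exists>s\<le>t. epoch \<Delta> n s (\<lambda>i. X (Suc i) \<omega>))"
proof (cases "crossing_time X \<Delta> n \<omega>")
  case (enat r)
  then have "epoch \<Delta> n s (\<lambda>i. X (Suc i) \<omega>) \<longleftrightarrow> r = s" for s
    using crossing_time_eq_enat_iff[of X \<Delta> n \<omega> s] by simp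
  with enat show ?thesis by simp
next
  case infinity
  then have "\<not> epoch \<Delta> n s (\<lambda>i. X (Suc i) \<omega>)" for s
    using crossing_time_eq_enat_iff[of X \<Delta> n \<omega> s] by auto
  with infinity show ?thesis by simp
qed

lemma overshoot_eq_excess: "overshoot X \<Delta> \<omega> = excess \<Delta> (\<lambda>i. X (Suc i) \<omega>)"
proof -
  let ?x = "\<lambda>i. X (Suc i) \<omega>"
  have *: "epoch \<Delta> (Suc 0) s ?x \<longleftrightarrow> crosses_at \<Delta> s ?x" for s by auto
  show ?thesis
  proof (cases "crossing_time X \<Delta> (Suc 0) \<omega>")
    case (enat r)
    with crossing_time_eq_enat_iff[of X \<Delta> "Suc 0" \<omega> r] have "crosses_at \<Delta> r ?x"
      by (simp add: * del: crossing_time.simps epoch.simps)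
    from excess_crosses_at[OF this] enat show ?thesis
      by (simp add: overshoot_def stopped_walk_def walk_eq_psum del: crossing_time.simps)
  next
    case infinity
    then have "\<not> (\<exists>k. crosses_at \<Delta> k ?x)"
      using crossing_time_eq_enat_iff[of X \<Delta> "Suc 0" \<omega>] * by (simp del: crossing_time.simps epoch.simps)
    with infinity show ?thesis
      by (simp add: overshoot_def stopped_walk_def excess_def del: crossing_time.simps)
  qed
qed

lemma enat_less_crossing_time_iff:
  "enat k < crossing_time X \<Delta> 1 \<omega> \<longleftrightarrow> below \<Delta> k (\<lambda>i. X (Suc i) \<omega>)"
proof -
  let ?x = "\<lambda>i. X (Suc i) \<omega>"
  have "crossing_time X \<Delta> 1 \<omega> \<le> enat k \<longleftrightarrow> (\<exists>s\<le>k. crosses_at \<Delta> s ?x)"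
    using crossing_time_le_iff[of X \<Delta> "Suc 0" \<omega> k] by (simp del: crossing_time.simps)
  also have "\<dots> \<longleftrightarrow> \<not> below \<Delta> k ?x"
  proof
    assume "\<exists>s\<le>k. crosses_at \<Delta> s ?x"
    then obtain s where "s \<le> k" "crosses_at \<Delta> s ?x" by blast
    then show "\<not> below \<Delta> k ?x" using crosses_at_below[of \<Delta> s ?x k] by simp
  next
    assume "\<not> below \<Delta> k ?x"
    then show "\<exists>s\<le>k. crosses_at \<Delta> s ?x"
      by (rule not_below_imp_crosses_at) auto
  qed
  finally show ?thesis unfolding not_le[symmetric] by blast
qed

text \<open>All three facts rest on the maximum in \<open>crossing_count\<close> being attained: the
  \<open>n\<close>-th crossing cannot occur before time \<open>n\<close>, so the set is contained in
  \<open>{..t}\<close>, and it contains 0.\<close>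

lemma
  assumes "\<Delta> > 0"
  defines "x \<equiv> \<lambda>X \<omega> i. X (Suc i) \<omega>"
  shows epoch_last_crossing:
      "epoch \<Delta> (crossing_count X \<Delta> t \<omega>) (last_crossing X \<Delta> t \<omega>) (x X \<omega>)"
    and last_crossing_le: "last_crossing X \<Delta> t \<omega> \<le> t"
    and epoch_crossing_count_Suc: "s \<le> t \<Longrightarrow> \<not> epoch \<Delta> (Suc (crossing_count X \<Delta> t \<omega>)) s (x X \<omega>)"
proof -
  let ?A = "{n. crossing_time X \<Delta> n \<omega> \<le> enat t}"
  have "?A \<subseteq> {..t}"
  proof
    fix n assume "n \<in> ?A"
    then obtain s where "s \<le> t" "epoch \<Delta> n s (\<lambda>i. X (Suc i) \<omega>)"
      unfolding mem_Collect_eq crossing_time_le_iff by blast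
    with epoch_ge[OF assms(1), of n s "\<lambda>i. X (Suc i) \<omega>"] show "n \<in> {..t}" by simp
  qed
  then have fin: "finite ?A" by (rule finite_subset) simp
  have "0 \<in> ?A" by simp
  then have "?A \<noteq> {}" by blast
  then have "crossing_count X \<Delta> t \<omega> \<in> ?A"
    unfolding crossing_count_def by (rule Max_in[OF fin])
  then obtain q where q: "q \<le> t" "epoch \<Delta> (crossing_count X \<Delta> t \<omega>) q (x X \<omega>)"
    unfolding x_def mem_Collect_eq crossing_time_le_iff by blast
  from q(2) have "last_crossing X \<Delta> t \<omega> = q"
    unfolding last_crossing_def using crossing_time_eq_enat_iff[of X \<Delta> "crossing_count X \<Delta> t \<omega>" \<omega> q] by (simp add: x_def)
  with q show "epoch \<Delta> (crossing_count X \<Delta> t \<omega>) (last_crossing X \<Delta> t \<omega>) (x X \<omega>)"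
    "last_crossing X \<Delta> t \<omega> \<le> t" by simp_all
  have "Suc (crossing_count X \<Delta> t \<omega>) \<notin> ?A"
    unfolding crossing_count_def using Max_ge[OF fin, of "Suc (Max ?A)"] Suc_n_not_le_n by blast
  then show "s \<le> t \<Longrightarrow> \<not> epoch \<Delta> (Suc (crossing_count X \<Delta> t \<omega>)) s (x X \<omega>)"
    unfolding x_def mem_Collect_eq crossing_time_le_iff by blast
qed

text \<open>A gain of \<open>\<Delta>\<close> since the last epoch would give one more crossing no
  later than \<open>t\<close>, contradicting the maximality of
  \<open>crossing_count\<close>.\<close>

lemma psum_after_last_crossing:
  assumes "\<Delta> > 0"
  shows "psum (\<lambda>i. X (Suc i) \<omega>) t - psum (\<lambda>i. X (Suc i) \<omega>) (last_crossing X \<Delta> t \<omega>) < \<Delta>"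
proof (rule ccontr)
  let ?x = "\<lambda>i. X (Suc i) \<omega>"
  define s where "s = last_crossing X \<Delta> t \<omega>"
  define N where "N = crossing_count X \<Delta> t \<omega>"
  have st: "s \<le> t"
    unfolding s_def by (rule last_crossing_le[OF assms])
  assume "\<not> psum ?x t - psum ?x (last_crossing X \<Delta> t \<omega>) < \<Delta>"
  then have "\<not> psum (shift s ?x) (t - s) < \<Delta>"
    using st by (simp add: psum_shift s_def)
  then have "\<not> below \<Delta> (t - s) (shift s ?x)"
    unfolding below_def by blast
  then obtain k where k: "k \<le> t - s" "crosses_at \<Delta> k (shift s ?x)"
    by (rule not_below_imp_crosses_at)
  have "epoch \<Delta> N s ?x"
    unfolding N_def s_def by (rule epoch_last_crossing[OF assms])
  with k have "s \<le> s + k \<and> epoch \<Delta> N s ?x \<and> crosses_at \<Delta> (s + k - s) (shift s ?x)"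
    by simp
  then have "epoch \<Delta> (Suc N) (s + k) ?x"
    unfolding epoch.simps by (rule exI)
  moreover have "s + k \<le> t"
    using k st by linarith
  from epoch_crossing_count_Suc[OF assms this] have "\<not> epoch \<Delta> (Suc N) (s + k) ?x"
    unfolding N_def .
  ultimately show False by (rule notE[rotated])
qed

lemma renewal_after_last_crossing:
  assumes "\<Delta> > 0" "last_crossing X \<Delta> t \<omega> < s" "s \<le> t"
  shows "\<not> renewal \<Delta> s (\<lambda>i. X (Suc i) \<omega>)"
proof
  let ?x = "\<lambda>i. X (Suc i) \<omega>"
  define N where "N = crossing_count X \<Delta> t \<omega>"
  assume "renewal \<Delta> s ?x"
  then obtain m where m: "epoch \<Delta> m s ?x" unfolding renewal_def by blast
  have N: "epoch \<Delta> N (last_crossing X \<Delta> t \<omega>) ?x"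
    unfolding N_def by (rule epoch_last_crossing[OF assms(1)])
  have "\<not> m < N"
    using epoch_less[OF assms(1) N m] assms(2) by (meson less_asym)
  moreover have "m \<noteq> N"
    using epoch_unique[OF N] m assms(2) by (metis less_irrefl)
  ultimately have "Suc N \<le> m" by simp
  with m obtain r where r: "r \<le> s" "epoch \<Delta> (Suc N) r ?x"
    by (rule epoch_le)
  from r(1) assms(3) have "r \<le> t" by simp
  from epoch_crossing_count_Suc[OF assms(1) this] r(2) show False
    unfolding N_def by (rule notE)
qed

section \<open>Moment bounds\<close>

context iid_steps
begin

lemma Collect_in_sets: "Measurable.pred S A \<Longrightarrow> Collect A \<in> sets S"
  by (simp add: pred_def)

lemma measurable_below [measurable]: "Measurable.pred S (below \<Delta> k)"
  unfolding below_def by measurable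

lemma measurable_crosses_at [measurable]: "Measurable.pred S (crosses_at \<Delta> k)"
  unfolding crosses_at_def by measurable

lemma measurable_epoch [measurable]: "Measurable.pred S (epoch \<Delta> n s)"
proof (induction n arbitrary: s)
  case 0
  have "epoch \<Delta> 0 s = (\<lambda>x. s = 0)" by (rule ext) simp
  then show ?case by simp
next
  case (Suc n)
  note Suc [measurable]
  have "epoch \<Delta> (Suc n) s = (\<lambda>x. \<exists>r\<le>s. epoch \<Delta> n r x \<and> crosses_at \<Delta> (s - r) (shift r x))"
    by (rule ext) simp
  then show ?case by simp
qed

lemma measurable_renewal [measurable]: "Measurable.pred S (renewal \<Delta> s)"
  unfolding renewal_def by measurable

lemma measurable_excess [measurable]: "excess \<Delta> \<in> borel_measurable S"
proof -
  have "(\<lambda>x. psum x (LEAST k. crosses_at \<Delta> k x)) \<in> borel_measurable S"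
    by (rule measurable_compose_countable[where g="\<lambda>x. LEAST k. crosses_at \<Delta> k x"]) measurable
  then show ?thesis
    unfolding excess_def by measurable
qed

lemma
  fixes f :: "real \<Rightarrow> real"
  assumes "integrable D f"
  shows integrable_coord: "integrable S (\<lambda>x. f (x i))"
    and integral_coord: "(\<integral>x. f (x i) \<partial>S) = (\<integral>x. f x \<partial>D)"
proof -
  have D: "distr S D (\<lambda>x. x i) = D"
    by (rule PiM_component) simp
  from assms have "integrable (distr S D (\<lambda>x. x i)) f" by (simp add: D)
  then show "integrable S (\<lambda>x. f (x i))"
    by (subst (asm) integrable_distr_eq) (use assms in auto)
  have "(\<integral>x. f x \<partial>D) = (\<integral>x. f x \<partial>distr S D (\<lambda>x. x i))" by (simp add: D)
  also have "\<dots> = (\<integral>x. f (x i) \<partial>S)"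
    by (rule integral_distr) (use assms in auto)
  finally show "(\<integral>x. f (x i) \<partial>S) = (\<integral>x. f x \<partial>D)" ..
qed

lemma measure_shift:
  assumes [measurable]: "Measurable.pred S A"
  shows "measure S {x. A (shift k x)} = measure S {x. A x}"
proof -
  have "measure S {x. A (shift k x)} = (\<integral>x. of_bool (A (shift k x)) \<partial>S)"
    by (rule integral_of_bool[symmetric]) measurable
  also have "\<dots> = (\<integral>x. of_bool (A x) \<partial>S)"
    by (rule integral_shift) auto
  also have "\<dots> = measure S {x. A x}"
    by (rule integral_of_bool) measurable
  finally show ?thesis .
qed

lemma measure_le_square:
  fixes f :: "(nat \<Rightarrow> real) \<Rightarrow> real"
  assumes [measurable]: "f \<in> borel_measurable S" and "integrable S (\<lambda>x. (f x)\<^sup>2)" "a > 0"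
    and "\<And>x. A x \<Longrightarrow> a \<le> \<bar>f x\<bar>"
  shows "measure S {x. A x} \<le> (\<integral>x. (f x)\<^sup>2 \<partial>S) / a\<^sup>2"
proof -
  have "measure S {x. A x} \<le> measure S {x \<in> space S. a \<le> \<bar>f x\<bar>}"
    using assms(4) by (intro P.finite_measure_mono) (auto intro: Collect_in_sets)
  also have "\<dots> \<le> (\<integral>x. (f x)\<^sup>2 \<partial>S) / a\<^sup>2"
    by (rule P.second_moment_method) (use assms in auto)
  finally show ?thesis .
qed

end

lemma (in iid_steps) gated_coord: "gated G (\<lambda>x. f (x 0)) n x = (\<Sum>k<n. of_bool (G k x) * f (x k))"
  by (simp add: gated_def shift_def)

locale walk_law = iid_steps D for D +
  fixes \<mu> :: real
  assumes mu_pos: "\<mu> > 0"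
    and mean_D: "(\<integral>x. x \<partial>D) = \<mu>"
    and third_moment: "integrable D (\<lambda>x. \<bar>x\<bar> ^ 3)"
begin

lemma integrable_D:
  shows "integrable D (\<lambda>x. x\<^sup>2)" "integrable D (\<lambda>x. \<bar>x\<bar>)" "integrable D (\<lambda>x. x)"
proof -
  have i: "integrable D (\<lambda>x. 1 + \<bar>x\<bar> ^ 3)" using third_moment by simp
  have "\<bar>x\<bar> \<le> 1 + \<bar>x\<bar> ^ 3 \<and> x\<^sup>2 \<le> 1 + \<bar>x\<bar> ^ 3" for x :: real
  proof (cases "\<bar>x\<bar> \<le> 1")
    case True
    then have "x\<^sup>2 \<le> 1" by (simp add: abs_square_le_1)
    moreover have "0 \<le> \<bar>x\<bar> ^ 3" by simp
    ultimately show ?thesis using True by linarith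
  next
    case False
    then have "\<bar>x\<bar> ^ 2 \<le> \<bar>x\<bar> ^ 3" "\<bar>x\<bar> ^ 1 \<le> \<bar>x\<bar> ^ 3"
      by (intro power_increasing; simp)+
    then show ?thesis by (simp del: power_increasing_iff)
  qed
  note b = this
  show "integrable D (\<lambda>x. x\<^sup>2)"
    by (rule Bochner_Integration.integrable_bound[OF i]) (use b in auto)
  show 1: "integrable D (\<lambda>x. \<bar>x\<bar>)"
    by (rule Bochner_Integration.integrable_bound[OF i]) (use b in auto)
  show "integrable D (\<lambda>x. x)"
    by (rule Bochner_Integration.integrable_bound[OF 1]) auto
qed

section \<open>Kolmogorov's maximal inequality\<close>

definition "var = (\<integral>x. (x - \<mu>)\<^sup>2 \<partial>D)"

lemma integrable_centred: "integrable D (\<lambda>x. (x - \<mu>)\<^sup>2)"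
proof -
  have "(\<lambda>x. (x - \<mu>)\<^sup>2) = (\<lambda>x. x\<^sup>2 - 2 * \<mu> * x + \<mu>\<^sup>2)"
    by (simp add: power2_diff algebra_simps)
  then show ?thesis using integrable_D by auto
qed

lemma var_nonneg: "var \<ge> 0"
  unfolding var_def by simp

lemma maximal_inequality:
  assumes "a > 0"
  shows "measure S {x. \<exists>k\<le>n. a < \<bar>psum x k - real k * \<mu>\<bar>} \<le> real n * var / a\<^sup>2"
proof -
  let ?c = "\<lambda>x k. psum x k - real k * \<mu>"
  define G where "G k x \<longleftrightarrow> (\<forall>j\<le>k. \<bar>?c x j\<bar> \<le> a)" for k x
  define h where "h = (\<lambda>x :: nat \<Rightarrow> real. x 0 - \<mu>)"
  have G [measurable]: "Measurable.pred S (G k)" for k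
    unfolding G_def by measurable
  have pastG: "past k (G k)" for k
    unfolding past_def
  proof (intro allI impI)
    fix x y :: "nat \<Rightarrow> real" assume "\<forall>i<k. x i = y i"
    then have "psum x j = psum y j" if "j \<le> k" for j
      using pastD[OF past_psum[OF that], of x y] by simp
    then show "G k x = G k y" by (simp add: G_def)
  qed
  have h [measurable]: "h \<in> borel_measurable S"
    unfolding h_def by measurable
  have h2: "integrable S (\<lambda>x. (h x)\<^sup>2)" "(\<integral>x. (h x)\<^sup>2 \<partial>S) = var"
    unfolding h_def var_def using integrable_coord[OF integrable_centred] integral_coord[OF integrable_centred] by auto
  have h1: "(\<integral>x. h x \<partial>S) = 0"
    unfolding h_def using integral_coord[of "\<lambda>x. x - \<mu>" 0] integrable_D mean_D
    by (simp add: M.prob_space[simplified])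
  have cross: "past l (\<lambda>x. of_bool (G l x) * (of_bool (G k x) * h (shift k x)))" if "k < l" for k l
    unfolding past_def
  proof (intro allI impI)
    fix x y :: "nat \<Rightarrow> real" assume *: "\<forall>i<l. x i = y i"
    have "G l x = G l y" "G k x = G k y" "h (shift k x) = h (shift k y)"
      using pastD[OF pastG, of l x y] pastD[OF pastG, of k x y] * that by (auto simp: h_def shift_def)
    then show "of_bool (G l x) * (of_bool (G k x) * h (shift k x)) = of_bool (G l y) * (of_bool (G k y) * h (shift k y))"
      by simp
  qed
  have eq: "gated G h n x = (\<Sum>k<n. of_bool (G k x) * (x k - \<mu>))" for x
    unfolding h_def gated_coord[of _ "\<lambda>u. u - \<mu>"] ..
  have bad: "a \<le> \<bar>gated G h n x\<bar>" if "\<exists>k\<le>n. a < \<bar>?c x k\<bar>" for x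
  proof -
    define k where "k = (LEAST k. a < \<bar>?c x k\<bar>)"
    have k: "a < \<bar>?c x k\<bar>" unfolding k_def using that by (auto intro: LeastI)
    have "k \<le> n" unfolding k_def using that by (auto intro: Least_le[THEN order_trans])
    have good: "\<bar>?c x j\<bar> \<le> a" if "j < k" for j
      using not_less_Least[of j "\<lambda>k. a < \<bar>?c x k\<bar>"] that by (simp add: k_def not_less)
    \<comment> \<open>With \<open>k\<close> the first exit, the gates before \<open>k\<close> are
      open and those from \<open>k\<close> on are closed. As \<open>x l\<close> leads from time
      \<open>l\<close> to \<open>l + 1\<close>, the step that leaves the band is still
      counted.\<close>
    have "gated G h n x = (\<Sum>l<k. of_bool (G l x) * (x l - \<mu>))"
      unfolding eq using \<open>k \<le> n\<close> k
      by (intro sum.mono_neutral_right) (auto simp: G_def not_less not_le)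
    also have "\<dots> = (\<Sum>l<k. (x l - \<mu>))"
      using good by (intro sum.cong) (auto simp: G_def)
    also have "\<dots> = ?c x k" by (simp add: psum_def sum_subtractf)
    finally show ?thesis using k by simp
  qed
  have "measure S {x. \<exists>k\<le>n. a < \<bar>?c x k\<bar>} \<le> (\<integral>x. (gated G h n x)\<^sup>2 \<partial>S) / a\<^sup>2"
  proof (rule measure_le_square)
    show "gated G h n \<in> borel_measurable S" unfolding gated_def by measurable
    show "integrable S (\<lambda>x. (gated G h n x)\<^sup>2)"
      by (rule integrable_gated_square[OF G pastG h h2(1) h1 cross])
  qed (use bad assms in auto)
  also have "(\<integral>x. (gated G h n x)\<^sup>2 \<partial>S) = (\<Sum>k<n. measure S {x. G k x}) * var"
    using integral_gated_square[OF G pastG h h2(1) h1 cross] h2(2) by simp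
  also have "(\<Sum>k<n. measure S {x. G k x}) * var \<le> (\<Sum>k<n. 1) * var"
    by (intro mult_right_mono sum_mono P.prob_le_1 var_nonneg)
  finally show ?thesis
    by (simp add: divide_right_mono)
qed

text \<open>Both \<open>n\<close> and \<open>s\<close> are compared with the fixed time
  \<open>n - m\<close>, which costs the factor 2. The walk restarted at \<open>n - m\<close> has the
  law of the original one, so the maximal inequality over \<open>m\<close> steps applies.\<close>

lemma increment_inequality:
  assumes "a > 0" "m \<le> n"
  shows "measure S {x. \<exists>s. n - m \<le> s \<and> s \<le> n \<and>
      2 * a < \<bar>(psum x n - real n * \<mu>) - (psum x s - real s * \<mu>)\<bar>} \<le> real m * var / a\<^sup>2"
    (is "measure S {x. ?A x} \<le> _")
proof -
  let ?B = "\<lambda>x. \<exists>k\<le>m. a < \<bar>psum x k - real k * \<mu>\<bar>"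
  have "?B (shift (n - m) x)" if A: "?A x" for x
  proof (rule ccontr)
    assume "\<not> ?B (shift (n - m) x)"
    then have B: "\<bar>psum (shift (n - m) x) k - real k * \<mu>\<bar> \<le> a" if "k \<le> m" for k
      using that by (auto simp: not_less)
    obtain s where s: "n - m \<le> s" "s \<le> n"
      "2 * a < \<bar>(psum x n - real n * \<mu>) - (psum x s - real s * \<mu>)\<bar>" using A by auto
    have "\<bar>(psum x j - real j * \<mu>) - (psum x (n - m) - real (n - m) * \<mu>)\<bar> \<le> a" if "n - m \<le> j" "j \<le> n" for j
    proof -
      have "j - (n - m) \<le> m" using that assms(2) by linarith
      from B[OF this] show ?thesis
        using that by (simp add: psum_shift of_nat_diff algebra_simps)
    qed
    from this[OF s(1,2)] this[of n] s(3) show False by force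
  qed
  then have "measure S {x. ?A x} \<le> measure S {x. ?B (shift (n - m) x)}"
    by (intro P.finite_measure_mono) (auto intro!: Collect_in_sets)
  also have "\<dots> = measure S {x. ?B x}"
    by (rule measure_shift) measurable
  also have "\<dots> \<le> real m * var / a\<^sup>2"
    by (rule maximal_inequality[OF assms(1)])
  finally show ?thesis .
qed

section \<open>The mean passage time and one-sided Wald bounds\<close>

lemma gated_below: "below \<Delta> n x \<Longrightarrow> m \<le> Suc n \<Longrightarrow> gated (below \<Delta>) h m x = (\<Sum>k<m. h (shift k x))"
  unfolding gated_def by (intro sum.cong) (auto simp: below_def)

text \<open>The gate \<open>below \<Delta> k\<close> is open exactly while \<open>k\<close> precedes
  the passage time, so gating produces the stopped sum, crossing step included.\<close>

lemma gated_crosses_at: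
  assumes "crosses_at \<Delta> l x" "l \<le> n"
  shows "gated (below \<Delta>) h n x = (\<Sum>k<l. h (shift k x))"
proof -
  have "gated (below \<Delta>) h n x = (\<Sum>k<l. of_bool (below \<Delta> k x) * h (shift k x))"
    unfolding gated_def using assms crosses_at_below[OF assms(1)]
    by (intro sum.mono_neutral_right) auto
  also have "\<dots> = (\<Sum>k<l. h (shift k x))"
    using crosses_at_below[OF assms(1)] by (intro sum.cong) auto
  finally show ?thesis .
qed

definition "tail \<Delta> k = measure S {x. below \<Delta> k x}"

text \<open>The mean passage time in the form of the tail sum formula;
  \<open>mean_period_eq_period\<close> identifies it with \<open>mean_period\<close>.\<close>

definition "period \<Delta> = (\<Sum>k. tail \<Delta> k)"

lemma tail_nonneg: "tail \<Delta> k \<ge> 0" by (simp add: tail_def)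

lemma second_moment_pos: "(\<integral>x. x\<^sup>2 \<partial>D) > 0"
proof -
  have "0 \<le> (\<integral>x. (x - \<mu>)\<^sup>2 \<partial>D)" by simp
  also have "\<dots> = (\<integral>x. x\<^sup>2 - 2 * \<mu> * x + \<mu>\<^sup>2 \<partial>D)"
    by (simp add: power2_diff algebra_simps)
  also have "\<dots> = (\<integral>x. x\<^sup>2 \<partial>D) - 2 * \<mu> * \<mu> + \<mu>\<^sup>2"
    using integrable_D mean_D by (simp add: M.prob_space[simplified])
  finally have "\<mu>\<^sup>2 \<le> (\<integral>x. x\<^sup>2 \<partial>D)" by (simp add: power2_eq_square)
  moreover have "\<mu>\<^sup>2 > 0" using mu_pos by simp
  ultimately show ?thesis by linarith
qed

definition "level_slack = 2 * (\<integral>x. x\<^sup>2 \<partial>D) / \<mu>"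

text \<open>Wald's identity for the truncated passage time, where the last step \<open>x\<close> overshoots by at
  most \<open>K + x\<^sup>2 / K\<close> and \<open>K\<close> is chosen so that the quadratic term eats half of the drift.\<close>

lemma sum_tail_le:
  assumes "\<Delta> > 0"
  shows "(\<Sum>k<n. tail \<Delta> k) \<le> 2 * (\<Delta> + level_slack) / \<mu>"
proof -
  define K where "K = level_slack"
  have K: "K > 0" "(\<integral>x. x\<^sup>2 \<partial>D) / K = \<mu> / 2"
    using second_moment_pos mu_pos by (auto simp: K_def level_slack_def)
  note m = measurable_below past_below
  let ?id = "\<lambda>x :: nat \<Rightarrow> real. x 0" and ?sq = "\<lambda>x :: nat \<Rightarrow> real. (x 0)\<^sup>2"
  have id: "integrable S ?id" "(\<integral>x. ?id x \<partial>S) = \<mu>"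
    using integrable_coord[OF integrable_D(3)] integral_coord[OF integrable_D(3)] mean_D by auto
  have sq: "integrable S ?sq" "(\<integral>x. ?sq x \<partial>S) = (\<integral>x. x\<^sup>2 \<partial>D)"
    using integrable_coord[OF integrable_D(1)] integral_coord[OF integrable_D(1)] by auto
  have sqpos: "0 \<le> gated (below \<Delta>) ?sq n x" for x
    unfolding gated_def by (intro sum_nonneg) auto
  \<comment> \<open>If the level is crossed by time \<open>n\<close>, the walk before the last step
    \<open>x j\<close> is below \<open>\<Delta>\<close>. The last step is at most
    \<open>K + (x j)^2 / K\<close>, and its square is one of the summands of the gated sum of
    squares.\<close>
  have ptw: "gated (below \<Delta>) ?id n x \<le> \<Delta> + K + gated (below \<Delta>) ?sq n x / K" for x
  proof (cases "below \<Delta> n x")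
    case True
    then have "gated (below \<Delta>) ?id n x = psum x n"
      by (subst gated_below) (auto simp: psum_def shift_def)
    also have "\<dots> < \<Delta>" using True by (auto simp: below_def)
    moreover have "0 \<le> gated (below \<Delta>) ?sq n x / K"
      using sqpos K by simp
    ultimately show ?thesis using K by linarith
  next
    case False
    then obtain l where l: "l \<le> n" "crosses_at \<Delta> l x" by (rule not_below_imp_crosses_at)
    from crosses_at_pos[OF assms l(2)] obtain j where j: "l = Suc j" by (cases l) auto
    have "gated (below \<Delta>) ?id n x = psum x j + x j"
      using gated_crosses_at[OF l(2,1), of ?id] by (simp add: shift_def psum_def j)
    also have "psum x j < \<Delta>" using l(2) j by (auto simp: crosses_at_def)
    moreover have "x j \<le> K + (x j)\<^sup>2 / K"
    proof (cases "x j \<le> K")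
      case False
      then have "x j * K \<le> x j * x j" using K by (intro mult_left_mono) auto
      then have "x j \<le> (x j)\<^sup>2 / K" using K by (simp add: power2_eq_square field_simps)
      then show ?thesis using K by simp
    qed (use K in \<open>simp add: add_increasing2\<close>)
    moreover have "(x j)\<^sup>2 \<le> gated (below \<Delta>) ?sq n x"
      using gated_crosses_at[OF l(2,1), of ?sq]
      by (simp add: shift_def j sum_nonneg)
    then have "(x j)\<^sup>2 / K \<le> gated (below \<Delta>) ?sq n x / K"
      using K by (intro divide_right_mono) auto
    ultimately show ?thesis by linarith
  qed
  have gi: "integrable S (gated (below \<Delta>) ?id n)" "integrable S (gated (below \<Delta>) ?sq n)"
    by (rule integrable_gated[OF m id(1)] integrable_gated[OF m sq(1)])+
  have "(\<Sum>k<n. tail \<Delta> k) * \<mu> = (\<integral>x. gated (below \<Delta>) ?id n x \<partial>S)"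
    using integral_gated[OF m id(1), of _ n] id(2) by (simp add: tail_def)
  also have "\<dots> \<le> (\<integral>x. \<Delta> + K + gated (below \<Delta>) ?sq n x / K \<partial>S)"
    by (intro integral_mono ptw) (use gi in auto)
  also have "\<dots> = \<Delta> + K + (\<Sum>k<n. tail \<Delta> k) * ((\<integral>x. x\<^sup>2 \<partial>D) / K)"
    using integral_gated[OF m sq(1), of _ n] sq(2) gi(2) by (simp add: tail_def)
  also have "\<dots> = \<Delta> + K + (\<Sum>k<n. tail \<Delta> k) * \<mu> / 2"
    unfolding K(2) by simp
  \<comment> \<open>The truncated mean reappears on the right with factor \<open>\<mu> / 2\<close>.
    Being a finite sum it can be moved to the left, where half of the drift remains.\<close>
  finally show ?thesis
    using mu_pos by (simp add: K_def field_simps)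
qed

lemma summable_tail: "\<Delta> > 0 \<Longrightarrow> summable (tail \<Delta>)"
  by (rule summableI_nonneg_bounded[OF tail_nonneg sum_tail_le])

lemma period_le: "\<Delta> > 0 \<Longrightarrow> period \<Delta> \<le> 2 * (\<Delta> + level_slack) / \<mu>"
  unfolding period_def by (rule suminf_le_const[OF summable_tail sum_tail_le])

lemma AE_crosses:
  assumes "\<Delta> > 0"
  shows "AE x in S. \<exists>k. crosses_at \<Delta> k x"
proof -
  have "measure S {x. \<forall>k. below \<Delta> k x} \<le> tail \<Delta> k" for k
    unfolding tail_def by (intro P.finite_measure_mono) (auto intro: Collect_in_sets)
  moreover have "tail \<Delta> \<longlonglongrightarrow> 0"
    by (rule summable_LIMSEQ_zero[OF summable_tail[OF assms]])
  ultimately have "measure S {x. \<forall>k. below \<Delta> k x} \<le> 0"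
    by (intro LIMSEQ_le_const) auto
  then have "measure S {x. \<forall>k. below \<Delta> k x} = 0"
    by (intro antisym) auto
  then have "AE x in S. \<not> (\<forall>k. below \<Delta> k x)"
    by (intro AE_I[where N="{x. \<forall>k. below \<Delta> k x}"]) (auto simp: P.emeasure_eq_measure intro: Collect_in_sets)
  then show ?thesis
    by (rule AE_mp) (auto intro!: AE_I2 elim: not_below_imp_crosses_at)
qed

text \<open>The event that the passage time exceeds \<open>k\<close> depends on the steps before
  \<open>x k\<close>, so the expected sum of \<open>f\<close> over one period is
  \<open>period \<Delta>\<close> times the mean of \<open>f\<close>. Domination is required only on
  crossing paths, which have probability one.\<close>

lemma stopped_sum_bound:
  fixes Y :: "(nat \<Rightarrow> real) \<Rightarrow> real" and f :: "real \<Rightarrow> real"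
  assumes "\<Delta> > 0" and [measurable]: "Y \<in> borel_measurable S" and f: "integrable D f" "\<And>u. f u \<ge> 0"
    and Y: "\<And>x l. crosses_at \<Delta> l x \<Longrightarrow> 0 \<le> Y x \<and> Y x \<le> (\<Sum>k<l. f (x k))"
  shows "integrable S Y" "(\<integral>x. Y x \<partial>S) \<le> period \<Delta> * (\<integral>x. f x \<partial>D)"
proof -
  have [measurable]: "f \<in> borel_measurable borel"
    using borel_measurable_integrable[OF f(1)] by simp
  let ?g = "\<lambda>k x. of_bool (below \<Delta> k x) * f (x k)"
  have g: "integrable S (?g k)" "(\<integral>x. ?g k x \<partial>S) = tail \<Delta> k * (\<integral>x. f x \<partial>D)" for k
  proof -
    have *: "?g k = (\<lambda>x. of_bool (below \<Delta> k x) * (\<lambda>y. f (y 0)) (shift k x))"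
      by (simp add: shift_def)
    have i: "integrable S (\<lambda>x. of_bool (below \<Delta> k x) :: real)" "past k (\<lambda>x. of_bool (below \<Delta> k x) :: real)"
      by (auto intro: past_of_bool past_below)
    show "integrable S (?g k)"
      unfolding * by (rule integrable_past_mult_shift[OF i(1) integrable_coord[OF f(1)] i(2)])
    show "(\<integral>x. ?g k x \<partial>S) = tail \<Delta> k * (\<integral>x. f x \<partial>D)"
      unfolding * by (subst integral_past_mult_shift[OF i(1) integrable_coord[OF f(1)] i(2)])
        (simp add: integral_of_bool tail_def integral_coord[OF f(1)])
  qed
  have Ef: "0 \<le> (\<integral>x. f x \<partial>D)" using f(2) by simp
  have "(\<integral>\<^sup>+x. ennreal (Y x) \<partial>S) \<le> (\<integral>\<^sup>+x. (\<Sum>k. ennreal (?g k x)) \<partial>S)"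
  proof (rule nn_integral_mono_AE, use AE_crosses[OF assms(1)] in eventually_elim)
    fix x assume "\<exists>k. crosses_at \<Delta> k x"
    then obtain l where l: "crosses_at \<Delta> l x" by auto
    have "ennreal (Y x) \<le> ennreal (\<Sum>k<l. f (x k))"
      using Y[OF l] by (intro ennreal_leI) simp
    also have "\<dots> = (\<Sum>k<l. ennreal (?g k x))"
      using crosses_at_below[OF l] f(2) by (subst sum_ennreal[symmetric]) auto
    also have "\<dots> \<le> (\<Sum>k. ennreal (?g k x))"
      by (intro sum_le_suminf) auto
    finally show "ennreal (Y x) \<le> (\<Sum>k. ennreal (?g k x))" .
  qed
  also have "\<dots> = (\<Sum>k. \<integral>\<^sup>+x. ennreal (?g k x) \<partial>S)"
    by (intro nn_integral_suminf) measurable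
  also have "\<dots> = (\<Sum>k. ennreal (tail \<Delta> k * (\<integral>x. f x \<partial>D)))"
    using g f(2) by (intro suminf_cong, subst nn_integral_eq_integral) auto
  also have "\<dots> = ennreal (\<Sum>k. tail \<Delta> k * (\<integral>x. f x \<partial>D))"
    using summable_tail[OF assms(1)] Ef tail_nonneg by (intro suminf_ennreal2 summable_mult2) auto
  also have "(\<Sum>k. tail \<Delta> k * (\<integral>x. f x \<partial>D)) = period \<Delta> * (\<integral>x. f x \<partial>D)"
    unfolding period_def using summable_tail[OF assms(1)] by (rule suminf_mult2[symmetric])
  finally have nn: "(\<integral>\<^sup>+x. ennreal (Y x) \<partial>S) \<le> ennreal (period \<Delta> * (\<integral>x. f x \<partial>D))" .
  have Y0: "AE x in S. 0 \<le> Y x"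
    using AE_crosses[OF assms(1)] by eventually_elim (use Y in auto)
  show "integrable S Y"
    by (rule integrableI_nonneg) (use nn Y0 in \<open>auto intro: le_less_trans\<close>)
  have p: "0 \<le> period \<Delta>"
    unfolding period_def by (intro suminf_nonneg summable_tail assms(1) tail_nonneg)
  show "(\<integral>x. Y x \<partial>S) \<le> period \<Delta> * (\<integral>x. f x \<partial>D)"
    using nn p Ef by (subst integral_eq_nn_integral) (auto intro: Y0 enn2real_leI)
qed

text \<open>The steps of one period add up to at least \<open>\<Delta>\<close>. This lower bound on
  the mean period turns upper growth conditions on \<delta> into conditions on
  \<open>\<Delta>\<close>.\<close>

lemma level_le_period:
  assumes "\<Delta> > 0"
  shows "\<Delta> \<le> period \<Delta> * (\<integral>x. \<bar>x\<bar> \<partial>D)"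
proof -
  have "(\<integral>x. \<Delta> \<partial>S) \<le> period \<Delta> * (\<integral>x. \<bar>x\<bar> \<partial>D)"
  proof (rule stopped_sum_bound(2)[OF assms _ integrable_D(2)])
    fix x l assume "crosses_at \<Delta> l x"
    then have "\<Delta> \<le> psum x l" by (simp add: crosses_at_def)
    also have "\<dots> \<le> (\<Sum>k<l. \<bar>x k\<bar>)"
      unfolding psum_def by (intro sum_mono) simp
    finally show "0 \<le> \<Delta> \<and> \<Delta> \<le> (\<Sum>k<l. \<bar>x k\<bar>)" using assms by simp
  qed auto
  then show ?thesis by simp
qed

section \<open>Second moment of the overshoot\<close>

lemma excess_bounds:
  assumes "\<Delta> > 0" "crosses_at \<Delta> l x"
  shows "0 \<le> excess \<Delta> x" "excess \<Delta> x \<le> \<bar>x (l - 1)\<bar>"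
proof -
  obtain j where "l = Suc j"
    using crosses_at_pos[OF assms] by (cases l) auto
  moreover from this assms(2) have "psum x j < \<Delta>" "\<Delta> \<le> psum x j + x j"
    by (auto simp: crosses_at_def)
  ultimately show "0 \<le> excess \<Delta> x" "excess \<Delta> x \<le> \<bar>x (l - 1)\<bar>"
    by (auto simp: excess_crosses_at[OF assms(2)])
qed

text \<open>Bounding the squared overshoot by all squared steps of its period yields only order
  \<open>\<Delta>\<close>. To gain more, \<open>a\<close> is subtracted first: a last step of
  modulus above \<open>sqrt a\<close> has its square at most its cube divided by
  \<open>sqrt a\<close>, so only third powers with this small factor are summed over the
  period.\<close>

lemma
  assumes "\<Delta> > 0"
  shows integrable_excess_square: "integrable S (\<lambda>x. (excess \<Delta> x)\<^sup>2)"
    and excess_square_le: "a > 0 \<Longrightarrow> (\<integral>x. (excess \<Delta> x)\<^sup>2 \<partial>S) \<le> a + period \<Delta> * (\<integral>x. \<bar>x\<bar> ^ 3 \<partial>D) / sqrt a"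
proof -
  show i: "integrable S (\<lambda>x. (excess \<Delta> x)\<^sup>2)"
  proof (rule stopped_sum_bound(1)[OF assms _ integrable_D(1)])
    fix x l assume l: "crosses_at \<Delta> l x"
    have "(excess \<Delta> x)\<^sup>2 \<le> (x (l - 1))\<^sup>2"
      using power_mono[OF excess_bounds(2,1)[OF assms l], of 2] by simp
    also have "\<dots> \<le> (\<Sum>k<l. (x k)\<^sup>2)"
      using crosses_at_pos[OF assms l] by (intro member_le_sum) auto
    finally show "0 \<le> (excess \<Delta> x)\<^sup>2 \<and> (excess \<Delta> x)\<^sup>2 \<le> (\<Sum>k<l. (x k)\<^sup>2)" by simp
  qed auto
  assume a: "a > 0"
  let ?Y = "\<lambda>x. max 0 ((excess \<Delta> x)\<^sup>2 - a)"
  have Y: "integrable S ?Y" "(\<integral>x. ?Y x \<partial>S) \<le> period \<Delta> * (\<integral>x. \<bar>x\<bar> ^ 3 / sqrt a \<partial>D)"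
  proof -
    have *: "0 \<le> ?Y x \<and> ?Y x \<le> (\<Sum>k<l. \<bar>x k\<bar> ^ 3 / sqrt a)" if l: "crosses_at \<Delta> l x" for x l
    proof -
      let ?u = "\<bar>x (l - 1)\<bar>"
      have "(excess \<Delta> x)\<^sup>2 \<le> ?u\<^sup>2"
        using power_mono[OF excess_bounds(2,1)[OF assms l], of 2] .
      moreover have "?u\<^sup>2 \<le> a + ?u ^ 3 / sqrt a"
      proof (cases "?u \<le> sqrt a")
        case True
        then have "?u\<^sup>2 \<le> (sqrt a)\<^sup>2" by (intro power_mono) auto
        moreover have "0 \<le> ?u ^ 3 / sqrt a" using a by simp
        moreover have "(sqrt a)\<^sup>2 = a" using a by simp
        ultimately show ?thesis by linarith
      next
        case False
        then have "?u\<^sup>2 * sqrt a \<le> ?u\<^sup>2 * ?u" by (intro mult_left_mono) auto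
        then have "?u\<^sup>2 \<le> ?u ^ 3 / sqrt a" using a by (simp add: field_simps power3_eq_cube power2_eq_square)
        then show ?thesis using a by simp
      qed
      moreover have "?u ^ 3 / sqrt a \<le> (\<Sum>k<l. \<bar>x k\<bar> ^ 3 / sqrt a)"
        using crosses_at_pos[OF assms l] a by (intro member_le_sum[of "l - 1" _ "\<lambda>k. \<bar>x k\<bar> ^ 3 / sqrt a"]) auto
      moreover have "0 \<le> (\<Sum>k<l. \<bar>x k\<bar> ^ 3 / sqrt a)"
        using a by (intro sum_nonneg) auto
      ultimately show ?thesis by auto
    qed
    have i3: "integrable D (\<lambda>x. \<bar>x\<bar> ^ 3 / sqrt a)" using third_moment by simp
    show "integrable S ?Y"
      by (rule stopped_sum_bound(1)[OF assms _ i3]) (use * a in auto)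
    show "(\<integral>x. ?Y x \<partial>S) \<le> period \<Delta> * (\<integral>x. \<bar>x\<bar> ^ 3 / sqrt a \<partial>D)"
      by (rule stopped_sum_bound(2)[OF assms _ i3]) (use * a in auto)
  qed
  have "(\<integral>x. (excess \<Delta> x)\<^sup>2 \<partial>S) \<le> (\<integral>x. a + ?Y x \<partial>S)"
    using Y(1) i by (intro integral_mono) auto
  also have "\<dots> = a + (\<integral>x. ?Y x \<partial>S)"
    using Y(1) by simp
  finally show "(\<integral>x. (excess \<Delta> x)\<^sup>2 \<partial>S) \<le> a + period \<Delta> * (\<integral>x. \<bar>x\<bar> ^ 3 \<partial>D) / sqrt a"
    using Y(2) by simp
qed

lemma excess_square_small: "((\<lambda>\<Delta>. (\<integral>x. (excess \<Delta> x)\<^sup>2 \<partial>S) / \<Delta>) \<longlongrightarrow> 0) at_top"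
proof (rule tendsto_sandwich)
  let ?m = "\<integral>x. \<bar>x\<bar> ^ 3 \<partial>D"
  show "\<forall>\<^sub>F \<Delta> in at_top. 0 \<le> (\<integral>x. (excess \<Delta> x)\<^sup>2 \<partial>S) / \<Delta>"
    using eventually_gt_at_top[of 0] by eventually_elim simp
  show "\<forall>\<^sub>F \<Delta> in at_top. (\<integral>x. (excess \<Delta> x)\<^sup>2 \<partial>S) / \<Delta> \<le>
      (sqrt \<Delta> + 2 * (\<Delta> + level_slack) / \<mu> * ?m / sqrt (sqrt \<Delta>)) / \<Delta>"
    using eventually_gt_at_top[of 0]
  proof eventually_elim
    case (elim \<Delta>)
    \<comment> \<open>The choice \<open>a = sqrt \<Delta>\<close> makes the two terms of order
      \<open>\<Delta> powr (1/2)\<close> and \<open>\<Delta> powr (3/4)\<close>, since the mean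
      period is at most of order \<open>\<Delta>\<close>.\<close>
    have "(\<integral>x. (excess \<Delta> x)\<^sup>2 \<partial>S) \<le> sqrt \<Delta> + period \<Delta> * ?m / sqrt (sqrt \<Delta>)"
      using elim by (intro excess_square_le) auto
    also have "\<dots> \<le> sqrt \<Delta> + 2 * (\<Delta> + level_slack) / \<mu> * ?m / sqrt (sqrt \<Delta>)"
      using elim by (intro add_left_mono divide_right_mono mult_right_mono period_le) auto
    finally show ?case
      using elim by (intro divide_right_mono) auto
  qed
  show "((\<lambda>\<Delta>. (sqrt \<Delta> + 2 * (\<Delta> + level_slack) / \<mu> * ?m / sqrt (sqrt \<Delta>)) / \<Delta>) \<longlongrightarrow> 0) at_top"
  proof -
    define c where "c = 2 * ?m / \<mu>"
    have "((\<lambda>\<Delta>::real. 1 / sqrt \<Delta> + c * (1 / sqrt (sqrt \<Delta>)) +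
        c * level_slack * (1 / (\<Delta> * sqrt (sqrt \<Delta>)))) \<longlongrightarrow> 0 + c * 0 + c * level_slack * 0) at_top"
      by (intro tendsto_add tendsto_mult tendsto_const; real_asymp)
    then have "((\<lambda>\<Delta>::real. 1 / sqrt \<Delta> + c * (1 / sqrt (sqrt \<Delta>)) +
        c * level_slack * (1 / (\<Delta> * sqrt (sqrt \<Delta>)))) \<longlongrightarrow> 0) at_top" by simp
    moreover have "\<forall>\<^sub>F \<Delta> in at_top. 1 / sqrt \<Delta> + c * (1 / sqrt (sqrt \<Delta>)) +
        c * level_slack * (1 / (\<Delta> * sqrt (sqrt \<Delta>))) =
        (sqrt \<Delta> + 2 * (\<Delta> + level_slack) / \<mu> * ?m / sqrt (sqrt \<Delta>)) / \<Delta>"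
      using eventually_gt_at_top[of "0 :: real"]
    proof eventually_elim
      case (elim \<Delta>)
      have "sqrt \<Delta> / \<Delta> = 1 / sqrt \<Delta>"
        using elim by (simp add: real_div_sqrt field_simps)
      moreover have "2 * (\<Delta> + level_slack) / \<mu> * ?m = c * \<Delta> + c * level_slack"
        using mu_pos by (simp add: c_def field_simps)
      ultimately show ?case
        using elim by (simp add: add_divide_distrib)
    qed
    ultimately show ?thesis by (rule Lim_transform_eventually)
  qed
qed simp

end

section \<open>Fluctuation of the accumulated overshoots\<close>

text \<open>The canonical process in the indexing of \<open>walk\<close>, which reads from index 1
  on; the value at 0 is never read.\<close>

definition coord :: "nat \<Rightarrow> (nat \<Rightarrow> real) \<Rightarrow> real" where
  "coord i x = x (i - 1)"

lemma coord_Suc [simp]: "(\<lambda>i. coord (Suc i) x) = x"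
  by (simp add: coord_def)

abbreviation crossings :: "real \<Rightarrow> nat \<Rightarrow> (nat \<Rightarrow> real) \<Rightarrow> nat" where
  "crossings \<equiv> crossing_count coord"

abbreviation last_epoch :: "real \<Rightarrow> nat \<Rightarrow> (nat \<Rightarrow> real) \<Rightarrow> nat" where
  "last_epoch \<equiv> last_crossing coord"

lemma epoch_last_epoch: "\<Delta> > 0 \<Longrightarrow> epoch \<Delta> (crossings \<Delta> t x) (last_epoch \<Delta> t x) x"
  using epoch_last_crossing[of \<Delta> coord t x] by simp

text \<open>No epoch lies after the last one and up to \<open>t\<close>. A sum over all times up to
  the deterministic bound \<open>t\<close> therefore sees the completed periods and, as one further
  term, the period still open.\<close>

lemma sum_renewal:
  fixes f :: "nat \<Rightarrow> real"
  assumes "\<Delta> > 0"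
  shows "(\<Sum>s<Suc t. of_bool (renewal \<Delta> s x) * f s) =
    (\<Sum>s<last_epoch \<Delta> t x. of_bool (renewal \<Delta> s x) * f s) + f (last_epoch \<Delta> t x)"
proof -
  let ?T = "last_epoch \<Delta> t x"
  have "?T \<le> t" by (rule last_crossing_le[OF assms])
  have ren: "renewal \<Delta> ?T x"
    unfolding renewal_def by (rule exI, rule epoch_last_epoch[OF assms])
  from \<open>?T \<le> t\<close> have "{..<Suc t} = {..<?T} \<union> {?T} \<union> {?T<..t}" by auto
  then have "(\<Sum>s<Suc t. of_bool (renewal \<Delta> s x) * f s) =
      (\<Sum>s\<in>{..<?T} \<union> {?T} \<union> {?T<..t}. of_bool (renewal \<Delta> s x) * f s)" by simp
  also have "\<dots> = (\<Sum>s\<in>{..<?T} \<union> {?T}. of_bool (renewal \<Delta> s x) * f s)"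
    using renewal_after_last_crossing[OF assms, of coord t x]
    by (intro sum.mono_neutral_right) auto
  also have "\<dots> = (\<Sum>s<?T. of_bool (renewal \<Delta> s x) * f s) + of_bool (renewal \<Delta> ?T x) * f ?T"
    by (subst sum.union_disjoint) auto
  finally show ?thesis
    using ren by simp
qed

context walk_law
begin

definition "mean_excess \<Delta> = (\<integral>x. excess \<Delta> x \<partial>S)"

text \<open>This is \<open>Z\<close>: the epochs strictly before the last one are the starting
  points of the completed periods.\<close>

definition "excess_fluct \<Delta> t x =
  (\<Sum>s<last_epoch \<Delta> t x. of_bool (renewal \<Delta> s x) * (excess \<Delta> (shift s x) - mean_excess \<Delta>))"

lemma psum_last_epoch:
  assumes "\<Delta> > 0"
  shows "psum x (last_epoch \<Delta> t x) =
    real (crossings \<Delta> t x) * \<Delta> + real (crossings \<Delta> t x) * mean_excess \<Delta> + excess_fluct \<Delta> t x"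
proof -
  note * = epoch_sums[OF assms epoch_last_epoch[OF assms, of t x]]
  have "(\<Sum>s<last_epoch \<Delta> t x. of_bool (renewal \<Delta> s x) * mean_excess \<Delta>) = real (crossings \<Delta> t x) * mean_excess \<Delta>"
    unfolding *(1)[symmetric] by (rule sum_distrib_right[symmetric])
  with *(2) show ?thesis
    unfolding excess_fluct_def right_diff_distrib sum_subtractf by linarith
qed

text \<open>The left side is the expected number of periods started by time \<open>t\<close>.
  Pathwise the completed periods gain at least \<open>\<Delta>\<close> each, which the absolute
  values of the steps must supply; the 1 accounts for the open period.\<close>

lemma sum_renewal_prob_le:
  assumes "\<Delta> > 0"
  shows "(\<Sum>s<Suc t. measure S {x. renewal \<Delta> s x}) \<le> 1 + real t * (\<integral>x. \<bar>x\<bar> \<partial>D) / \<Delta>"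
proof -
  have i: "integrable S (\<lambda>x. \<bar>x i\<bar>)" "(\<integral>x. \<bar>x i\<bar> \<partial>S) = (\<integral>x. \<bar>x\<bar> \<partial>D)" for i
    using integrable_coord[OF integrable_D(2)] integral_coord[OF integrable_D(2)] by auto
  have ptw: "(\<Sum>s<Suc t. of_bool (renewal \<Delta> s x)) \<le> 1 + (\<Sum>i<t. \<bar>x i\<bar>) / \<Delta>" for x
  proof -
    let ?N = "crossings \<Delta> t x" and ?T = "last_epoch \<Delta> t x"
    have "(\<Sum>s<Suc t. of_bool (renewal \<Delta> s x)) = real ?N + 1"
      using sum_renewal[OF assms, of x "\<lambda>_. 1" t] epoch_sums(1)[OF assms epoch_last_epoch[OF assms, of t x]]
      by (simp only: mult_1_right)
    also have "real ?N * \<Delta> \<le> (\<Sum>i<t. \<bar>x i\<bar>)"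
    proof -
      have "real ?N * \<Delta> \<le> psum x ?T"
        by (rule epoch_level[OF epoch_last_epoch[OF assms]])
      also have "\<dots> \<le> (\<Sum>i<?T. \<bar>x i\<bar>)"
        unfolding psum_def by (intro sum_mono) simp
      also have "\<dots> \<le> (\<Sum>i<t. \<bar>x i\<bar>)"
        using last_crossing_le[OF assms, of coord t x] by (intro sum_mono2) auto
      finally show ?thesis .
    qed
    then have "real ?N + 1 \<le> 1 + (\<Sum>i<t. \<bar>x i\<bar>) / \<Delta>"
      using assms by (simp add: field_simps)
    finally show ?thesis .
  qed
  have "(\<Sum>s<Suc t. measure S {x. renewal \<Delta> s x}) = (\<integral>x. (\<Sum>s<Suc t. of_bool (renewal \<Delta> s x)) \<partial>S)"
    by (subst Bochner_Integration.integral_sum) (auto simp: integral_of_bool simp del: sum_of_bool_eq)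
  also have "\<dots> \<le> (\<integral>x. 1 + (\<Sum>i<t. \<bar>x i\<bar>) / \<Delta> \<partial>S)"
    using i(1) by (intro integral_mono ptw) (auto simp del: sum_of_bool_eq)
  also have "\<dots> = 1 + real t * (\<integral>x. \<bar>x\<bar> \<partial>D) / \<Delta>"
    using i by (simp add: Bochner_Integration.integral_sum)
  finally show ?thesis .
qed

text \<open>The period straddling \<open>t\<close> has to be included for the sum to be gated by the past; its
  contribution is dominated by the sum of squares.\<close>

lemma excess_fluct_bound:
  assumes "\<Delta> > 0" "b > 0"
  obtains B where "B \<in> sets S"
    "measure S B \<le> (1 + real t * (\<integral>x. \<bar>x\<bar> \<partial>D) / \<Delta>) * (\<integral>x. (excess \<Delta> x)\<^sup>2 \<partial>S) / b\<^sup>2"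
    "\<And>x. x \<notin> B \<Longrightarrow> \<bar>excess_fluct \<Delta> t x\<bar> < 2 * b"
proof -
  let ?h = "\<lambda>x. excess \<Delta> x - mean_excess \<Delta>"
  have G: "Measurable.pred S (renewal \<Delta> k)" "past k (renewal \<Delta> k)" for k
    by (auto intro: past_renewal)
  have ex2: "integrable S (\<lambda>x. (excess \<Delta> x)\<^sup>2)"
    by (rule integrable_excess_square[OF assms(1)])
  have ex: "integrable S (excess \<Delta>)"
    by (rule P.square_integrable_imp_integrable[OF _ ex2]) measurable
  have h: "?h \<in> borel_measurable S" by measurable
  have h2: "integrable S (\<lambda>x. (?h x)\<^sup>2)"
    using ex ex2 by (simp add: power2_diff)
  have h0: "(\<integral>x. ?h x \<partial>S) = 0"
    using ex by (simp add: mean_excess_def)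
  have v: "(\<integral>x. (?h x)\<^sup>2 \<partial>S) \<le> (\<integral>x. (excess \<Delta> x)\<^sup>2 \<partial>S)"
    using P.variance_eq[OF ex ex2] by (simp add: mean_excess_def)
  have cross: "past l (\<lambda>x. of_bool (renewal \<Delta> l x) * (of_bool (renewal \<Delta> k x) * ?h (shift k x)))"
    if "k < l" for k l
    using past_renewal_cross[OF assms(1) that, of "\<lambda>u. u - mean_excess \<Delta>"] by simp
  define p where "p = (\<Sum>s<Suc t. measure S {x. renewal \<Delta> s x})"
  define V where "V = gated (renewal \<Delta>) ?h (Suc t)"
  define W where "W = gated (renewal \<Delta>) (\<lambda>x. (?h x)\<^sup>2) (Suc t)"
  have V: "integrable S (\<lambda>x. (V x)\<^sup>2)" "(\<integral>x. (V x)\<^sup>2 \<partial>S) = p * (\<integral>x. (?h x)\<^sup>2 \<partial>S)"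
    unfolding V_def p_def
    by (rule integrable_gated_square[OF G h h2 h0 cross] integral_gated_square[OF G h h2 h0 cross]; assumption)+
  have W: "integrable S W" "(\<integral>x. W x \<partial>S) = p * (\<integral>x. (?h x)\<^sup>2 \<partial>S)"
    unfolding W_def p_def by (rule integrable_gated[OF G h2] integral_gated[OF G h2])+
  have Wpos: "0 \<le> W x" for x
    unfolding W_def gated_def by (intro sum_nonneg) auto
  \<comment> \<open>\<open>Z\<close> is \<open>V\<close> minus the summand \<open>z\<close> of the
    open period, and \<open>W\<close> dominates \<open>z^2\<close>, so \<open>Q\<close> dominates
    \<open>Z^2\<close>. The means of \<open>V^2\<close> and \<open>W\<close> coincide, whence the
    factor 4, which cancels against the threshold \<open>(2 * b)^2\<close>.\<close>
  define Q where "Q x = 2 * (V x)\<^sup>2 + 2 * W x" for x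
  have Q: "integrable S Q" "(\<integral>x. Q x \<partial>S) = 4 * (p * (\<integral>x. (?h x)\<^sup>2 \<partial>S))"
    unfolding Q_def using V W by auto
  have [measurable]: "Q \<in> borel_measurable S" using Q by auto
  have dom: "(excess_fluct \<Delta> t x)\<^sup>2 \<le> Q x" for x
  proof -
    let ?z = "?h (shift (last_epoch \<Delta> t x) x)"
    have "V x = excess_fluct \<Delta> t x + ?z"
      unfolding V_def gated_def excess_fluct_def by (rule sum_renewal[OF assms(1)])
    moreover have "W x = (\<Sum>s<last_epoch \<Delta> t x. of_bool (renewal \<Delta> s x) * (?h (shift s x))\<^sup>2) + ?z\<^sup>2"
      unfolding W_def gated_def by (rule sum_renewal[OF assms(1)])
    moreover have "0 \<le> (\<Sum>s<last_epoch \<Delta> t x. of_bool (renewal \<Delta> s x) * (?h (shift s x))\<^sup>2)"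
      by (intro sum_nonneg) auto
    ultimately have "excess_fluct \<Delta> t x = V x - ?z" "?z\<^sup>2 \<le> W x" by auto
    moreover have "(u - z)\<^sup>2 \<le> 2 * u\<^sup>2 + 2 * z\<^sup>2" for u z :: real
      using zero_le_power2[of "u + z"] by (simp add: power2_sum power2_diff)
    from this[of "V x" ?z] have "(V x - ?z)\<^sup>2 \<le> 2 * (V x)\<^sup>2 + 2 * ?z\<^sup>2" .
    ultimately show ?thesis by (simp add: Q_def)
  qed
  show thesis
  proof
    show "{x \<in> space S. 4 * b\<^sup>2 \<le> Q x} \<in> sets S" by measurable
    have "measure S {x \<in> space S. 4 * b\<^sup>2 \<le> Q x} \<le> (\<integral>x. Q x \<partial>S) / (4 * b\<^sup>2)"
    proof (rule integral_Markov_inequality_measure[OF Q(1) sets.top])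
      show "AE x in S. 0 \<le> Q x" using Wpos by (intro AE_I2) (simp add: Q_def)
      show "0 < 4 * b\<^sup>2" using assms(2) by simp
    qed
    also have "\<dots> = p * (\<integral>x. (?h x)\<^sup>2 \<partial>S) / b\<^sup>2"
      unfolding Q(2) by simp
    also have "\<dots> \<le> (1 + real t * (\<integral>x. \<bar>x\<bar> \<partial>D) / \<Delta>) * (\<integral>x. (excess \<Delta> x)\<^sup>2 \<partial>S) / b\<^sup>2"
      using sum_renewal_prob_le[OF assms(1), of t] v assms(1)
      by (intro divide_right_mono mult_mono) (auto simp: p_def)
    finally show "measure S {x \<in> space S. 4 * b\<^sup>2 \<le> Q x} \<le>
        (1 + real t * (\<integral>x. \<bar>x\<bar> \<partial>D) / \<Delta>) * (\<integral>x. (excess \<Delta> x)\<^sup>2 \<partial>S) / b\<^sup>2" .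
  next
    fix x assume "x \<notin> {x \<in> space S. 4 * b\<^sup>2 \<le> Q x}"
    then have "\<bar>excess_fluct \<Delta> t x\<bar>\<^sup>2 < (2 * b)\<^sup>2"
      using dom[of x] by (simp add: power_mult_distrib)
    then show "\<bar>excess_fluct \<Delta> t x\<bar> < 2 * b"
      by (rule power_less_imp_less_base) (use assms(2) in simp)
  qed
qed

lemma distr_coord: "distr S borel (\<lambda>x. x i) = D"
proof -
  have "distr S borel (\<lambda>x. x i) = distr S D (\<lambda>x. x i)"
    by (rule distr_cong) auto
  also have "\<dots> = D" by (rule PiM_component) simp
  finally show ?thesis .
qed

lemma clt_walk:
  assumes "var > 0"
  shows "weak_conv_m (\<lambda>n. distr S borel (\<lambda>x. (psum x n - real n * \<mu>) / sqrt (real n * var)))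
    std_normal_distribution"
proof -
  have ind: "P.indep_vars (\<lambda>_. borel) (\<lambda>i x. x i) UNIV"
  proof (subst P.indep_vars_iff_distr_eq_PiM)
    have "distr S (\<Pi>\<^sub>M i\<in>UNIV. borel) (\<lambda>x. \<lambda>i\<in>UNIV. x i) = distr S S (\<lambda>x. x)"
      by (rule distr_cong) (auto intro!: sets_PiM_cong)
    also have "\<dots> = S" by (rule distr_id2) simp
    finally show "distr S (\<Pi>\<^sub>M i\<in>UNIV. borel) (\<lambda>x. \<lambda>i\<in>UNIV. x i) = (\<Pi>\<^sub>M i\<in>UNIV. distr S borel (\<lambda>x. x i))"
      by (simp add: distr_coord)
  qed auto
  have mean: "(\<integral>x. x i \<partial>S) = \<mu>" for i
    using integral_coord[OF integrable_D(3)] mean_D by simp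
  have "weak_conv_m (\<lambda>n. distr S borel (\<lambda>x. (\<Sum>i<n. x i - \<mu>) / sqrt (real n * (sqrt var)\<^sup>2))) std_normal_distribution"
  proof (rule P.central_limit_theorem[OF ind])
    show "(\<integral>x. (x i - (\<integral>x. x i \<partial>S))\<^sup>2 \<partial>S) = (sqrt var)\<^sup>2" for i
      unfolding mean using integral_coord[OF integrable_centred] assms by (simp add: var_def)
    show "integrable S (\<lambda>x. (x i)\<^sup>2)" for i
      by (rule integrable_coord[OF integrable_D(1)])
  qed (use assms mean distr_coord in auto)
  then show ?thesis
    using assms by (simp add: psum_def sum_subtractf)
qed

end

section \<open>Approximation in probability and the error on a good path\<close>

text \<open>Off \<open>N\<close> the complex exponential is 1-Lipschitz in its phase, giving
  \<open>\<bar>u\<bar> * d\<close>; on \<open>N\<close> two numbers of modulus 1 are at distance at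
  most 2.\<close>

lemma char_distr_diff_le:
  fixes A B :: "'a \<Rightarrow> real"
  assumes "prob_space M" and [measurable]: "A \<in> borel_measurable M" "B \<in> borel_measurable M"
    and N [measurable]: "N \<in> sets M" and d: "d \<ge> 0"
    and close: "\<And>x. x \<in> space M \<Longrightarrow> x \<notin> N \<Longrightarrow> \<bar>B x - A x\<bar> \<le> d"
  shows "cmod (char (distr M borel B) u - char (distr M borel A) u) \<le> \<bar>u\<bar> * d + 2 * measure M N"
proof -
  interpret prob_space M by fact
  have i: "integrable M (\<lambda>x. iexp (u * f x))" if [measurable]: "f \<in> borel_measurable M" for f
    by (intro integrable_const_bound[where B=1]) auto
  have c: "char (distr M borel f) u = (CLINT x|M. iexp (u * f x))"
    if [measurable]: "f \<in> borel_measurable M" for f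
    unfolding char_def by (rule integral_distr) measurable
  have "char (distr M borel B) u - char (distr M borel A) u =
      (CLINT x|M. iexp (u * B x) - iexp (u * A x))"
    unfolding c[OF assms(2)] c[OF assms(3)]
    by (rule Bochner_Integration.integral_diff[symmetric]) (rule i, fact)+
  also have "cmod \<dots> \<le> (\<integral>x. cmod (iexp (u * B x) - iexp (u * A x)) \<partial>M)"
    by (rule integral_norm_bound)
  also have "\<dots> \<le> (\<integral>x. \<bar>u\<bar> * d + 2 * indicator N x \<partial>M)"
  proof (rule integral_mono)
    show "integrable M (\<lambda>x. cmod (iexp (u * B x) - iexp (u * A x)))"
      using i[of A] i[of B] by auto
    show "integrable M (\<lambda>x. \<bar>u\<bar> * d + 2 * indicator N x)"
      by (auto simp: less_top[symmetric])
    fix x assume x: "x \<in> space M"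
    have "iexp (u * B x) - iexp (u * A x) = iexp (u * A x) * (iexp (u * (B x - A x)) - 1)"
      by (simp add: algebra_simps exp_add[symmetric])
    then have eq: "cmod (iexp (u * B x) - iexp (u * A x)) = cmod (iexp (u * (B x - A x)) - 1)"
      by (simp add: norm_mult)
    show "cmod (iexp (u * B x) - iexp (u * A x)) \<le> \<bar>u\<bar> * d + 2 * indicator N x"
    proof (cases "x \<in> N")
      case True
      have "cmod (iexp (u * (B x - A x)) - 1) \<le> 1 + 1"
        by (rule order_trans[OF norm_triangle_ineq4]) simp
      moreover have "0 \<le> \<bar>u\<bar> * d" using d by simp
      ultimately show ?thesis using True unfolding eq by (simp only: indicator_simps)
    next
      case False
      have "cmod (iexp (u * (B x - A x)) - 1) \<le> \<bar>u * (B x - A x)\<bar>"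
        using iexp_approx1[of "u * (B x - A x)" 0] by simp
      also have "\<dots> \<le> \<bar>u\<bar> * d"
        using close[OF x False] unfolding abs_mult by (intro mult_left_mono) auto
      finally show ?thesis using False unfolding eq by simp
    qed
  qed
  also have "\<dots> = \<bar>u\<bar> * d + 2 * measure M N"
    by (subst Bochner_Integration.integral_add) (auto simp: prob_space emeasure_eq_measure)
  finally show ?thesis .
qed

text \<open>Slutsky's lemma through characteristic functions. Convergence in probability is phrased
  with an exceptional set for each tolerance, which suits the good events constructed later.\<close>

lemma weak_conv_m_close:
  fixes A B :: "nat \<Rightarrow> 'a \<Rightarrow> real"
  assumes M: "prob_space M" and A: "\<And>n. A n \<in> borel_measurable M" and B: "\<And>n. B n \<in> borel_measurable M"
    and P: "real_distribution P" and conv: "weak_conv_m (\<lambda>n. distr M borel (A n)) P"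
    and close: "\<And>d. d > 0 \<Longrightarrow> \<forall>\<^sub>F n in sequentially.
      \<exists>N\<in>sets M. measure M N \<le> d \<and> (\<forall>x\<in>space M - N. \<bar>B n x - A n x\<bar> \<le> d)"
  shows "weak_conv_m (\<lambda>n. distr M borel (B n)) P"
proof (rule levy_continuity)
  interpret prob_space M by fact
  show "real_distribution (distr M borel (B n))" for n
    by (rule real_distribution_distr) (rule B)
  show "(\<lambda>n. char (distr M borel (B n)) u) \<longlonglongrightarrow> char P u" for u
  proof -
    have lim: "(\<lambda>n. char (distr M borel (A n)) u) \<longlonglongrightarrow> char P u"
      by (rule levy_continuity1[OF _ P conv]) (rule real_distribution_distr, rule A)
    have "(\<lambda>n. char (distr M borel (B n)) u - char (distr M borel (A n)) u) \<longlonglongrightarrow> 0"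
    proof (rule tendstoI)
      fix e :: real assume "e > 0"
      define d where "d = e / (2 * (\<bar>u\<bar> + 2))"
      have d: "d > 0" "\<bar>u\<bar> * d + 2 * d < e"
      proof -
        show "d > 0" using \<open>e > 0\<close> by (simp add: d_def add_nonneg_pos)
        define v where "v = \<bar>u\<bar> + 2"
        have "v > 0" by (simp add: v_def add_nonneg_pos)
        then have "v * d = e / 2" by (simp add: d_def v_def[symmetric])
        then have "(\<bar>u\<bar> + 2) * d = e / 2" by (simp only: v_def)
        then show "\<bar>u\<bar> * d + 2 * d < e" using \<open>e > 0\<close> by (simp add: algebra_simps)
      qed
      show "\<forall>\<^sub>F n in sequentially. dist (char (distr M borel (B n)) u - char (distr M borel (A n)) u) 0 < e"
        using close[OF d(1)]
      proof eventually_elim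
        case (elim n)
        then obtain N where N: "N \<in> sets M" "measure M N \<le> d"
          "\<And>x. x \<in> space M \<Longrightarrow> x \<notin> N \<Longrightarrow> \<bar>B n x - A n x\<bar> \<le> d" by auto
        from char_distr_diff_le[OF M A B N(1) less_imp_le[OF d(1)] N(3), of u] N(2) d(2) show ?case
          by (simp add: dist_norm)
      qed
    qed
    from tendsto_add[OF this lim] show ?thesis by simp
  qed
qed (rule P)

text \<open>Everything that happens on the good event is a deterministic consequence of the identity
  \<open>psum x T = N \<Delta> + N e + Z\<close> at the last epoch \<open>T\<close>: \<open>MT\<close> and \<open>Mt\<close> stand for the centred walk
  at \<open>T\<close> and \<open>t\<close>.\<close>

locale good_path =
  fixes \<mu> K \<epsilon> E0 C2 L \<Delta> t T N MT Mt Z e m :: real and R :: "real \<Rightarrow> real"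
  assumes pos: "\<mu> > 0" "K > 0" "\<epsilon> > 0" "E0 \<ge> 0" "C2 \<ge> 0" "\<Delta> > 0" "N \<ge> 0" "0 \<le> T"
    and t1: "t \<ge> 1" and Tt: "T \<le> t"
    and identity: "MT + \<mu> * T = N * \<Delta> + N * e + Z"
    and open_period: "(Mt + \<mu> * t) - (MT + \<mu> * T) < \<Delta>"
    and MT: "\<bar>MT\<bar> \<le> K * sqrt t" and Mt: "\<bar>Mt\<bar> \<le> K * sqrt t" and Z: "\<bar>Z\<bar> \<le> \<epsilon> * sqrt t"
    and incr: "t - T \<le> m \<Longrightarrow> \<bar>Mt - MT\<bar> \<le> \<epsilon> * sqrt t"
    and m1: "\<Delta> + 2 * K * sqrt t \<le> \<mu> * m" and m2: "m \<le> t / 2"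
    and e: "\<bar>e\<bar> \<le> E0" "\<bar>e - R \<mu>\<bar> \<le> C2 / \<Delta>" and Delta: "2 * E0 \<le> \<Delta>"
    and t_large: "2 * (K + \<epsilon>) < \<mu> * sqrt t"
    and lip: "L-lipschitz_on {0<..} R"
begin

text \<open>Since \<open>e\<close> is at least \<open>- \<Delta> / 2\<close>, the quantity
  \<open>N * \<Delta> / 2\<close> is at most \<open>MT + \<mu> * T - Z\<close>, hence at most
  \<open>(K + \<mu> + \<epsilon>) * t\<close>; thus \<open>N \<le> c * t / \<Delta>\<close>.\<close>

definition "c = 2 * (K + \<mu> + \<epsilon>)"

text \<open>A common bound on the distance of both uncorrected estimators from \<open>\<mu>\<close>:
  fluctuation, bias caused by the mean overshoot, and the open period. The last term comes from the
  estimator with divisor \<open>t\<close>.\<close>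

definition "dev = 2 * (K + 2 * \<epsilon>) / sqrt t + 2 * c * E0 / \<Delta> + \<Delta> / t"

text \<open>The bound on \<open>N\<close> times the error \<open>L * dev + C2 / \<Delta>\<close> of
  the correction in one period, divided by \<open>sqrt t\<close>. The factor 2 pays for the divisor
  \<open>T\<close>, which is at least \<open>t / 2\<close>.\<close>

definition "err = 2 * c * (sqrt t / \<Delta>) * (L * dev + C2 / \<Delta>)"

lemma sqrt_t: "1 \<le> sqrt t" "sqrt t * sqrt t = t" "sqrt t \<le> t"
proof -
  show "1 \<le> sqrt t" "sqrt t * sqrt t = t" using t1 by auto
  then have "sqrt t * 1 \<le> sqrt t * sqrt t" by (intro mult_left_mono) auto
  with \<open>sqrt t * sqrt t = t\<close> show "sqrt t \<le> t" by simp
qed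

lemma c_pos: "c > 0"
  using pos by (simp add: c_def)

text \<open>A bootstrap: the crude bounds on \<open>MT\<close> and \<open>Mt\<close> first give
  \<open>t - T \<le> m\<close>. This activates \<open>incr\<close>, and the open period is then
  bounded again with \<open>\<epsilon> * sqrt t\<close> in place of
  \<open>2 * K * sqrt t\<close>.\<close>

lemma lag: "\<mu> * (t - T) \<le> \<Delta> + \<epsilon> * sqrt t" and incr': "\<bar>Mt - MT\<bar> \<le> \<epsilon> * sqrt t"
  and half: "t / 2 \<le> T"
proof -
  have "\<mu> * (t - T) \<le> \<Delta> + 2 * K * sqrt t"
    using open_period MT Mt by (simp add: algebra_simps abs_le_iff)
  then have "\<mu> * (t - T) \<le> \<mu> * m" using m1 by simp
  then have *: "t - T \<le> m" using pos by simp
  from incr[OF this] show "\<bar>Mt - MT\<bar> \<le> \<epsilon> * sqrt t" .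
  then show "\<mu> * (t - T) \<le> \<Delta> + \<epsilon> * sqrt t"
    using open_period by (simp add: algebra_simps abs_le_iff)
  show "t / 2 \<le> T" using * m2 by linarith
qed

text \<open>Both bounds read \<open>N * (\<Delta> + e) = MT + \<mu> * T - Z\<close>. For large
  \<open>t\<close> the drift over at least half of the time beats the fluctuations, so some period
  is complete; from above the left side is at least \<open>N * \<Delta> / 2\<close>.\<close>

lemma N_pos: "N > 0" and N_le: "N \<le> c * t / \<Delta>"
proof -
  have eD: "\<Delta> / 2 \<le> \<Delta> + e" using e(1) Delta by linarith
  have NE: "N * (\<Delta> + e) = MT + \<mu> * T - Z" using identity by (simp add: algebra_simps)
  have "\<mu> * (t / 2) \<le> \<mu> * T" using half pos by (intro mult_left_mono) auto
  moreover have "(2 * (K + \<epsilon>)) * sqrt t < \<mu> * sqrt t * sqrt t"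
    using t_large sqrt_t(1) by (intro mult_strict_right_mono) auto
  then have "K * sqrt t + \<epsilon> * sqrt t < \<mu> * (t / 2)"
    using sqrt_t(2) by (simp add: algebra_simps)
  ultimately have "0 < N * (\<Delta> + e)"
    unfolding NE using MT Z by linarith
  then show "N > 0" using pos(7) by (simp add: zero_less_mult_iff)
  have "N * (\<Delta> / 2) \<le> N * (\<Delta> + e)" using eD pos(7) by (rule mult_left_mono)
  also have "\<dots> \<le> K * sqrt t + \<mu> * t + \<epsilon> * sqrt t"
    unfolding NE using MT Z mult_left_mono[OF Tt, of \<mu>] pos by linarith
  also have "\<dots> \<le> (K + \<mu> + \<epsilon>) * t"
  proof -
    have "K * sqrt t \<le> K * t" "\<epsilon> * sqrt t \<le> \<epsilon> * t"
      using sqrt_t(3) pos by simp_all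
    then show ?thesis by (simp add: algebra_simps)
  qed
  finally show "N \<le> c * t / \<Delta>" using pos by (simp add: c_def field_simps)
qed

lemma N_e: "\<bar>N * e\<bar> \<le> c * E0 / \<Delta> * t"
proof -
  have "\<bar>N * e\<bar> \<le> (c * t / \<Delta>) * E0"
    unfolding abs_mult using N_le N_pos e(1) c_pos pos t1 by (intro mult_mono) auto
  then show ?thesis by (simp add: field_simps)
qed

lemma hat_close: "\<bar>N * \<Delta> / T - \<mu>\<bar> \<le> dev"
proof -
  have T: "T > 0" using half t1 by linarith
  have "N * \<Delta> / T - \<mu> = (MT - Z - N * e) / T"
    using identity T by (simp add: field_simps)
  also have "\<bar>\<dots>\<bar> \<le> (K * sqrt t + \<epsilon> * sqrt t + c * E0 / \<Delta> * t) / (t / 2)"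
    unfolding abs_divide using MT Z N_e half T t1 by (intro frac_le) auto
  also have "\<dots> = 2 * (K + \<epsilon>) * (sqrt t / t) + 2 * c * E0 / \<Delta>"
    using t1 pos by (simp add: field_simps)
  also have "sqrt t / t = 1 / sqrt t" using t1 sqrt_t by (simp add: field_simps)
  finally have "\<bar>N * \<Delta> / T - \<mu>\<bar> \<le> 2 * (K + \<epsilon>) / sqrt t + 2 * c * E0 / \<Delta>" by simp
  moreover have "2 * (K + \<epsilon>) / sqrt t \<le> 2 * (K + 2 * \<epsilon>) / sqrt t"
    using pos sqrt_t by (intro divide_right_mono) auto
  moreover have "0 \<le> \<Delta> / t" using pos t1 by simp
  ultimately show ?thesis unfolding dev_def by linarith
qed

lemma check_close: "\<bar>N * \<Delta> / t - \<mu>\<bar> \<le> dev"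
proof -
  have "N * \<Delta> / t - \<mu> = (MT - Z - N * e - \<mu> * (t - T)) / t"
    using identity t1 by (simp add: field_simps)
  also have "\<bar>\<dots>\<bar> \<le> (K * sqrt t + \<epsilon> * sqrt t + c * E0 / \<Delta> * t + (\<Delta> + \<epsilon> * sqrt t)) / t"
  proof -
    have "0 \<le> \<mu> * (t - T)" using pos Tt by simp
    then have "\<bar>MT - Z - N * e - \<mu> * (t - T)\<bar> \<le> K * sqrt t + \<epsilon> * sqrt t + c * E0 / \<Delta> * t + (\<Delta> + \<epsilon> * sqrt t)"
      using MT Z N_e lag by linarith
    then show ?thesis
      unfolding abs_divide using t1 by (simp add: divide_right_mono)
  qed
  also have "\<dots> = (K + 2 * \<epsilon>) * (sqrt t / t) + c * E0 / \<Delta> + \<Delta> / t"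
    using t1 pos by (simp add: field_simps)
  also have "sqrt t / t = 1 / sqrt t" using t1 sqrt_t by (simp add: field_simps)
  finally have "\<bar>N * \<Delta> / t - \<mu>\<bar> \<le> (K + 2 * \<epsilon>) / sqrt t + c * E0 / \<Delta> + \<Delta> / t" by simp
  moreover have "(K + 2 * \<epsilon>) / sqrt t \<le> 2 * (K + 2 * \<epsilon>) / sqrt t"
    using pos sqrt_t by (intro divide_right_mono) auto
  moreover have "c * E0 / \<Delta> \<le> 2 * c * E0 / \<Delta>"
    using pos c_pos by (intro divide_right_mono) auto
  ultimately show ?thesis unfolding dev_def by linarith
qed

text \<open>The correction evaluated at the estimate \<open>w\<close> is compared with the true mean
  overshoot via \<open>R \<mu>\<close>: the Lipschitz bound for the first part, (A2) for the second.
  Positivity of \<open>w\<close> places it in the domain of the Lipschitz condition.\<close>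

lemma N_R:
  assumes "w > 0" "\<bar>w - \<mu>\<bar> \<le> dev"
  shows "\<bar>N * (R w - e)\<bar> \<le> err / 2 * sqrt t"
proof -
  have L: "L \<ge> 0" using lip by (simp add: lipschitz_on_def)
  have "\<bar>R w - R \<mu>\<bar> \<le> L * \<bar>w - \<mu>\<bar>"
    using lipschitz_onD[OF lip, of w \<mu>] assms(1) pos by (simp add: dist_real_def)
  also have "\<dots> \<le> L * dev" using assms(2) L by (rule mult_left_mono)
  finally have R: "\<bar>R w - e\<bar> \<le> L * dev + C2 / \<Delta>" using e(2) by linarith
  have "\<bar>N * (R w - e)\<bar> \<le> (c * t / \<Delta>) * (L * dev + C2 / \<Delta>)"
    unfolding abs_mult using N_le N_pos R c_pos pos t1 by (intro mult_mono) auto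
  also have "\<dots> = err / 2 * sqrt t"
  proof -
    have "c * t / \<Delta> = c * (sqrt t / \<Delta>) * sqrt t" using t1 by simp
    moreover have "c * u * v * q = 2 * c * u * q / 2 * v" for u v q :: real by simp
    ultimately show ?thesis by (simp only: err_def)
  qed
  finally show ?thesis .
qed

lemma err_nonneg: "err \<ge> 0"
proof -
  have "0 \<le> err / 2 * sqrt t"
    by (rule order_trans[OF abs_ge_zero N_R[OF _ check_close]]) (use N_pos pos t1 in simp)
  then show ?thesis using sqrt_t(1) by (simp add: zero_le_mult_iff)
qed

lemma corrected_hat_close:
  "\<bar>sqrt t * (N * \<Delta> / T * (1 + R (N * \<Delta> / T) / \<Delta>) - \<mu>) - Mt / sqrt t\<bar>
    \<le> 3 * \<epsilon> + err + 2 * K / \<mu> * (\<Delta> / t + \<epsilon> / sqrt t)"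
proof -
  have T: "T > 0" using half t1 by linarith
  let ?w = "N * \<Delta> / T"
  have w: "?w > 0" using N_pos pos T by simp
  have "?w * (1 + R ?w / \<Delta>) = (N * \<Delta> + N * R ?w) / T"
    using T pos by (simp add: divide_simps) (simp add: algebra_simps)
  then have "?w * (1 + R ?w / \<Delta>) - \<mu> = (N * \<Delta> + N * R ?w - \<mu> * T) / T"
    using T by (simp add: diff_divide_distrib)
  also have "N * \<Delta> + N * R ?w - \<mu> * T = MT + N * (R ?w - e) - Z"
    using identity by (simp add: right_diff_distrib)
  finally have w_eq: "?w * (1 + R ?w / \<Delta>) - \<mu> = (MT + N * (R ?w - e) - Z) / T" .
  \<comment> \<open>Here \<open>s\<close> is \<open>sqrt t\<close>. Replacing the divisor
    \<open>T\<close> by \<open>t\<close> costs \<open>MT * (t - T) / (T * s)\<close>, a second-order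
    term because \<open>MT\<close> itself is at most \<open>K * sqrt t\<close>.\<close>
  have alg: "s * ((MT + P - Z) / T) - Mt / s =
      s / T * P - s / T * Z + (MT * (s * s - T) / (T * s) + (MT - Mt) / s)" if "s > 0" for s P
    using that T by (simp add: field_simps)
  have main: "sqrt t * (?w * (1 + R ?w / \<Delta>) - \<mu>) - Mt / sqrt t =
      sqrt t / T * (N * (R ?w - e)) - sqrt t / T * Z + (MT * (t - T) / (T * sqrt t) + (MT - Mt) / sqrt t)"
    unfolding w_eq using alg[of "sqrt t" "N * (R ?w - e)"] sqrt_t(1,2) by simp
  have st: "sqrt t / T \<le> 2 / sqrt t" "0 \<le> sqrt t / T"
    using T half sqrt_t(1,2) by (auto simp: field_simps)
  have "\<bar>sqrt t / T * (N * (R ?w - e))\<bar> \<le> 2 / sqrt t * (err / 2 * sqrt t)"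
    unfolding abs_mult[of "sqrt t / T"] using N_R[OF w hat_close] st T sqrt_t(1)
    by (intro mult_mono) auto
  also have "2 / sqrt t * (err / 2 * sqrt t) = err" using sqrt_t(1) t1 by simp
  finally have b1: "\<bar>sqrt t / T * (N * (R ?w - e))\<bar> \<le> err" .
  have "\<bar>sqrt t / T * Z\<bar> \<le> 2 / sqrt t * (\<epsilon> * sqrt t)"
    unfolding abs_mult[of "sqrt t / T"] using Z st T sqrt_t(1)
    by (intro mult_mono) auto
  also have "2 / sqrt t * (\<epsilon> * sqrt t) = 2 * \<epsilon>" using sqrt_t(1) t1 by simp
  finally have b2: "\<bar>sqrt t / T * Z\<bar> \<le> 2 * \<epsilon>" .
  have b3: "\<bar>MT * (t - T) / (T * sqrt t)\<bar> \<le> 2 * K / \<mu> * (\<Delta> / t + \<epsilon> / sqrt t)"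
  proof -
    have "\<bar>MT * (t - T) / (T * sqrt t)\<bar> = (\<bar>MT\<bar> * (t - T)) / (T * sqrt t)"
      using Tt T by (simp add: abs_mult)
    also have "\<dots> \<le> (K * sqrt t * ((\<Delta> + \<epsilon> * sqrt t) / \<mu>)) / (t / 2 * sqrt t)"
      using MT lag Tt T half sqrt_t(1) pos t1
      by (intro frac_le mult_mono) (auto simp: field_simps)
    also have "\<dots> = 2 * K / \<mu> * (\<Delta> / t + \<epsilon> * (sqrt t / t))"
      using sqrt_t(1) pos t1 by (simp add: field_simps)
    also have "sqrt t / t = 1 / sqrt t" using t1 sqrt_t by (simp add: field_simps)
    finally show ?thesis by simp
  qed
  have b4: "\<bar>(MT - Mt) / sqrt t\<bar> \<le> \<epsilon>"
    using incr' sqrt_t(1) by (simp add: abs_divide field_simps abs_minus_commute)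
  have "\<bar>p - q + (r + s)\<bar> \<le> 3 * \<epsilon> + err + b"
    if "\<bar>p\<bar> \<le> err" "\<bar>q\<bar> \<le> 2 * \<epsilon>" "\<bar>r\<bar> \<le> b" "\<bar>s\<bar> \<le> \<epsilon>" for p q r s b
    using that by linarith
  from this[OF b1 b2 b3 b4] show ?thesis unfolding main .
qed

text \<open>With divisor \<open>t\<close> the open period enters as
  \<open>\<mu> * (t - T) / sqrt t\<close>, which \<open>lag\<close> bounds by
  \<open>\<Delta> / sqrt t + \<epsilon>\<close>. This is what the condition \<delta> = o(sqrt t) of
  part (i) controls.\<close>

lemma corrected_check_close:
  "\<bar>sqrt t * (N * \<Delta> / t * (1 + R (N * \<Delta> / t) / \<Delta>) - \<mu>) - Mt / sqrt t\<bar>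
    \<le> 3 * \<epsilon> + err + \<Delta> / sqrt t"
proof -
  let ?w = "N * \<Delta> / t"
  have w: "?w > 0" using N_pos pos t1 by simp
  have "?w * (1 + R ?w / \<Delta>) = (N * \<Delta> + N * R ?w) / t"
    using t1 pos by (simp add: divide_simps) (simp add: algebra_simps)
  then have "?w * (1 + R ?w / \<Delta>) - \<mu> = (N * \<Delta> + N * R ?w - \<mu> * t) / t"
    using t1 by (simp add: diff_divide_distrib)
  also have "N * \<Delta> + N * R ?w - \<mu> * t = MT + N * (R ?w - e) - Z - \<mu> * (t - T)"
    using identity by (simp add: right_diff_distrib)
  finally have w_eq: "?w * (1 + R ?w / \<Delta>) - \<mu> = (MT + N * (R ?w - e) - Z - \<mu> * (t - T)) / t" .
  have alg: "s * ((MT + P - Z - Q) / (s * s)) - Mt / s = (MT - Mt + P - Z - Q) / s" if "s > 0" for s P Q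
    using that by (simp add: field_simps)
  have "sqrt t * (?w * (1 + R ?w / \<Delta>) - \<mu>) - Mt / sqrt t =
      (MT - Mt + N * (R ?w - e) - Z - \<mu> * (t - T)) / sqrt t"
    unfolding w_eq using alg[of "sqrt t" "N * (R ?w - e)" "\<mu> * (t - T)"] sqrt_t(1,2) t1 by simp
  also have "\<bar>\<dots>\<bar> \<le> (\<epsilon> * sqrt t + err / 2 * sqrt t + \<epsilon> * sqrt t + (\<Delta> + \<epsilon> * sqrt t)) / sqrt t"
  proof -
    have "0 \<le> \<mu> * (t - T)" using pos Tt by simp
    then have "\<bar>MT - Mt + N * (R ?w - e) - Z - \<mu> * (t - T)\<bar> \<le>
        \<epsilon> * sqrt t + err / 2 * sqrt t + \<epsilon> * sqrt t + (\<Delta> + \<epsilon> * sqrt t)"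
      using incr' N_R[OF w check_close] Z lag by linarith
    then show ?thesis
      unfolding abs_divide using sqrt_t(1) by (simp add: divide_right_mono)
  qed
  also have "\<dots> = 3 * \<epsilon> + err / 2 + \<Delta> / sqrt t"
    using sqrt_t(1) by (simp add: field_simps)
  finally show ?thesis
    using err_nonneg by linarith
qed

end

section \<open>Central limit theorem for the corrected estimators\<close>

lemma crossing_time_coord:
  "crossing_time X \<Delta> n \<omega> = crossing_time coord \<Delta> n (\<lambda>i. X (Suc i) \<omega>)"
proof -
  have "crossing_time X \<Delta> n \<omega> = enat s \<longleftrightarrow> crossing_time coord \<Delta> n (\<lambda>i. X (Suc i) \<omega>) = enat s" for s
    unfolding crossing_time_eq_enat_iff coord_Suc ..
  then show ?thesis by (metis not_enat_eq)
qed

text \<open>The estimators depend on the process only through its path, so their laws can be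
  computed on the sequence space.\<close>

lemma estimators_coord:
  "corrected_hat F c X \<Delta> t \<omega> = corrected_hat F c coord \<Delta> t (\<lambda>i. X (Suc i) \<omega>)"
  "corrected_check F c X \<Delta> t \<omega> = corrected_check F c coord \<Delta> t (\<lambda>i. X (Suc i) \<omega>)"
proof -
  let ?x = "\<lambda>i. X (Suc i) \<omega>"
  have count: "crossing_count X \<Delta> t \<omega> = crossing_count coord \<Delta> t ?x"
    unfolding crossing_count_def by (simp only: crossing_time_coord[of X])
  have last: "last_crossing X \<Delta> t \<omega> = last_crossing coord \<Delta> t ?x"
    unfolding last_crossing_def count by (simp only: crossing_time_coord[of X])
  show "corrected_hat F c X \<Delta> t \<omega> = corrected_hat F c coord \<Delta> t ?x"
    by (simp only: corrected_hat_def mu_hat_def count last)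
  show "corrected_check F c X \<Delta> t \<omega> = corrected_check F c coord \<Delta> t ?x"
    by (simp only: corrected_check_def mu_check_def count)
qed

context iid_steps
begin

lemma measurable_crossings [measurable]: "crossings \<Delta> t \<in> measurable S (count_space UNIV)"
proof -
  have "crossings \<Delta> t = (\<lambda>x. Max {n. \<exists>s\<le>t. epoch \<Delta> n s x})"
    unfolding crossing_count_def[abs_def] crossing_time_le_iff coord_Suc ..
  then show ?thesis by simp
qed

lemma measurable_last_epoch:
  assumes "\<Delta> > 0"
  shows "last_epoch \<Delta> t \<in> measurable S (count_space UNIV)"
proof -
  \<comment> \<open>The existential over \<open>n\<close> replaces the random index
    \<open>crossings \<Delta> t x\<close> by deterministic ones, leaving a countable combination of
    measurable events.\<close>
  have "last_epoch \<Delta> t x = (LEAST s. \<exists>n. crossings \<Delta> t x = n \<and> epoch \<Delta> n s x)" for x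
    using epoch_last_epoch[OF assms, of t x] epoch_unique
    by (intro Least_equality[symmetric]) (auto, metis order_refl)
  then have "last_epoch \<Delta> t = (\<lambda>x. LEAST s. \<exists>n. crossings \<Delta> t x = n \<and> epoch \<Delta> n s x)"
    by (rule ext)
  then show ?thesis by simp
qed

lemma measurable_estimators:
  assumes "\<Delta> > 0"
  shows "corrected_hat F c coord \<Delta> t \<in> borel_measurable S"
    and "corrected_check F c coord \<Delta> t \<in> borel_measurable S"
proof -
  note [measurable] = measurable_last_epoch[OF assms]
  have "(\<lambda>x. f (crossings \<Delta> t x) (last_epoch \<Delta> t x)) \<in> borel_measurable S"
    for f :: "nat \<Rightarrow> nat \<Rightarrow> real"
    by (rule measurable_compose_countable[where g="crossings \<Delta> t"])
       (rule measurable_compose_countable[where g="last_epoch \<Delta> t"], measurable)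
  note * = this
  show "corrected_hat F c coord \<Delta> t \<in> borel_measurable S"
    using *[of "\<lambda>N T. if N = 0 then c else bias_correction F \<Delta> (real N * \<Delta> / real T)"]
    unfolding corrected_hat_def[abs_def] mu_hat_def .
  show "corrected_check F c coord \<Delta> t \<in> borel_measurable S"
    using *[of "\<lambda>N T. if N = 0 then c else bias_correction F \<Delta> (real N * \<Delta> / real t)"]
    unfolding corrected_check_def[abs_def] mu_check_def .
qed

lemma measurable_crossing_time [measurable]:
  "crossing_time coord \<Delta> n \<in> measurable S (count_space UNIV)"
  unfolding measurable_count_space_eq2_countable
proof safe
  fix v
  have "crossing_time coord \<Delta> n -` {v} \<inter> space S = {x. crossing_time coord \<Delta> n x = v}" by auto
  also have "\<dots> \<in> sets S"
  proof (cases v)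
    case (enat s)
    then have "{x. crossing_time coord \<Delta> n x = v} = Collect (epoch \<Delta> n s)"
      by (simp add: crossing_time_eq_enat_iff)
    then show ?thesis using Collect_in_sets[OF measurable_epoch] by simp
  next
    case infinity
    have "crossing_time coord \<Delta> n x = \<infinity> \<longleftrightarrow> (\<forall>s. \<not> epoch \<Delta> n s x)" for x
      using crossing_time_eq_enat_iff[of coord \<Delta> n x] by (metis coord_Suc not_enat_eq)
    then have "{x. crossing_time coord \<Delta> n x = v} = {x. \<forall>s. \<not> epoch \<Delta> n s x}"
      using infinity by simp
    also have "\<dots> \<in> sets S" by (rule Collect_in_sets) measurable
    finally show ?thesis .
  qed
  finally show "crossing_time coord \<Delta> n -` {v} \<inter> space S \<in> sets S" .
qed auto

end

context walk_law
begin

lemma mean_period_eq_period: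
  assumes "\<Delta> > 0"
  shows "mean_period S coord \<Delta> = period \<Delta>"
proof -
  have "(\<integral>\<^sup>+x. ennreal_of_enat (crossing_time coord \<Delta> 1 x) \<partial>S) =
      (\<Sum>k. emeasure S {x \<in> space S. enat k < crossing_time coord \<Delta> 1 x})"
    by (rule nn_integral_enat_function[OF measurable_crossing_time])
  also have "\<dots> = (\<Sum>k. ennreal (tail \<Delta> k))"
    by (simp only: enat_less_crossing_time_iff coord_Suc) (simp add: tail_def P.emeasure_eq_measure)
  also have "\<dots> = ennreal (period \<Delta>)"
    unfolding period_def by (rule suminf_ennreal2[OF tail_nonneg summable_tail[OF assms]])
  finally show ?thesis
    using suminf_nonneg[OF summable_tail[OF assms] tail_nonneg] by (simp add: mean_period_def period_def)
qed

end

text \<open>(A2) enters as the rate \<open>C2 / \<Delta>\<close> beyond \<open>\<Delta>0\<close>,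
  which an exponent \<open>r \<ge> 2\<close> supplies. The condition
  \<open>\<Delta>0 \<ge> 1\<close> turns it into the uniform bound \<open>E0\<close> on the mean
  overshoot.\<close>

locale estimation = walk_law D \<mu> for D \<mu> +
  fixes F :: "real \<Rightarrow> real measure" and L C2 \<Delta>0 :: real
  assumes var_pos: "var > 0"
    and lip: "L-lipschitz_on {0<..} (\<lambda>m. rho (F m))"
    and C2: "C2 \<ge> 0" "\<Delta>0 \<ge> 1" "\<And>\<Delta>. \<Delta> \<ge> \<Delta>0 \<Longrightarrow> \<bar>mean_excess \<Delta> - rho (F \<mu>)\<bar> \<le> C2 / \<Delta>"
begin

abbreviation "R \<equiv> \<lambda>m. rho (F m)"

definition "E0 = \<bar>R \<mu>\<bar> + C2"

lemma E0: "E0 \<ge> 0" "\<Delta> \<ge> \<Delta>0 \<Longrightarrow> \<bar>mean_excess \<Delta>\<bar> \<le> E0"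
proof -
  show "E0 \<ge> 0" using C2 by (simp add: E0_def)
  assume "\<Delta> \<ge> \<Delta>0"
  then have "C2 / \<Delta> \<le> C2" using C2 by (simp add: divide_le_eq mult_le_cancel_left1)
  with C2(3)[OF \<open>\<Delta> \<ge> \<Delta>0\<close>] show "\<bar>mean_excess \<Delta>\<bar> \<le> E0" by (simp add: E0_def)
qed

section \<open>Probability of the good event\<close>

abbreviation "cwalk x n \<equiv> psum x n - real n * \<mu>"

definition "good K \<epsilon> m \<Delta> t x \<longleftrightarrow> good_path \<mu> K \<epsilon> E0 C2 L \<Delta> (real t) (real (last_epoch \<Delta> t x))
  (real (crossings \<Delta> t x)) (cwalk x (last_epoch \<Delta> t x)) (cwalk x t) (excess_fluct \<Delta> t x)
  (mean_excess \<Delta>) m R"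

text \<open>The exceptional set is a union of three events, one for each summand of the bound: the
  walk deviates by more than \<open>K * sqrt t\<close> somewhere up to \<open>t\<close>, it
  fluctuates too much in the last \<open>m\<close> steps, or the overshoot sum is too large.\<close>

lemma good_outside_small_set:
  assumes par: "K > 0" "\<epsilon> > 0" "\<Delta> > 0" "\<Delta> \<ge> \<Delta>0" "2 * E0 \<le> \<Delta>" "t \<ge> 1" "m \<le> t" "real m \<le> real t / 2"
    "\<Delta> + 2 * K * sqrt (real t) \<le> \<mu> * real m" "2 * (K + \<epsilon>) < \<mu> * sqrt (real t)"
  obtains B where "B \<in> sets S" "\<And>x. x \<notin> B \<Longrightarrow> good K \<epsilon> (real m) \<Delta> t x"
    "measure S B \<le> var / K\<^sup>2 + 4 * (real m / real t) * var / \<epsilon>\<^sup>2 +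
      4 / \<epsilon>\<^sup>2 * ((\<integral>x. (excess \<Delta> x)\<^sup>2 \<partial>S) / real t + (\<integral>x. \<bar>x\<bar> \<partial>D) * ((\<integral>x. (excess \<Delta> x)\<^sup>2 \<partial>S) / \<Delta>))"
proof -
  define v where "v = (\<integral>x. (excess \<Delta> x)\<^sup>2 \<partial>S)"
  define m1 where "m1 = (\<integral>x. \<bar>x\<bar> \<partial>D)"
  define s where "s = sqrt (real t)"
  have s: "s > 0" "s\<^sup>2 = real t" using par by (auto simp: s_def)
  \<comment> \<open>Both \<open>increment_inequality\<close> and \<open>excess_fluct_bound\<close>
    lose a factor 2, so they are applied with half of the tolerance
    \<open>\<epsilon> * s\<close>.\<close>
  have bs: "\<epsilon> * s / 2 > 0" using par s by simp
  define B1 where "B1 = {x. \<exists>k\<le>t. K * s < \<bar>cwalk x k\<bar>}"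
  define B2 where "B2 = {x. \<exists>k. t - m \<le> k \<and> k \<le> t \<and> 2 * (\<epsilon> * s / 2) < \<bar>cwalk x t - cwalk x k\<bar>}"
  have "\<exists>B3. B3 \<in> sets S \<and> measure S B3 \<le> (1 + real t * m1 / \<Delta>) * v / (\<epsilon> * s / 2)\<^sup>2 \<and>
    (\<forall>x. x \<notin> B3 \<longrightarrow> \<bar>excess_fluct \<Delta> t x\<bar> < 2 * (\<epsilon> * s / 2))"
    unfolding m1_def v_def
    by (rule excess_fluct_bound[OF par(3) bs, of t], intro exI conjI allI impI) assumption
  then obtain B3 where B3: "B3 \<in> sets S" "measure S B3 \<le> (1 + real t * m1 / \<Delta>) * v / (\<epsilon> * s / 2)\<^sup>2"
    "\<And>x. x \<notin> B3 \<Longrightarrow> \<bar>excess_fluct \<Delta> t x\<bar> < 2 * (\<epsilon> * s / 2)"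
    by (elim exE conjE) (rule that, assumption, assumption, erule allE, erule mp)
  have "Measurable.pred S (\<lambda>x. \<exists>k\<le>t. K * s < \<bar>cwalk x k\<bar>)" by measurable
  then have sets1: "B1 \<in> sets S" unfolding B1_def by (rule Collect_in_sets)
  have "Measurable.pred S (\<lambda>x. \<exists>k. t - m \<le> k \<and> k \<le> t \<and> 2 * (\<epsilon> * s / 2) < \<bar>cwalk x t - cwalk x k\<bar>)" by measurable
  then have sets2: "B2 \<in> sets S" unfolding B2_def by (rule Collect_in_sets)
  note sets = sets1 sets2
  have "measure S B1 \<le> real t * var / (K * s)\<^sup>2"
    unfolding B1_def using par s by (intro maximal_inequality) auto
  also have "\<dots> = var / K\<^sup>2"
    using par s by (simp add: power_mult_distrib)
  finally have p1: "measure S B1 \<le> var / K\<^sup>2" .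
  have "measure S B2 \<le> real m * var / (\<epsilon> * s / 2)\<^sup>2"
    unfolding B2_def using par s by (intro increment_inequality) auto
  also have "\<dots> = 4 * (real m / real t) * var / \<epsilon>\<^sup>2"
    using par s by (simp add: power_mult_distrib power_divide mult_ac)
  finally have p2: "measure S B2 \<le> 4 * (real m / real t) * var / \<epsilon>\<^sup>2" .
  have p3: "measure S B3 \<le> 4 / \<epsilon>\<^sup>2 * (v / real t + m1 * (v / \<Delta>))"
  proof -
    have "(1 + real t * m1 / \<Delta>) * v / (\<epsilon> * s / 2)\<^sup>2 = 4 / \<epsilon>\<^sup>2 * (v / real t + m1 * (v / \<Delta>))"
      using par unfolding power_divide power_mult_distrib s(2) by (simp add: field_simps)
    with B3(2) show ?thesis by simp
  qed
  show thesis
  proof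
    show "B1 \<union> B2 \<union> B3 \<in> sets S" using sets B3(1) by auto
    have "measure S (B1 \<union> B2 \<union> B3) \<le> measure S (B1 \<union> B2) + measure S B3"
      by (rule measure_Un_le) (use sets B3(1) in auto)
    also have "\<dots> \<le> measure S B1 + measure S B2 + measure S B3"
      using measure_Un_le[OF sets] by simp
    finally have "measure S (B1 \<union> B2 \<union> B3) \<le> measure S B1 + measure S B2 + measure S B3" .
    with p1 p2 p3 show "measure S (B1 \<union> B2 \<union> B3) \<le> var / K\<^sup>2 + 4 * (real m / real t) * var / \<epsilon>\<^sup>2 +
      4 / \<epsilon>\<^sup>2 * ((\<integral>x. (excess \<Delta> x)\<^sup>2 \<partial>S) / real t + (\<integral>x. \<bar>x\<bar> \<partial>D) * ((\<integral>x. (excess \<Delta> x)\<^sup>2 \<partial>S) / \<Delta>))"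
      unfolding v_def m1_def by linarith
  next
    fix x assume x: "x \<notin> B1 \<union> B2 \<union> B3"
    let ?T = "last_epoch \<Delta> t x"
    have Tt: "?T \<le> t" by (rule last_crossing_le[OF par(3)])
    have b1: "\<bar>cwalk x k\<bar> \<le> K * s" if "k \<le> t" for k
      using x that by (auto simp: B1_def not_less)
    show "good K \<epsilon> (real m) \<Delta> t x"
      unfolding good_def
    proof unfold_locales
      show "cwalk x ?T + \<mu> * real ?T = real (crossings \<Delta> t x) * \<Delta> +
          real (crossings \<Delta> t x) * mean_excess \<Delta> + excess_fluct \<Delta> t x"
        using psum_last_epoch[OF par(3), of x t] by (simp add: mult.commute)
      show "cwalk x t + \<mu> * real t - (cwalk x ?T + \<mu> * real ?T) < \<Delta>"
        using psum_after_last_crossing[OF par(3), of coord x t] by (simp add: mult.commute)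
      show "\<bar>cwalk x ?T\<bar> \<le> K * sqrt (real t)" "\<bar>cwalk x t\<bar> \<le> K * sqrt (real t)"
        using b1[OF Tt] b1[of t] by (simp_all add: s_def)
      show "\<bar>excess_fluct \<Delta> t x\<bar> \<le> \<epsilon> * sqrt (real t)"
        using B3(3)[of x] x unfolding s_def by simp
      show "\<bar>cwalk x t - cwalk x ?T\<bar> \<le> \<epsilon> * sqrt (real t)" if "real t - real ?T \<le> real m"
      proof -
        have "t - m \<le> ?T" using that par(7) by linarith
        then show ?thesis using x Tt by (auto simp: B2_def s_def not_less)
      qed
      show "\<bar>mean_excess \<Delta> - R \<mu>\<bar> \<le> C2 / \<Delta>" by (rule C2(3)[OF par(4)])
      show "\<bar>mean_excess \<Delta>\<bar> \<le> E0" by (rule E0(2)[OF par(4)])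
      show "L-lipschitz_on {0<..} R" by (rule lip)
    qed (use par mu_pos E0(1) C2(1) Tt in simp_all)
  qed
qed

text \<open>Each of the three failure probabilities receives a third of \<open>\<eta>\<close>.
  \<open>K\<close> depends on \<open>\<eta>\<close> alone; then the window is taken as a small
  proportion \<open>\<theta>\<close> of \<open>t\<close>. It is eventually long enough because
  \<open>\<Delta> + 2 * K * sqrt t\<close> is o(t).\<close>

lemma eventually_good:
  fixes \<Delta> :: "nat \<Rightarrow> real" and t :: "nat \<Rightarrow> nat"
  assumes pos: "\<And>n. \<Delta> n > 0" and Delta: "filterlim \<Delta> at_top sequentially"
    and t: "filterlim t at_top sequentially" and Dt: "(\<lambda>n. \<Delta> n / real (t n)) \<longlonglongrightarrow> 0"
    and eps: "\<epsilon> > 0" "\<eta> > 0"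
  obtains K where "K > 0" "\<forall>\<^sub>F n in sequentially. \<exists>B\<in>sets S. measure S B \<le> \<eta> \<and>
    (\<forall>x. x \<notin> B \<longrightarrow> (\<exists>m. good K \<epsilon> m (\<Delta> n) (t n) x))"
proof -
  define K where "K = sqrt (3 * var / \<eta>)"
  have K: "K > 0" "var / K\<^sup>2 = \<eta> / 3"
    using var_pos eps by (auto simp: K_def)
  \<comment> \<open>The bound 1/2 ensures that the last epoch lies in the second half of the time;
    the other makes the window term \<open>4 * \<theta> * var / \<epsilon>^2\<close> at most
    \<open>\<eta> / 3\<close>.\<close>
  define \<theta> where "\<theta> = min (1/2) (\<eta> * \<epsilon>\<^sup>2 / (12 * var))"
  have \<theta>: "\<theta> > 0" "\<theta> \<le> 1 / 2" "4 * \<theta> * var / \<epsilon>\<^sup>2 \<le> \<eta> / 3"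
  proof -
    show "\<theta> > 0" "\<theta> \<le> 1 / 2" using var_pos eps by (auto simp: \<theta>_def)
    have "\<theta> \<le> \<eta> * \<epsilon>\<^sup>2 / (12 * var)" by (simp add: \<theta>_def)
    then have "\<theta> * (12 * var) \<le> \<eta> * \<epsilon>\<^sup>2" using var_pos by (simp add: pos_le_divide_eq)
    then show "4 * \<theta> * var / \<epsilon>\<^sup>2 \<le> \<eta> / 3" using eps by (simp add: field_simps)
  qed
  define m where "m n = nat \<lfloor>\<theta> * real (t n)\<rfloor>" for n
  have m: "real (m n) \<le> \<theta> * real (t n)" "\<theta> * real (t n) - 1 \<le> real (m n)" for n
    using \<theta>(1) by (auto simp: m_def)
  have rt: "filterlim (\<lambda>n. real (t n)) at_top sequentially"
    by (rule filterlim_compose[OF filterlim_real_sequentially t])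
  have st: "filterlim (\<lambda>n. sqrt (real (t n))) at_top sequentially"
    by (rule filterlim_compose[OF sqrt_at_top rt])
  have it: "(\<lambda>n. 1 / real (t n)) \<longlonglongrightarrow> 0" "(\<lambda>n. 1 / sqrt (real (t n))) \<longlonglongrightarrow> 0"
    using tendsto_inverse_0_at_top[OF rt] tendsto_inverse_0_at_top[OF st] by (simp_all add: inverse_eq_divide)
  define v where "v \<Delta> = (\<integral>x. (excess \<Delta> x)\<^sup>2 \<partial>S)" for \<Delta>
  define m1 where "m1 = (\<integral>x. \<bar>x\<bar> \<partial>D)"
  have vD: "(\<lambda>n. v (\<Delta> n) / \<Delta> n) \<longlonglongrightarrow> 0"
    unfolding v_def by (rule filterlim_compose[OF excess_square_small Delta])
  have "(\<lambda>n. (v (\<Delta> n) / \<Delta> n) * (\<Delta> n / real (t n))) \<longlonglongrightarrow> 0 * 0"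
    by (intro tendsto_mult vD Dt)
  moreover have "\<Delta> n \<noteq> 0" for n
    using pos[of n] by simp
  ultimately have vt: "(\<lambda>n. v (\<Delta> n) / real (t n)) \<longlonglongrightarrow> 0" by simp
  have "(\<lambda>n. 4 / \<epsilon>\<^sup>2 * (v (\<Delta> n) / real (t n) + m1 * (v (\<Delta> n) / \<Delta> n))) \<longlonglongrightarrow> 4 / \<epsilon>\<^sup>2 * (0 + m1 * 0)"
    by (intro tendsto_intros vD vt)
  from order_tendstoD(2)[OF this, of "\<eta> / 3"] have e1: "\<forall>\<^sub>F n in sequentially. 4 / \<epsilon>\<^sup>2 * (v (\<Delta> n) / real (t n) + m1 * (v (\<Delta> n) / \<Delta> n)) < \<eta> / 3"
    using eps by simp
  \<comment> \<open>The last summand \<open>\<mu> / t\<close> pays for rounding the window length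
    \<open>m n\<close> down to an integer.\<close>
  have "(\<lambda>n. \<Delta> n / real (t n) + 2 * K * (1 / sqrt (real (t n))) + \<mu> * (1 / real (t n))) \<longlonglongrightarrow> 0 + 2 * K * 0 + \<mu> * 0"
    by (intro tendsto_intros Dt it)
  from order_tendstoD(2)[OF this, of "\<mu> * \<theta>"] have e2: "\<forall>\<^sub>F n in sequentially. \<Delta> n / real (t n) + 2 * K * (1 / sqrt (real (t n))) + \<mu> * (1 / real (t n)) < \<mu> * \<theta>"
    using mu_pos \<theta>(1) by simp
  have e3: "\<forall>\<^sub>F n in sequentially. 2 * (K + \<epsilon>) / \<mu> < sqrt (real (t n))"
    using st by (simp only: filterlim_at_top_dense)
  have e4: "\<forall>\<^sub>F n in sequentially. \<Delta>0 \<le> \<Delta> n" "\<forall>\<^sub>F n in sequentially. 2 * E0 \<le> \<Delta> n"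
    using Delta by (simp_all only: filterlim_at_top)
  have e5: "\<forall>\<^sub>F n in sequentially. 1 \<le> t n"
    using t by (simp only: filterlim_at_top)
  show thesis
  proof
    show "K > 0" by (rule K)
    show "\<forall>\<^sub>F n in sequentially. \<exists>B\<in>sets S. measure S B \<le> \<eta> \<and>
      (\<forall>x. x \<notin> B \<longrightarrow> (\<exists>m. good K \<epsilon> m (\<Delta> n) (t n) x))"
      using e1 e2 e3 e4 e5
    proof eventually_elim
      case (elim n)
      have tn: "real (t n) > 0" using elim(6) by simp
      have mt: "real (m n) \<le> real (t n) / 2"
        using m(1)[of n] mult_right_mono[OF \<theta>(2), of "real (t n)"] by simp
      have "\<Delta> n + 2 * K * sqrt (real (t n)) + \<mu> =
          (\<Delta> n / real (t n) + 2 * K * (1 / sqrt (real (t n))) + \<mu> * (1 / real (t n))) * real (t n)"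
      proof -
        have h: "1 / sqrt (real (t n)) * real (t n) = sqrt (real (t n))"
          by (simp add: real_div_sqrt)
        have "(\<Delta> n / real (t n) + 2 * K * (1 / sqrt (real (t n))) + \<mu> * (1 / real (t n))) * real (t n) =
            \<Delta> n / real (t n) * real (t n) + 2 * K * (1 / sqrt (real (t n)) * real (t n)) +
            \<mu> * (1 / real (t n) * real (t n))"
          by (simp only: distrib_right mult.assoc)
        also have "\<dots> = \<Delta> n + 2 * K * sqrt (real (t n)) + \<mu>"
          unfolding h using tn by simp
        finally show ?thesis ..
      qed
      also have "\<dots> \<le> \<mu> * \<theta> * real (t n)"
        using elim(2) tn by (intro mult_right_mono) auto
      finally have "\<Delta> n + 2 * K * sqrt (real (t n)) \<le> \<mu> * (\<theta> * real (t n) - 1)"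
        by (simp add: algebra_simps)
      also have "\<dots> \<le> \<mu> * real (m n)"
        using m(2)[of n] mu_pos by (intro mult_left_mono) auto
      finally have c1: "\<Delta> n + 2 * K * sqrt (real (t n)) \<le> \<mu> * real (m n)" .
      have c2: "2 * (K + \<epsilon>) < \<mu> * sqrt (real (t n))"
        using elim(3) mu_pos by (simp add: pos_divide_less_eq mult.commute)
      have c3: "m n \<le> t n" using mt by linarith
      have "\<exists>B. B \<in> sets S \<and> (\<forall>x. x \<notin> B \<longrightarrow> good K \<epsilon> (real (m n)) (\<Delta> n) (t n) x) \<and>
        measure S B \<le> var / K\<^sup>2 + 4 * (real (m n) / real (t n)) * var / \<epsilon>\<^sup>2 +
          4 / \<epsilon>\<^sup>2 * (v (\<Delta> n) / real (t n) + m1 * (v (\<Delta> n) / \<Delta> n))"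
        unfolding v_def m1_def
        by (rule good_outside_small_set[OF K(1) eps(1) pos elim(4,5,6) c3 mt c1 c2], intro exI conjI allI impI) assumption
      then obtain B where B: "B \<in> sets S" "\<forall>x. x \<notin> B \<longrightarrow> good K \<epsilon> (real (m n)) (\<Delta> n) (t n) x"
        "measure S B \<le> var / K\<^sup>2 + 4 * (real (m n) / real (t n)) * var / \<epsilon>\<^sup>2 +
          4 / \<epsilon>\<^sup>2 * (v (\<Delta> n) / real (t n) + m1 * (v (\<Delta> n) / \<Delta> n))"
        by (elim exE conjE) (rule that)
      have "4 * (real (m n) / real (t n)) * var / \<epsilon>\<^sup>2 \<le> 4 * \<theta> * var / \<epsilon>\<^sup>2"
        using m(1)[of n] tn var_pos
        by (intro divide_right_mono mult_right_mono mult_left_mono) (auto simp: pos_divide_le_eq)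
      with B(3) K(2) \<theta>(3) elim(1) have "measure S B \<le> \<eta>" by linarith
      with B(1,2) show ?case by (intro bexI[of _ B] conjI allI impI exI[of _ "real (m n)"]) simp_all
    qed
  qed
qed

section \<open>Limits of the error terms and the limit law on the sequence space\<close>

definition "remainder K \<epsilon> \<Delta> t =
  2 * (2 * (K + \<mu> + \<epsilon>)) * (sqrt t / \<Delta>) * (L * (2 * (K + 2 * \<epsilon>) / sqrt t +
    2 * (2 * (K + \<mu> + \<epsilon>)) * E0 / \<Delta> + \<Delta> / t) + C2 / \<Delta>)"

text \<open>Multiplying the three terms of \<open>dev\<close> by \<open>sqrt t / \<Delta>\<close>
  leaves multiples of \<open>1 / \<Delta>\<close>, \<open>sqrt t / \<Delta>^2\<close> and
  \<open>1 / sqrt t\<close>; the (A2) term gives \<open>sqrt t / \<Delta>^2\<close> once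
  more.\<close>

lemma remainder_tendsto_0:
  fixes \<Delta> :: "nat \<Rightarrow> real" and t :: "nat \<Rightarrow> nat"
  assumes pos: "\<And>n. \<Delta> n > 0" and Delta: "filterlim \<Delta> at_top sequentially"
    and t: "filterlim t at_top sequentially" and sD: "(\<lambda>n. sqrt (real (t n)) / (\<Delta> n)\<^sup>2) \<longlonglongrightarrow> 0"
  shows "(\<lambda>n. remainder K \<epsilon> (\<Delta> n) (real (t n))) \<longlonglongrightarrow> 0"
proof -
  define c where "c = 2 * (K + \<mu> + \<epsilon>)"
  have st: "filterlim (\<lambda>n. sqrt (real (t n))) at_top sequentially"
    by (intro filterlim_compose[OF sqrt_at_top] filterlim_compose[OF filterlim_real_sequentially t])
  have it: "(\<lambda>n. 1 / sqrt (real (t n))) \<longlonglongrightarrow> 0" "(\<lambda>n. 1 / \<Delta> n) \<longlonglongrightarrow> 0"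
    using tendsto_inverse_0_at_top[OF Delta] tendsto_inverse_0_at_top[OF st] by (simp_all add: inverse_eq_divide)
  have "(\<lambda>n. 2 * c * (L * (2 * (K + 2 * \<epsilon>) * (1 / \<Delta> n) + 2 * c * E0 * (sqrt (real (t n)) / (\<Delta> n)\<^sup>2) +
      1 / sqrt (real (t n))) + C2 * (sqrt (real (t n)) / (\<Delta> n)\<^sup>2))) \<longlonglongrightarrow>
      2 * c * (L * (2 * (K + 2 * \<epsilon>) * 0 + 2 * c * E0 * 0 + 0) + C2 * 0)"
    by (intro tendsto_intros it sD)
  then have lim: "(\<lambda>n. 2 * c * (L * (2 * (K + 2 * \<epsilon>) * (1 / \<Delta> n) + 2 * c * E0 * (sqrt (real (t n)) / (\<Delta> n)\<^sup>2) +
      1 / sqrt (real (t n))) + C2 * (sqrt (real (t n)) / (\<Delta> n)\<^sup>2))) \<longlonglongrightarrow> 0" by simp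
  have "\<forall>\<^sub>F n in sequentially. 1 \<le> t n"
    using t by (simp only: filterlim_at_top)
  then have "\<forall>\<^sub>F n in sequentially. 2 * c * (L * (2 * (K + 2 * \<epsilon>) * (1 / \<Delta> n) + 2 * c * E0 * (sqrt (real (t n)) / (\<Delta> n)\<^sup>2) +
      1 / sqrt (real (t n))) + C2 * (sqrt (real (t n)) / (\<Delta> n)\<^sup>2)) = remainder K \<epsilon> (\<Delta> n) (real (t n))"
  proof eventually_elim
    case (elim n)
    define s where "s = sqrt (real (t n))"
    have s: "s > 0" "real (t n) = s\<^sup>2" using elim by (auto simp: s_def)
    show ?case
      unfolding remainder_def c_def[symmetric] s_def[symmetric] s(2)
      using pos[of n] s(1) by (simp add: field_simps power2_eq_square)
  qed
  with lim show ?thesis by (rule Lim_transform_eventually)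
qed

lemma good_estimators:
  assumes "good K \<epsilon> m \<Delta> t x"
  shows "\<bar>sqrt (real t) * (corrected_hat F c coord \<Delta> t x - \<mu>) - cwalk x t / sqrt (real t)\<bar>
      \<le> 3 * \<epsilon> + remainder K \<epsilon> \<Delta> (real t) + 2 * K / \<mu> * (\<Delta> / real t + \<epsilon> / sqrt (real t))"
    and "\<bar>sqrt (real t) * (corrected_check F c coord \<Delta> t x - \<mu>) - cwalk x t / sqrt (real t)\<bar>
      \<le> 3 * \<epsilon> + remainder K \<epsilon> \<Delta> (real t) + \<Delta> / sqrt (real t)"
proof -
  interpret gp: good_path \<mu> K \<epsilon> E0 C2 L \<Delta> "real t" "real (last_epoch \<Delta> t x)"
    "real (crossings \<Delta> t x)" "cwalk x (last_epoch \<Delta> t x)" "cwalk x t" "excess_fluct \<Delta> t x"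
    "mean_excess \<Delta>" m R
    using assms unfolding good_def .
  have err: "gp.err = remainder K \<epsilon> \<Delta> (real t)"
    unfolding gp.err_def gp.dev_def gp.c_def remainder_def ..
  \<comment> \<open>On a good path a period has been completed, so the default value
    \<open>c\<close> is not taken.\<close>
  have N: "crossings \<Delta> t x \<noteq> 0" using gp.N_pos by simp
  show "\<bar>sqrt (real t) * (corrected_hat F c coord \<Delta> t x - \<mu>) - cwalk x t / sqrt (real t)\<bar>
      \<le> 3 * \<epsilon> + remainder K \<epsilon> \<Delta> (real t) + 2 * K / \<mu> * (\<Delta> / real t + \<epsilon> / sqrt (real t))"
    using gp.corrected_hat_close N unfolding err
    by (simp only: corrected_hat_def mu_hat_def bias_correction_def if_False)
  show "\<bar>sqrt (real t) * (corrected_check F c coord \<Delta> t x - \<mu>) - cwalk x t / sqrt (real t)\<bar>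
      \<le> 3 * \<epsilon> + remainder K \<epsilon> \<Delta> (real t) + \<Delta> / sqrt (real t)"
    using gp.corrected_check_close N unfolding err
    by (simp only: corrected_check_def mu_check_def bias_correction_def if_False)
qed

text \<open>\<open>extra\<close> is the part of the error that differs between the two estimators.\<close>

lemma clt_estimator:
  fixes \<Delta> :: "nat \<Rightarrow> real" and t :: "nat \<Rightarrow> nat" and est :: "real \<Rightarrow> nat \<Rightarrow> (nat \<Rightarrow> real) \<Rightarrow> real"
  assumes pos: "\<And>n. \<Delta> n > 0" and Delta: "filterlim \<Delta> at_top sequentially"
    and t: "filterlim t at_top sequentially" and sD: "(\<lambda>n. sqrt (real (t n)) / (\<Delta> n)\<^sup>2) \<longlonglongrightarrow> 0"
    and Dt: "(\<lambda>n. \<Delta> n / real (t n)) \<longlonglongrightarrow> 0"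
    and meas: "\<And>n. est (\<Delta> n) (t n) \<in> borel_measurable S"
    and est: "\<And>K \<epsilon> m n x. good K \<epsilon> m (\<Delta> n) (t n) x \<Longrightarrow>
      \<bar>sqrt (real (t n)) * (est (\<Delta> n) (t n) x - \<mu>) - cwalk x (t n) / sqrt (real (t n))\<bar>
      \<le> 3 * \<epsilon> + remainder K \<epsilon> (\<Delta> n) (real (t n)) + extra K \<epsilon> n"
    and extra: "\<And>K \<epsilon>. extra K \<epsilon> \<longlonglongrightarrow> 0"
  shows "weak_conv_m (\<lambda>n. distr S borel (\<lambda>x. (est (\<Delta> n) (t n) x - \<mu>) / (sqrt var / sqrt (real (t n)))))
    std_normal_distribution"
proof (rule weak_conv_m_close)
  let ?A = "\<lambda>n x. (psum x (t n) - real (t n) * \<mu>) / sqrt (real (t n) * var)"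
  show "prob_space S" by (rule P.prob_space_axioms)
  show "?A n \<in> borel_measurable S" for n by measurable
  show "(\<lambda>x. (est (\<Delta> n) (t n) x - \<mu>) / (sqrt var / sqrt (real (t n)))) \<in> borel_measurable S" for n
    using meas[of n] by measurable
  show "real_distribution std_normal_distribution"
    by (rule real_dist_normal_dist)
  \<comment> \<open>The times \<open>t n\<close> need not be monotone: convergence of the
    distribution functions at each continuity point is composed with the limit of
    \<open>t\<close>.\<close>
  show "weak_conv_m (\<lambda>n. distr S borel (?A n)) std_normal_distribution"
    unfolding weak_conv_m_def weak_conv_def
  proof (intro allI impI)
    fix u assume "isCont (cdf std_normal_distribution) u"
    with clt_walk[OF var_pos]
    have "(\<lambda>n. cdf (distr S borel (\<lambda>x. cwalk x n / sqrt (real n * var))) u) \<longlonglongrightarrow> cdf std_normal_distribution u"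
      unfolding weak_conv_m_def weak_conv_def by blast
    from filterlim_compose[OF this t]
    show "(\<lambda>n. cdf (distr S borel (?A n)) u) \<longlonglongrightarrow> cdf std_normal_distribution u" .
  qed
  fix d :: real assume d: "d > 0"
  \<comment> \<open>Half of the tolerance \<open>sqrt var * d\<close> goes to
    \<open>3 * \<epsilon>\<close>, the other half to \<open>remainder\<close> and
    \<open>extra\<close>, which vanish for fixed \<open>K\<close> and
    \<open>\<epsilon>\<close>.\<close>
  define \<epsilon> where "\<epsilon> = sqrt var * d / 6"
  have \<epsilon>: "\<epsilon> > 0" "3 * \<epsilon> = sqrt var * d / 2" using d var_pos by (auto simp: \<epsilon>_def)
  obtain K where K: "K > 0" "\<forall>\<^sub>F n in sequentially. \<exists>B\<in>sets S. measure S B \<le> d \<and>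
    (\<forall>x. x \<notin> B \<longrightarrow> (\<exists>m. good K \<epsilon> m (\<Delta> n) (t n) x))"
    using eventually_good[OF pos Delta t Dt \<epsilon>(1) d] by blast
  have "(\<lambda>n. remainder K \<epsilon> (\<Delta> n) (real (t n)) + extra K \<epsilon> n) \<longlonglongrightarrow> 0 + 0"
    by (intro tendsto_add extra remainder_tendsto_0[OF pos Delta t sD])
  from order_tendstoD(2)[OF this, of "sqrt var * d / 2"] have rem: "\<forall>\<^sub>F n in sequentially. remainder K \<epsilon> (\<Delta> n) (real (t n)) + extra K \<epsilon> n < sqrt var * d / 2"
    using d var_pos by simp
  have "\<forall>\<^sub>F n in sequentially. 1 \<le> t n"
    using t by (simp only: filterlim_at_top)
  then show "\<forall>\<^sub>F n in sequentially. \<exists>N\<in>sets S. measure S N \<le> d \<and>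
      (\<forall>x\<in>space S - N. \<bar>(est (\<Delta> n) (t n) x - \<mu>) / (sqrt var / sqrt (real (t n))) - ?A n x\<bar> \<le> d)"
    using K(2) rem
  proof eventually_elim
    case (elim n)
    then obtain B where B: "B \<in> sets S" "measure S B \<le> d" "\<And>x. x \<notin> B \<Longrightarrow> \<exists>m. good K \<epsilon> m (\<Delta> n) (t n) x"
      by blast
    have close: "\<bar>(est (\<Delta> n) (t n) x - \<mu>) / (sqrt var / sqrt (real (t n))) - ?A n x\<bar> \<le> d" if "x \<notin> B" for x
    proof -
      from B(3)[OF that] obtain m where "good K \<epsilon> m (\<Delta> n) (t n) x" ..
      from est[OF this] have le: "\<bar>sqrt (real (t n)) * (est (\<Delta> n) (t n) x - \<mu>) - cwalk x (t n) / sqrt (real (t n))\<bar> \<le> sqrt var * d"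
        using elim(3) \<epsilon>(2) by linarith
      have "(est (\<Delta> n) (t n) x - \<mu>) / (sqrt var / sqrt (real (t n))) - ?A n x =
          (sqrt (real (t n)) * (est (\<Delta> n) (t n) x - \<mu>) - cwalk x (t n) / sqrt (real (t n))) / sqrt var"
        using var_pos elim(1) by (simp add: real_sqrt_mult diff_divide_distrib mult.commute)
      with le show ?thesis
        using var_pos by (simp add: abs_divide pos_divide_le_eq mult.commute)
    qed
    show ?case using B(1,2) close by (intro bexI[of _ B]) auto
  qed
qed

end

section \<open>Transfer from the sequence space\<close>

text \<open>Independence makes the joint law over the index set \<open>{1..}\<close> a product
  measure, and reindexing along \<open>Suc\<close> moves it to the canonical sequence space. Results
  about coordinates on \<open>S\<close> then hold for \<open>X\<close> under
  \<open>M\<close>.\<close>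

lemma (in prob_space) distr_path_eq_PiM:
  fixes X :: "nat \<Rightarrow> 'a \<Rightarrow> real"
  assumes indep: "indep_vars (\<lambda>_. borel) X {1..}" and law: "\<And>i. i \<ge> 1 \<Longrightarrow> distr M borel (X i) = D"
  shows "(\<lambda>\<omega> i. X (Suc i) \<omega>) \<in> measurable M (\<Pi>\<^sub>M i\<in>(UNIV :: nat set). D)"
    and "distr M (\<Pi>\<^sub>M i\<in>(UNIV :: nat set). D) (\<lambda>\<omega> i. X (Suc i) \<omega>) = (\<Pi>\<^sub>M i\<in>UNIV. D)"
proof -
  have rv: "X i \<in> borel_measurable M" if "i \<ge> 1" for i
    using indep that by (simp add: indep_vars_def2)
  have sets_D: "sets D = sets borel" using law[of 1] by auto
  have prob_D: "prob_space D"
    using prob_space_distr[OF rv[of 1]] law[of 1] by simp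
  have meas: "X (Suc i) \<in> measurable M D" for i
    using rv[of "Suc i"] measurable_cong_sets[OF refl sets_D, of M] by simp
  show path: "(\<lambda>\<omega> i. X (Suc i) \<omega>) \<in> measurable M (\<Pi>\<^sub>M i\<in>(UNIV :: nat set). D)"
    by (rule measurable_abs_UNIV) (rule meas)
  let ?Y = "\<lambda>\<omega>. \<lambda>i\<in>{1..}. X i \<omega>" and ?N = "\<Pi>\<^sub>M i\<in>{1::nat..}. (borel :: real measure)"
  have "distr M ?N ?Y = (\<Pi>\<^sub>M i\<in>{1..}. distr M borel (X i))"
    using indep_vars_iff_distr_eq_PiM'[of "{1..}" X "\<lambda>_. borel"] rv indep by simp
  also have "\<dots> = (\<Pi>\<^sub>M i\<in>{1::nat..}. D)"
    by (rule PiM_cong) (auto simp: law)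
  finally have Y: "distr M ?N ?Y = (\<Pi>\<^sub>M i\<in>{1::nat..}. D)" .
  have sets_N: "sets ?N = sets (\<Pi>\<^sub>M i\<in>{1::nat..}. D)"
    by (rule sets_PiM_cong) (auto simp: sets_D)
  have Y_meas: "?Y \<in> measurable M ?N"
    by (rule measurable_restrict) (use rv in auto)
  have Suc_meas: "(\<lambda>\<omega>. \<lambda>n\<in>UNIV. \<omega> (Suc n)) \<in> measurable ?N (\<Pi>\<^sub>M i\<in>(UNIV :: nat set). D)"
  proof (rule measurable_restrict)
    fix n :: nat
    have "(\<lambda>\<omega>. \<omega> (Suc n)) \<in> measurable ?N borel"
      by (rule measurable_component_singleton) simp
    then show "(\<lambda>\<omega>. \<omega> (Suc n)) \<in> measurable ?N D"
      using measurable_cong_sets[OF refl sets_D] by blast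
  qed
  have "(\<Pi>\<^sub>M i\<in>(UNIV :: nat set). D) =
      distr (\<Pi>\<^sub>M i\<in>{1::nat..}. D) (\<Pi>\<^sub>M i\<in>UNIV. D) (\<lambda>\<omega>. \<lambda>n\<in>UNIV. \<omega> (Suc n))"
    using distr_PiM_reindex[of "{1::nat..}" "\<lambda>_. D" Suc UNIV] prob_D by simp
  also have "\<dots> = distr M (\<Pi>\<^sub>M i\<in>UNIV. D) ((\<lambda>\<omega>. \<lambda>n\<in>UNIV. \<omega> (Suc n)) \<circ> ?Y)"
    unfolding Y[symmetric] by (rule distr_distr[OF Suc_meas Y_meas])
  also have "(\<lambda>\<omega>. \<lambda>n\<in>UNIV. \<omega> (Suc n)) \<circ> ?Y = (\<lambda>\<omega> i. X (Suc i) \<omega>)"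
    by (auto simp: fun_eq_iff)
  finally show "distr M (\<Pi>\<^sub>M i\<in>(UNIV :: nat set). D) (\<lambda>\<omega> i. X (Suc i) \<omega>) = (\<Pi>\<^sub>M i\<in>UNIV. D)" ..
qed

theorem theorem3p3:
  fixes F :: "real \<Rightarrow> real measure"
    and M :: "'a measure"
    and X :: "nat \<Rightarrow> 'a \<Rightarrow> real"
    and \<mu> \<sigma> c :: real
  assumes family:
      "\<And>m. m > 0 \<Longrightarrow> real_distribution (F m)"
      "\<And>m. m > 0 \<Longrightarrow> integrable (F m) (\<lambda>x. x\<^sup>2)"
      "\<And>m. m > 0 \<Longrightarrow> (\<integral>x. x \<partial>F m) = m"
    and mu: "\<mu> > 0"
    and space: "prob_space M"
    and indep: "prob_space.indep_vars M (\<lambda>_. borel) X {1..}"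
    and law: "\<And>i. i \<ge> 1 \<Longrightarrow> distr M borel (X i) = F \<mu>"
    and sigma: "\<sigma> = sqrt (prob_space.variance M (X 1))" "\<sigma> > 0"
    and nonlattice:
      "\<not> (\<exists>d>0. measure M {\<omega> \<in> space M. \<exists>k::int. X 1 \<omega> = d * of_int k} = 1)"
    and A1: "\<exists>r\<ge>2. integrable M (\<lambda>\<omega>. \<bar>X 1 \<omega>\<bar> powr (r + 1))"
    and A2: "\<exists>r\<ge>2. (\<lambda>\<Delta>. \<bar>(\<integral>\<omega>. overshoot X \<Delta> \<omega> \<partial>M) - rho (F \<mu>)\<bar>)
                     \<in> O[at_top](\<lambda>\<Delta>. \<Delta> powr (- (r - 1)))"
    and A3: "\<exists>L. L-lipschitz_on {0<..} (\<lambda>m. rho (F m))"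
  shows
    "(\<forall>(\<Delta> :: nat \<Rightarrow> real) (t :: nat \<Rightarrow> nat).
        (\<forall>n. \<Delta> n > 0) \<longrightarrow>
        filterlim \<Delta> at_top sequentially \<longrightarrow>
        filterlim t at_top sequentially \<longrightarrow>
        (\<lambda>n. real (t n) powr (1/4)) \<in> o(\<lambda>n. mean_period M X (\<Delta> n)) \<longrightarrow>
        (\<lambda>n. mean_period M X (\<Delta> n)) \<in> o(\<lambda>n. sqrt (real (t n))) \<longrightarrow>
        weak_conv_m
          (\<lambda>n. distr M borel
             (\<lambda>\<omega>. (corrected_check F c X (\<Delta> n) (t n) \<omega> - \<mu>) / (\<sigma> / sqrt (real (t n)))))
          std_normal_distribution)
   \<and> (\<forall>(\<Delta> :: nat \<Rightarrow> real) (t :: nat \<Rightarrow> nat).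
        (\<forall>n. \<Delta> n > 0) \<longrightarrow>
        filterlim \<Delta> at_top sequentially \<longrightarrow>
        filterlim t at_top sequentially \<longrightarrow>
        (\<lambda>n. real (t n) powr (1/4)) \<in> o(\<lambda>n. mean_period M X (\<Delta> n)) \<longrightarrow>
        (\<lambda>n. mean_period M X (\<Delta> n)) \<in> o(\<lambda>n. real (t n)) \<longrightarrow>
        weak_conv_m
          (\<lambda>n. distr M borel
             (\<lambda>\<omega>. (corrected_hat F c X (\<Delta> n) (t n) \<omega> - \<mu>) / (\<sigma> / sqrt (real (t n)))))
          std_normal_distribution)"
proof -
  interpret PM: prob_space M by (rule space)
  define D where "D = F \<mu>"
  have D: "real_distribution D" "(\<integral>x. x \<partial>D) = \<mu>"
    using family(1,3)[OF mu] by (simp_all add: D_def)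
  interpret RD: real_distribution D by (rule D)
  interpret iid_steps D
  proof
    show "sets D = sets borel" by simp
  qed
  have rv: "X i \<in> borel_measurable M" if "i \<ge> 1" for i
    using indep that by (simp add: PM.indep_vars_def2)
  have lawD: "distr M borel (X i) = D" if "i \<ge> 1" for i
    unfolding D_def using that by (rule law)
  note law1 = lawD[OF order_refl]
  have third: "integrable D (\<lambda>x. \<bar>x\<bar> ^ 3)"
  proof -
    from A1 obtain r :: real where r: "r \<ge> 2" "integrable M (\<lambda>\<omega>. \<bar>X 1 \<omega>\<bar> powr (r + 1))" by blast
    have "integrable (distr M borel (X 1)) (\<lambda>x. \<bar>x\<bar> powr (r + 1))"
      by (subst integrable_distr_eq) (use r rv in auto)
    then have i: "integrable D (\<lambda>x. 1 + \<bar>x\<bar> powr (r + 1))"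
      unfolding law1 by simp
    have "\<bar>x\<bar> ^ 3 \<le> 1 + \<bar>x\<bar> powr (r + 1)" for x :: real
    proof (cases "\<bar>x\<bar> \<le> 1")
      case True
      then have "\<bar>x\<bar> ^ 3 \<le> 1" by (simp add: power_le_one)
      then show ?thesis using powr_ge_zero[of "\<bar>x\<bar>" "r + 1"] by linarith
    next
      case False
      then have "\<bar>x\<bar> ^ 3 = \<bar>x\<bar> powr 3" by (simp add: powr_numeral)
      also have "\<dots> \<le> \<bar>x\<bar> powr (r + 1)" using False r(1) by (intro powr_mono) auto
      finally show ?thesis by simp
    qed
    then show ?thesis
      by (intro Bochner_Integration.integrable_bound[OF i]) auto
  qed
  interpret walk_law D \<mu>
    by unfold_locales (use mu D(2) third in auto)
  let ?path = "\<lambda>\<omega> i. X (Suc i) \<omega>"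
  have path_meas [measurable]: "?path \<in> measurable M S"
    and path: "distr M S ?path = S"
    by (rule PM.distr_path_eq_PiM[OF indep lawD]; assumption)+
  have X1: "(\<integral>\<omega>. f (X 1 \<omega>) \<partial>M) = (\<integral>x. f x \<partial>D)" if "f \<in> borel_measurable borel" for f :: "real \<Rightarrow> real"
    unfolding law1[symmetric] by (rule integral_distr[symmetric, OF rv[OF order_refl] that])
  have EX: "PM.expectation (X 1) = \<mu>"
    using X1[of "\<lambda>x. x"] D(2) by simp
  have "var = PM.variance (X 1)"
    unfolding var_def EX by (rule X1[symmetric]) measurable
  with sigma have \<sigma>: "\<sigma> = sqrt var" "var > 0" by auto
  have mean_excess: "(\<integral>\<omega>. overshoot X \<Delta> \<omega> \<partial>M) = mean_excess \<Delta>" for \<Delta>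
  proof -
    have "mean_excess \<Delta> = (\<integral>x. excess \<Delta> x \<partial>distr M S ?path)"
      by (simp only: mean_excess_def path)
    also have "\<dots> = (\<integral>\<omega>. excess \<Delta> (?path \<omega>) \<partial>M)"
      by (rule integral_distr[OF path_meas measurable_excess])
    finally show ?thesis by (simp only: overshoot_eq_excess)
  qed
  have period: "mean_period M X \<Delta> = period \<Delta>" if "\<Delta> > 0" for \<Delta>
  proof -
    have "(\<integral>\<^sup>+\<omega>. ennreal_of_enat (crossing_time X \<Delta> 1 \<omega>) \<partial>M) =
        (\<integral>\<^sup>+\<omega>. ennreal_of_enat (crossing_time coord \<Delta> 1 (?path \<omega>)) \<partial>M)"
      by (simp only: crossing_time_coord[of X])
    also have "\<dots> = (\<integral>\<^sup>+x. ennreal_of_enat (crossing_time coord \<Delta> 1 x) \<partial>distr M S ?path)"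
    proof (rule nn_integral_distr[symmetric, OF path_meas])
      have "(\<lambda>x. ennreal_of_enat (crossing_time coord \<Delta> 1 x)) \<in> borel_measurable S"
        by (rule measurable_compose[OF measurable_crossing_time]) simp
      then show "(\<lambda>x. ennreal_of_enat (crossing_time coord \<Delta> 1 x)) \<in> borel_measurable (distr M S ?path)"
        by (simp only: path)
    qed
    finally show ?thesis
      unfolding path using mean_period_eq_period[OF that] by (simp only: mean_period_def)
  qed
  obtain r :: real where r: "r \<ge> 2"
    "(\<lambda>\<Delta>. \<bar>mean_excess \<Delta> - rho (F \<mu>)\<bar>) \<in> O[at_top](\<lambda>\<Delta>. \<Delta> powr (- (r - 1)))"
    using A2 unfolding mean_excess by blast
  obtain C where C: "C > 0"
    "\<forall>\<^sub>F \<Delta> in at_top. norm \<bar>mean_excess \<Delta> - rho (F \<mu>)\<bar> \<le> C * norm (\<Delta> powr (- (r - 1)))"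
    by (rule landau_o.bigE[OF r(2)])
  then obtain \<Delta>1 where \<Delta>1: "\<bar>mean_excess \<Delta> - rho (F \<mu>)\<bar> \<le> C * \<Delta> powr (- (r - 1))" if "\<Delta> \<ge> \<Delta>1" for \<Delta>
    unfolding eventually_at_top_linorder by auto
  \<comment> \<open>For \<open>\<Delta> \<ge> 1\<close> and \<open>r \<ge> 2\<close> the rate of
    (A2) is at most \<open>1 / \<Delta>\<close>.\<close>
  have C_bound: "\<bar>mean_excess \<Delta> - rho (F \<mu>)\<bar> \<le> C / \<Delta>" if "\<Delta> \<ge> max 1 \<Delta>1" for \<Delta>
  proof -
    have "\<Delta> powr (- (r - 1)) \<le> \<Delta> powr (-1)"
      using that r(1) by (intro powr_mono) auto
    also have "\<dots> = 1 / \<Delta>" using that by (simp add: powr_minus_divide)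
    finally have "C * \<Delta> powr (- (r - 1)) \<le> C * (1 / \<Delta>)"
      using C(1) by (intro mult_left_mono) auto
    moreover have "\<bar>mean_excess \<Delta> - rho (F \<mu>)\<bar> \<le> C * \<Delta> powr (- (r - 1))"
      using \<Delta>1[of \<Delta>] that by simp
    ultimately show ?thesis by simp
  qed
  from A3 obtain L where L: "L-lipschitz_on {0<..} (\<lambda>m. rho (F m))" by blast
  interpret estimation D \<mu> F L C "max 1 \<Delta>1"
    by unfold_locales (use \<sigma> L C(1) C_bound in simp_all)

  have transfer: "distr M borel (\<lambda>\<omega>. (est (?path \<omega>) - \<mu>) / (\<sigma> / sqrt u)) =
      distr S borel (\<lambda>x. (est x - \<mu>) / (sqrt var / sqrt u))"
    if [measurable]: "est \<in> borel_measurable S" for est :: "(nat \<Rightarrow> real) \<Rightarrow> real" and u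
  proof -
    have "distr S borel (\<lambda>x. (est x - \<mu>) / (sqrt var / sqrt u)) =
        distr (distr M S ?path) borel (\<lambda>x. (est x - \<mu>) / (sqrt var / sqrt u))"
      by (simp only: path)
    also have "\<dots> = distr M borel ((\<lambda>x. (est x - \<mu>) / (sqrt var / sqrt u)) \<circ> ?path)"
      by (rule distr_distr) measurable
    finally show ?thesis by (simp add: \<sigma>(1) comp_def)
  qed

  \<comment> \<open>Next, \<delta> and \<open>\<Delta>\<close> are shown to be of the same order.
    The bound \<open>\<Delta> \<le> m1 * period \<Delta>\<close> transfers the upper growth
    conditions in \<open>level_small\<close>; \<open>period \<Delta> \<le> C3 * \<Delta>\<close>
    transfers the lower one in \<open>quad\<close>.\<close>
  define m1 where "m1 = (\<integral>x. \<bar>x\<bar> \<partial>D)"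
  define C3 where "C3 = 2 * (1 + level_slack) / \<mu>"
  have slack: "level_slack \<ge> 0"
    using mu second_moment_pos by (simp add: level_slack_def)
  have period_pos: "period \<Delta> > 0" and level_le: "\<Delta> \<le> m1 * period \<Delta>" if "\<Delta> > 0" for \<Delta>
  proof -
    show "\<Delta> \<le> m1 * period \<Delta>"
      using level_le_period[OF that] by (simp add: m1_def mult.commute)
    then have "0 < m1 * period \<Delta>" using that by simp
    moreover have "m1 \<ge> 0" by (simp add: m1_def)
    ultimately show "period \<Delta> > 0" by (simp add: zero_less_mult_iff)
  qed
  have period_le': "period \<Delta> \<le> C3 * \<Delta>" if "\<Delta> \<ge> 1" for \<Delta>
  proof -
    have "period \<Delta> \<le> 2 * (\<Delta> + level_slack) / \<mu>" using that by (intro period_le) simp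
    also have "\<dots> \<le> 2 * (\<Delta> + level_slack * \<Delta>) / \<mu>"
      using mu slack that mult_left_mono[OF that slack] by (intro divide_right_mono) auto
    also have "\<dots> = C3 * \<Delta>" by (simp add: C3_def algebra_simps)
    finally show ?thesis .
  qed
  have level_small: "(\<lambda>n. \<Delta> n / g n) \<longlonglongrightarrow> 0"
    if pos: "\<And>n. \<Delta> n > 0" and small: "(\<lambda>n. mean_period M X (\<Delta> n)) \<in> o(g)" and g: "\<And>n. g n \<ge> 0"
    for \<Delta> g :: "nat \<Rightarrow> real"
  proof (rule tendsto_sandwich[OF _ _ tendsto_const])
    show "\<forall>\<^sub>F n in sequentially. 0 \<le> \<Delta> n / g n"
      using pos g by (intro always_eventually allI divide_nonneg_nonneg) (auto intro: less_imp_le)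
    show "\<forall>\<^sub>F n in sequentially. \<Delta> n / g n \<le> m1 * (mean_period M X (\<Delta> n) / g n)"
      using level_le[OF pos] g by (intro always_eventually allI) (auto simp: period[OF pos] intro!: divide_right_mono)
    have "(\<lambda>n. m1 * (mean_period M X (\<Delta> n) / g n)) \<longlonglongrightarrow> m1 * 0"
      by (intro tendsto_mult_left smalloD_tendsto[OF small])
    then show "(\<lambda>n. m1 * (mean_period M X (\<Delta> n) / g n)) \<longlonglongrightarrow> 0" by simp
  qed
  have quad: "(\<lambda>n. sqrt (real (t n)) / (\<Delta> n)\<^sup>2) \<longlonglongrightarrow> 0"
    if pos: "\<And>n. \<Delta> n > 0" and lim: "filterlim \<Delta> at_top sequentially"
      and small: "(\<lambda>n. real (t n) powr (1/4)) \<in> o(\<lambda>n. mean_period M X (\<Delta> n))"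
    for \<Delta> :: "nat \<Rightarrow> real" and t :: "nat \<Rightarrow> nat"
  proof -
    let ?q = "\<lambda>n. real (t n) powr (1/4)"
    have "(\<lambda>n. ?q n / \<Delta> n) \<longlonglongrightarrow> 0"
    proof (rule tendsto_sandwich[OF _ _ tendsto_const])
      show "\<forall>\<^sub>F n in sequentially. 0 \<le> ?q n / \<Delta> n"
        using pos by (intro always_eventually allI divide_nonneg_nonneg) (auto intro: less_imp_le)
      have "\<forall>\<^sub>F n in sequentially. 1 \<le> \<Delta> n"
        using lim by (simp only: filterlim_at_top)
      then show "\<forall>\<^sub>F n in sequentially. ?q n / \<Delta> n \<le> C3 * (?q n / mean_period M X (\<Delta> n))"
      proof eventually_elim
        case (elim n)
        have "?q n * period (\<Delta> n) \<le> ?q n * (C3 * \<Delta> n)"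
          using period_le'[OF elim] by (intro mult_left_mono) auto
        then show ?case
          using period_pos[OF pos[of n]] pos[of n] unfolding period[OF pos]
          by (simp add: field_simps)
      qed
      have "(\<lambda>n. C3 * (?q n / mean_period M X (\<Delta> n))) \<longlonglongrightarrow> C3 * 0"
        by (intro tendsto_mult_left smalloD_tendsto[OF small])
      then show "(\<lambda>n. C3 * (?q n / mean_period M X (\<Delta> n))) \<longlonglongrightarrow> 0" by simp
    qed
    from tendsto_power[OF this, of 2] have "(\<lambda>n. (?q n / \<Delta> n)\<^sup>2) \<longlonglongrightarrow> 0" by simp
    moreover have "(?q n / \<Delta> n)\<^sup>2 = sqrt (real (t n)) / (\<Delta> n)\<^sup>2" for n
    proof -
      have "(?q n)\<^sup>2 = real (t n) powr (1/4 + 1/4)"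
        by (simp only: powr_add power2_eq_square)
      also have "\<dots> = sqrt (real (t n))" by (simp add: powr_half_sqrt)
      finally show ?thesis by (simp only: power_divide)
    qed
    ultimately show ?thesis by simp
  qed
  have inv_sqrt: "(\<lambda>n. 1 / sqrt (real (t n))) \<longlonglongrightarrow> 0" if "filterlim t at_top sequentially" for t :: "nat \<Rightarrow> nat"
  proof -
    have "filterlim (\<lambda>n. sqrt (real (t n))) at_top sequentially"
      by (intro filterlim_compose[OF sqrt_at_top] filterlim_compose[OF filterlim_real_sequentially that])
    from tendsto_inverse_0_at_top[OF this] show ?thesis by (simp add: inverse_eq_divide)
  qed

  show ?thesis
  proof (intro conjI allI impI)
    fix \<Delta> :: "nat \<Rightarrow> real" and t :: "nat \<Rightarrow> nat"
    assume pos: "\<forall>n. \<Delta> n > 0" and lim: "filterlim \<Delta> at_top sequentially" "filterlim t at_top sequentially"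
      and small: "(\<lambda>n. real (t n) powr (1/4)) \<in> o(\<lambda>n. mean_period M X (\<Delta> n))"
        "(\<lambda>n. mean_period M X (\<Delta> n)) \<in> o(\<lambda>n. sqrt (real (t n)))"
    have p: "\<Delta> n > 0" for n using pos by simp
    have Ds: "(\<lambda>n. \<Delta> n / sqrt (real (t n))) \<longlonglongrightarrow> 0"
      by (rule level_small[OF p small(2)]) simp
    \<comment> \<open>The stronger condition of part (i) implies the one on
      \<open>\<Delta> / t\<close> that \<open>clt_estimator\<close> requires for either
      estimator.\<close>
    have "(\<lambda>n. \<Delta> n / sqrt (real (t n)) * (1 / sqrt (real (t n)))) \<longlonglongrightarrow> 0 * 0"
      by (intro tendsto_mult Ds inv_sqrt lim)
    then have Dt: "(\<lambda>n. \<Delta> n / real (t n)) \<longlonglongrightarrow> 0" by simp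
    show "weak_conv_m (\<lambda>n. distr M borel
        (\<lambda>\<omega>. (corrected_check F c X (\<Delta> n) (t n) \<omega> - \<mu>) / (\<sigma> / sqrt (real (t n))))) std_normal_distribution"
      unfolding estimators_coord(2)[of F c X] transfer[OF measurable_estimators(2)[OF p]]
    proof (rule clt_estimator[where extra="\<lambda>K \<epsilon> n. \<Delta> n / sqrt (real (t n))", OF p lim quad[OF p lim(1) small(1)] Dt])
      show "corrected_check F c coord (\<Delta> n) (t n) \<in> borel_measurable S" for n
        by (rule measurable_estimators(2)[OF p])
    qed (rule good_estimators(2) Ds; assumption?)+
  next
    fix \<Delta> :: "nat \<Rightarrow> real" and t :: "nat \<Rightarrow> nat"
    assume pos: "\<forall>n. \<Delta> n > 0" and lim: "filterlim \<Delta> at_top sequentially" "filterlim t at_top sequentially"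
      and small: "(\<lambda>n. real (t n) powr (1/4)) \<in> o(\<lambda>n. mean_period M X (\<Delta> n))"
        "(\<lambda>n. mean_period M X (\<Delta> n)) \<in> o(\<lambda>n. real (t n))"
    have p: "\<Delta> n > 0" for n using pos by simp
    have Dt: "(\<lambda>n. \<Delta> n / real (t n)) \<longlonglongrightarrow> 0"
      by (rule level_small[OF p small(2)]) simp
    have extra: "(\<lambda>n. 2 * K / \<mu> * (\<Delta> n / real (t n) + \<epsilon> / sqrt (real (t n)))) \<longlonglongrightarrow> 0" for K \<epsilon>
    proof -
      have "(\<lambda>n. 2 * K / \<mu> * (\<Delta> n / real (t n) + \<epsilon> * (1 / sqrt (real (t n))))) \<longlonglongrightarrow> 2 * K / \<mu> * (0 + \<epsilon> * 0)"
        by (intro tendsto_intros Dt inv_sqrt lim)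
      then show ?thesis by simp
    qed
    show "weak_conv_m (\<lambda>n. distr M borel
        (\<lambda>\<omega>. (corrected_hat F c X (\<Delta> n) (t n) \<omega> - \<mu>) / (\<sigma> / sqrt (real (t n))))) std_normal_distribution"
      unfolding estimators_coord(1)[of F c X] transfer[OF measurable_estimators(1)[OF p]]
    proof (rule clt_estimator[where extra="\<lambda>K \<epsilon> n. 2 * K / \<mu> * (\<Delta> n / real (t n) + \<epsilon> / sqrt (real (t n)))",
          OF p lim quad[OF p lim(1) small(1)] Dt])
      show "corrected_hat F c coord (\<Delta> n) (t n) \<in> borel_measurable S" for n
        by (rule measurable_estimators(1)[OF p])
    qed (rule good_estimators(1) extra; assumption?)+
  qed
qed

end
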